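(* 1. When $d$ is odd, the orbit under the action of the structure group of the set of extendable indecomposable $\mathrm{u}_q^+$-modules is $\mathrm{Ind}\,\mathrm{u}_q^+$, i.e. every indecomposable $\mathrm{u}_q^+$-module is isomorphic to $S\otimes X$ with $S$ simple and $X$ indecomposable extendable. Hence the maps $\mathrm{id}_S\otimes\tau R$ induce isomorphisms of $\mathrm{u}_q^+$-modules $M_i^u\otimes M_j^v\cong M_j^v\otimes M_i^u$ for all $i,j\in\mathbb{Z}/d\mathbb{Z}$ and $0\le u,v\le d-1$. 2. When $d$ is even, the orbit under the action of the structure group of the set of extendable indecomposable $\mathrm{u}_q^+$-modules covers all the indecomposable $\mathrm{u}_q^+$-modules whose dimension over $\mathbb{C}$ is odd. Hence the maps $\mathrm{id}_S\otimes\tau R$ induce isomorphisms of $\mathrm{u}_q^+$-modules $M_i^u\otimes M_j^v\cong M_j^v\otimes M_i^u$ for all $i,j\in\mathbb{Z}/d\mathbb{Z}$ and all even $u,v$ with $0\le u,v\le d-1$.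
   Context: Let $q\in\mathbb{C}$ be a primitive $n$-th root of unity with $n\ge 3$, $n\ne 4$, and set $d=n$ if $n$ is odd, $d=n/2$ if $n$ is even. The Hopf algebra $\mathrm{u}_q=\mathrm{u}_q(\mathfrak{sl}_2(\mathbb{C}))$ is the $\mathbb{C}$-algebra generated by $E,F,K$ with relations $E^d=F^d=0$, $K^d=1$, $KE=q^2EK$, $KF=q^{-2}FK$, $EF-FE=\frac{K-K^{-1}}{q-q^{-1}}$, with $\Delta(E)=1\otimes E+E\otimes K$, $\Delta(F)=K^{-1}\otimes F+F\otimes 1$, $\Delta(K)=K\otimes K$; $\mathrm{u}_q^+$ is its sub-Hopf algebra generated by $E$ and $K$. Tensor products are over $\mathbb{C}$, with module structure through $\Delta$. For $i\in\mathbb{Z}/d\mathbb{Z}$ and $0\le u\le d-1$, $M_i^u$ is the $\mathrm{u}_q^+$-module with $\mathbb{C}$-basis $e_i^0,\dots,e_i^u$ and action $Ke_i^j=q^{2(i+j)}e_i^j$, $Ee_i^j=e_i^{j+1}$ for $0\le j\le u-1$, $Ee_i^u=0$. These form a complete list of pairwise non-isomorphic indecomposable $\mathrm{u}_q^+$-modules; $\mathrm{Ind}\,\mathrm{u}_q^+$ denotes the set of (isomorphism classes of) indecomposable finite-dimensional $\mathrm{u}_q^+$-modules. The simple modules are $S_i=M_i^0$. The structure group is the group of isomorphism classes of simple $\mathrm{u}_q^+$-modules under $\otimes$; it acts on isomorphism classes of $\mathrm{u}_q^+$-modules by $[S]\cdot[M]=[S\otimes M]$. A $\mathrm{u}_q^+$-module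 is extendable if there is a $\mathrm{u}_q$-module structure on it whose restriction to $\mathrm{u}_q^+$ is the given action. The $R$-matrix of $\mathrm{u}_q$ is $$R=\frac1d\sum_{0\le i,j,k\le d-1}\frac{(q-q^{-1})^k}{[k]!}\,q^{k(k-1)/2+2k(i-j)-2ij}\,E^kK^i\otimes F^kK^j,$$ where $[x]=\frac{q^x-q^{-x}}{q-q^{-1}}$ and $[k]!=[1][2]\cdots[k]$. For $\mathrm{u}_q$-modules $X,Y$, with $\tau$ the flip $\tau(x\otimes y)=y\otimes x$, the map $\tau R:X\otimes Y\to Y\otimes X$ is an isomorphism of $\mathrm{u}_q$-modules. If $M\cong S'\otimes X$ and $N\cong S''\otimes Y$ with $S',S''$ simple $\mathrm{u}_q^+$-modules and $X,Y$ extendable $\mathrm{u}_q^+$-modules (with chosen extensions to $\mathrm{u}_q$), then "the isomorphism induced by $\mathrm{id}_S\otimes\tau R$" means a composite $M\otimes N\cong S\otimes X\otimes Y\xrightarrow{\mathrm{id}_S\otimes\tau R}S\otimes Y\otimes X\cong N\otimes M$, where $S\cong S'\otimes S''$ is simple and the outer isomorphisms are isomorphisms of $\mathrm{u}_q^+$-modules. *)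

theory Defs
  imports
    "HOL-Library.Poly_Mapping"
    "HOL-Algebra.QuotRing"
    "HOL-Algebra.Generated_Rings"
    "HOL-Algebra.Group_Action"
    "Jordan_Normal_Form.Matrix"
    Complex_Main
begin

section \<open>The algebras \<open>u_q(sl_2)\<close> and \<open>u_q\<^sup>+\<close>\<close>

text \<open>
  Words form the free monoid under concatenation, so that \<open>'g list \<Rightarrow>\<^sub>0 complex\<close>
  with its type-class ring structure is the free associative algebra on \<open>'g\<close>.
\<close>

instantiation list :: (type) monoid_add
begin
definition zero_list :: "'a list" where "zero_list = []"
definition plus_list :: "'a list \<Rightarrow> 'a list \<Rightarrow> 'a list" where "plus_list = (@)"
instance by standard (simp_all add: zero_list_def plus_list_def)
end

datatype gen = GE | GF | GK

type_synonym free_alg = "gen list \<Rightarrow>\<^sub>0 complex"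

definition free_ring :: "free_alg ring" where
  "free_ring = \<lparr>carrier = UNIV, monoid.mult = (*), one = 1, zero = 0, add = (+)\<rparr>"

definition const :: "complex \<Rightarrow> free_alg" where
  "const c = Poly_Mapping.single [] c"

definition var :: "gen \<Rightarrow> free_alg" where
  "var g = Poly_Mapping.single [g] 1"

text \<open>Since \<open>K\<^sup>d = 1\<close>, the inverse of \<open>K\<close> is written \<open>K\<^sup>d\<^sup>-\<^sup>1\<close>.\<close>

definition uq_relators :: "complex \<Rightarrow> nat \<Rightarrow> free_alg set" where
  "uq_relators q d = (let E = var GE; F = var GF; K = var GK in
     {E ^ d, F ^ d, K ^ d - 1,
      K * E - const (q\<^sup>2) * E * K,
      K * F - const (inverse (q\<^sup>2)) * F * K,
      E * F - F * E - const (1 / (q - inverse q)) * (K - K ^ (d - 1))})"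

definition uq_ideal :: "complex \<Rightarrow> nat \<Rightarrow> free_alg set" where
  "uq_ideal q d = genideal free_ring (uq_relators q d)"

definition uq :: "complex \<Rightarrow> nat \<Rightarrow> free_alg set ring" where
  "uq q d = free_ring Quot uq_ideal q d"

definition uq_class :: "complex \<Rightarrow> nat \<Rightarrow> free_alg \<Rightarrow> free_alg set" where
  "uq_class q d x = uq_ideal q d +>\<^bsub>free_ring\<^esub> x"

definition uq_plus :: "complex \<Rightarrow> nat \<Rightarrow> free_alg set ring" where
  "uq_plus q d = (uq q d) \<lparr>carrier :=
     generate_ring (uq q d) (uq_class q d ` (range const \<union> {var GE, var GK}))\<rparr>"


section \<open>Finite-dimensional modules\<close>

definition algebra_rep ::
  "complex \<Rightarrow> nat \<Rightarrow> free_alg set ring \<Rightarrow> nat \<Rightarrow> (free_alg set \<Rightarrow> complex mat) \<Rightarrow> bool" where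
  "algebra_rep q d A m \<rho> \<longleftrightarrow>
     \<rho> \<in> Ring.ring_hom A (ring_mat TYPE(complex) m ()) \<and>
     (\<forall>c. \<rho> (uq_class q d (const c)) = c \<cdot>\<^sub>m 1\<^sub>m m)"

text \<open>
  A \<open>u_q\<^sup>+\<close>-module is given on \<open>\<complex>\<^sup>m\<close> and is recorded by the matrices through
  which the algebra generators \<open>E\<close> and \<open>K\<close> act; these determine the action.
\<close>

record uqp_mod =
  mdim :: nat
  mE :: "complex mat"
  mK :: "complex mat"

definition uqp_module :: "complex \<Rightarrow> nat \<Rightarrow> uqp_mod \<Rightarrow> bool" where
  "uqp_module q d M \<longleftrightarrow> (\<exists>\<rho>. algebra_rep q d (uq_plus q d) (mdim M) \<rho> \<and>
     \<rho> (uq_class q d (var GE)) = mE M \<and> \<rho> (uq_class q d (var GK)) = mK M)"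

text \<open>
  \<open>F\<close> is the action of the remaining generator in a \<open>u_q\<close>-module structure on
  \<open>\<complex>\<^sup>m\<close> whose restriction to \<open>u_q\<^sup>+\<close> is the given one.
\<close>

definition uq_extension :: "complex \<Rightarrow> nat \<Rightarrow> uqp_mod \<Rightarrow> complex mat \<Rightarrow> bool" where
  "uq_extension q d M F \<longleftrightarrow> (\<exists>\<rho>. algebra_rep q d (uq q d) (mdim M) \<rho> \<and>
     \<rho> (uq_class q d (var GE)) = mE M \<and> \<rho> (uq_class q d (var GK)) = mK M \<and>
     \<rho> (uq_class q d (var GF)) = F)"

definition extendable :: "complex \<Rightarrow> nat \<Rightarrow> uqp_mod \<Rightarrow> bool" where
  "extendable q d M \<longleftrightarrow> uqp_module q d M \<and> (\<exists>F. uq_extension q d M F)"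

definition mod_iso :: "complex mat \<Rightarrow> uqp_mod \<Rightarrow> uqp_mod \<Rightarrow> bool" where
  "mod_iso P M N \<longleftrightarrow> P \<in> carrier_mat (mdim N) (mdim M) \<and> invertible_mat P \<and>
     P * mE M = mE N * P \<and> P * mK M = mK N * P"

definition isomorphic :: "uqp_mod \<Rightarrow> uqp_mod \<Rightarrow> bool" where
  "isomorphic M N \<longleftrightarrow> (\<exists>P. mod_iso P M N)"

definition submod :: "uqp_mod \<Rightarrow> complex vec set \<Rightarrow> bool" where
  "submod M W \<longleftrightarrow> W \<subseteq> carrier_vec (mdim M) \<and> 0\<^sub>v (mdim M) \<in> W \<and>
     (\<forall>v\<in>W. \<forall>w\<in>W. v + w \<in> W) \<and> (\<forall>c. \<forall>v\<in>W. c \<cdot>\<^sub>v v \<in> W) \<and>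
     (\<forall>v\<in>W. mE M *\<^sub>v v \<in> W \<and> mK M *\<^sub>v v \<in> W)"

definition simple_mod :: "complex \<Rightarrow> nat \<Rightarrow> uqp_mod \<Rightarrow> bool" where
  "simple_mod q d M \<longleftrightarrow> uqp_module q d M \<and> mdim M \<noteq> 0 \<and>
     (\<forall>W. submod M W \<longrightarrow> W = {0\<^sub>v (mdim M)} \<or> W = carrier_vec (mdim M))"

definition indecomposable :: "complex \<Rightarrow> nat \<Rightarrow> uqp_mod \<Rightarrow> bool" where
  "indecomposable q d M \<longleftrightarrow> uqp_module q d M \<and> mdim M \<noteq> 0 \<and>
     (\<forall>V W. submod M V \<and> submod M W \<and> V \<inter> W = {0\<^sub>v (mdim M)} \<and>
        {v + w | v w. v \<in> V \<and> w \<in> W} = carrier_vec (mdim M) \<longrightarrow>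
        V = {0\<^sub>v (mdim M)} \<or> W = {0\<^sub>v (mdim M)})"

text \<open>The module \<open>M_i\<^sup>u\<close>; column \<open>j\<close> is the image of the basis vector \<open>e_i\<^sup>j\<close>.\<close>

definition std_mod :: "complex \<Rightarrow> nat \<Rightarrow> nat \<Rightarrow> uqp_mod" where
  "std_mod q i u = \<lparr>mdim = u + 1,
     mE = mat (u + 1) (u + 1) (\<lambda>(r, j). if r = j + 1 then 1 else 0),
     mK = mat (u + 1) (u + 1) (\<lambda>(r, j). if r = j then q ^ (2 * (i + j)) else 0)\<rparr>"


section \<open>Tensor products\<close>

text \<open>
  Kronecker product: \<open>\<complex>\<^sup>m \<otimes> \<complex>\<^sup>n\<close> is identified with \<open>\<complex>\<^sup>m\<^sup>n\<close> by sending
  \<open>e_a \<otimes> e_b\<close> to the basis vector of index \<open>a * n + b\<close>.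
\<close>

definition kron :: "complex mat \<Rightarrow> complex mat \<Rightarrow> complex mat" where
  "kron A B = mat (dim_row A * dim_row B) (dim_col A * dim_col B)
     (\<lambda>(r, c). A $$ (r div dim_row B, c div dim_col B) * B $$ (r mod dim_row B, c mod dim_col B))"

definition flip_mat :: "nat \<Rightarrow> nat \<Rightarrow> complex mat" where
  "flip_mat m n = mat (n * m) (m * n)
     (\<lambda>(r, c). if r = (c mod n) * m + c div n then 1 else 0)"

text \<open>The action is through \<open>\<Delta>(E) = 1 \<otimes> E + E \<otimes> K\<close> and \<open>\<Delta>(K) = K \<otimes> K\<close>.\<close>

definition mod_tensor :: "uqp_mod \<Rightarrow> uqp_mod \<Rightarrow> uqp_mod" where
  "mod_tensor M N = \<lparr>mdim = mdim M * mdim N,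
     mE = kron (1\<^sub>m (mdim M)) (mE N) + kron (mE M) (mK N),
     mK = kron (mK M) (mK N)\<rparr>"


section \<open>Isomorphism classes and the structure group\<close>

definition iso_class :: "complex \<Rightarrow> nat \<Rightarrow> uqp_mod \<Rightarrow> uqp_mod set" where
  "iso_class q d M = {N. uqp_module q d N \<and> isomorphic N M}"

definition class_tensor ::
  "complex \<Rightarrow> nat \<Rightarrow> uqp_mod set \<Rightarrow> uqp_mod set \<Rightarrow> uqp_mod set" where
  "class_tensor q d C D = (\<Union>M\<in>C. \<Union>N\<in>D. iso_class q d (mod_tensor M N))"

definition structure_group :: "complex \<Rightarrow> nat \<Rightarrow> uqp_mod set monoid" where
  "structure_group q d = \<lparr>carrier = {iso_class q d S | S. simple_mod q d S},
     monoid.mult = class_tensor q d, one = iso_class q d (std_mod q 0 0)\<rparr>"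

definition Ind :: "complex \<Rightarrow> nat \<Rightarrow> uqp_mod set set" where
  "Ind q d = {iso_class q d M | M. indecomposable q d M}"

definition extendable_Ind :: "complex \<Rightarrow> nat \<Rightarrow> uqp_mod set set" where
  "extendable_Ind q d = {iso_class q d X | X. indecomposable q d X \<and> extendable q d X}"

definition extendable_orbit :: "complex \<Rightarrow> nat \<Rightarrow> uqp_mod set set" where
  "extendable_orbit q d =
     (\<Union>D\<in>extendable_Ind q d. orbit (structure_group q d) (class_tensor q d) D)"


section \<open>The \<open>R\<close>-matrix and the induced isomorphisms\<close>

definition qint :: "complex \<Rightarrow> nat \<Rightarrow> complex" where
  "qint q x = (q ^ x - inverse q ^ x) / (q - inverse q)"

definition qfact :: "complex \<Rightarrow> nat \<Rightarrow> complex" where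
  "qfact q k = (\<Prod>x = 1..k. qint q x)"

definition R_coeff :: "complex \<Rightarrow> nat \<Rightarrow> nat \<Rightarrow> nat \<Rightarrow> complex" where
  "R_coeff q i j k = (q - inverse q) ^ k / qfact q k *
     q powi (int k * (int k - 1) div 2 + 2 * int k * (int i - int j) - 2 * int i * int j)"

text \<open>
  The action of \<open>R\<close> on \<open>X \<otimes> Y\<close>, where \<open>F\<close> is the matrix of the generator \<open>F\<close>
  on \<open>Y\<close>; the summation is entrywise.
\<close>

definition R_action :: "complex \<Rightarrow> nat \<Rightarrow> uqp_mod \<Rightarrow> uqp_mod \<Rightarrow> complex mat \<Rightarrow> complex mat" where
  "R_action q d X Y F = mat (mdim X * mdim Y) (mdim X * mdim Y) (\<lambda>rc.
     (1 / of_nat d) * (\<Sum>i<d. \<Sum>j<d. \<Sum>k<d. R_coeff q i j k *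
        kron (mE X ^\<^sub>m k * mK X ^\<^sub>m i) (F ^\<^sub>m k * mK Y ^\<^sub>m j) $$ rc))"

definition braiding :: "complex \<Rightarrow> nat \<Rightarrow> uqp_mod \<Rightarrow> uqp_mod \<Rightarrow> complex mat \<Rightarrow> complex mat" where
  "braiding q d X Y F = flip_mat (mdim X) (mdim Y) * R_action q d X Y F"

text \<open>\<open>M \<cong> S \<otimes> X\<close> with \<open>S\<close> simple and \<open>X\<close> extendable, with chosen extension \<open>F\<close>.\<close>

definition factorization ::
  "complex \<Rightarrow> nat \<Rightarrow> uqp_mod \<Rightarrow> uqp_mod \<Rightarrow> uqp_mod \<Rightarrow> complex mat \<Rightarrow> bool" where
  "factorization q d M S X F \<longleftrightarrow> simple_mod q d S \<and> extendable q d X \<and>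
     uq_extension q d X F \<and> isomorphic M (mod_tensor S X)"

text \<open>
  Factorizations of \<open>M\<close> and \<open>N\<close> exist, and for every choice of them (and of
  \<open>S \<cong> S' \<otimes> S''\<close>) outer isomorphisms
  \<open>\<alpha> : M \<otimes> N \<rightarrow> S \<otimes> X \<otimes> Y\<close> and \<open>\<beta> : S \<otimes> Y \<otimes> X \<rightarrow> N \<otimes> M\<close> exist, and
  each resulting composite is an isomorphism of \<open>u_q\<^sup>+\<close>-modules.
\<close>

definition braiding_induces_iso :: "complex \<Rightarrow> nat \<Rightarrow> uqp_mod \<Rightarrow> uqp_mod \<Rightarrow> bool" where
  "braiding_induces_iso q d M N \<longleftrightarrow>
     (\<exists>S' X FX. factorization q d M S' X FX) \<and>
     (\<exists>S'' Y FY. factorization q d N S'' Y FY) \<and>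
     (\<forall>S' X FX S'' Y FY. factorization q d M S' X FX \<and> factorization q d N S'' Y FY \<longrightarrow>
        (\<exists>S. simple_mod q d S \<and> isomorphic S (mod_tensor S' S'')) \<and>
        (\<forall>S. simple_mod q d S \<and> isomorphic S (mod_tensor S' S'') \<longrightarrow>
           (\<exists>\<alpha>. mod_iso \<alpha> (mod_tensor M N) (mod_tensor S (mod_tensor X Y))) \<and>
           (\<exists>\<beta>. mod_iso \<beta> (mod_tensor S (mod_tensor Y X)) (mod_tensor N M)) \<and>
           (\<forall>\<alpha> \<beta>. mod_iso \<alpha> (mod_tensor M N) (mod_tensor S (mod_tensor X Y)) \<and>
              mod_iso \<beta> (mod_tensor S (mod_tensor Y X)) (mod_tensor N M) \<longrightarrow>
              mod_iso (\<beta> * kron (1\<^sub>m (mdim S)) (braiding q d X Y FY) * \<alpha>)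
                (mod_tensor M N) (mod_tensor N M))))"

end

theory Submission
  imports Defs "Jordan_Normal_Form.Determinant"
begin

text \<open>
  Both parts rest on one observation: \<open>M_i^u\<close> becomes extendable after tensoring with a
  suitable simple module as soon as \<open>d\<close> is odd or \<open>u\<close> is even. Look for an operator \<open>F\<close> on
  \<open>M_c^u\<close> that sends \<open>e^j\<close> to \<open>f_j e^(j-1)\<close>: the relation for \<open>E F - F E\<close> determines the \<open>f_j\<close> by a recursion,
  and the recursion closes up when the weights \<open>q^(2c), ..., q^(2(c+u))\<close> are stable under
  inversion. That holds when \<open>d\<close> divides \<open>2c + u\<close>, and this congruence can be solved for \<open>c\<close>
  exactly under the parity condition. Tensoring with a simple module only shifts weights, so
  \<open>M_i^u\<close> is a shift of \<open>M_c^u\<close> (\<open>std_mod_factorization\<close>).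

  The statement about all indecomposable modules then needs their classification
  (\<open>indecomposable_is_std_mod\<close>): a Jordan chain of \<open>E\<close> of maximal length that starts at a
  weight vector has a complementary submodule, cut out by a weight functional. Since \<open>u_q^+\<close> is
  given as a subalgebra of \<open>u_q\<close> and not by a presentation, that \<open>M_i^u\<close> is a module for it at all
  is proved by realizing it inside the module \<open>M_c^(d-1)\<close>, which is always extendable
  (\<open>uqp_module_std_mod\<close>); extendability in turn comes from the universal property of the
  presentation of \<open>u_q\<close> (\<open>sl2_action_uq_extension\<close>).

  The isomorphisms come from a factorization \<open>R = C T\<close>. Here \<open>C\<close> acts by \<open>q^(2ab)\<close> on vectors of
  weights \<open>q^(2a)\<close> and \<open>q^(2b)\<close>, and \<open>T\<close> is a polynomial in the nilpotent operator \<open>E \<otimes> F\<close> with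
  constant term 1. Both factors are invertible, and each transports the coproduct of \<open>E\<close>
  to an explicit operator, the two steps leading from \<open>\<Delta>(E)\<close> to the opposite
  coproduct (\<open>R_element_coproduct\<close>, \<open>mod_iso_braiding\<close>). Finally, moving a
  simple factor past \<open>X\<close> is conjugation by a power of \<open>K\<close> (\<open>mod_iso_twist_tensor\<close>), which provides the outer isomorphisms.
\<close>

section \<open>Sums, powers and matrices\<close>

lemma sum_cyclic_shift:
  fixes g :: "nat \<Rightarrow> 'a::ab_group_add"
  assumes "g d = g 0"
  shows "(\<Sum>i<d. g (Suc i)) = (\<Sum>i<d. g i)"
proof -
  have "g 0 + (\<Sum>i<d. g (Suc i)) = (\<Sum>i<d. g i) + g d"
    using sum.lessThan_Suc_shift[of g d] sum.lessThan_Suc[of g d] by simp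
  then show ?thesis using assms by (simp add: add.commute)
qed

lemma sum_rotate: "(\<Sum>j\<in>B. \<Sum>k\<in>C. \<Sum>i\<in>A. f i j k) = (\<Sum>i\<in>A. \<Sum>j\<in>B. \<Sum>k\<in>C. f i j k)"
proof -
  have "(\<Sum>j\<in>B. \<Sum>k\<in>C. \<Sum>i\<in>A. f i j k) = (\<Sum>j\<in>B. \<Sum>i\<in>A. \<Sum>k\<in>C. f i j k)"
    by (rule sum.cong[OF refl], rule sum.swap)
  also have "\<dots> = (\<Sum>i\<in>A. \<Sum>j\<in>B. \<Sum>k\<in>C. f i j k)" by (rule sum.swap)
  finally show ?thesis .
qed

lemma power_mult_distrib_commute:
  fixes y z :: "'a::monoid_mult" assumes "z * y = y * z" shows "(z * y) ^ k = z ^ k * y ^ k"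
proof (induction k)
  case (Suc k)
  have "(z * y) ^ Suc k = z * (y * z ^ k) * y ^ k" by (simp add: Suc mult.assoc)
  also have "y * z ^ k = z ^ k * y" using power_commuting_commutes[OF assms, of k] by simp
  finally show ?case by (simp add: mult.assoc)
qed simp

lemma one_minus_nilpotent_right_inverse:
  fixes y :: "'a::ring_1" assumes "y ^ n = 0" shows "(1 - y) * (\<Sum>k<n. y ^ k) = 1"
proof -
  have "(1 - y) * (\<Sum>k<m. y ^ k) = 1 - y ^ m" for m
  proof (induction m)
    case (Suc m)
    have "(1 - y) * (\<Sum>k<Suc m. y ^ k) = (1 - y) * (\<Sum>k<m. y ^ k) + (1 - y) * y ^ m"
      by (simp add: distrib_left)
    then show ?case by (simp only: Suc) (simp add: left_diff_distrib)
  qed simp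
  then show ?thesis using assms by simp
qed

lemma mat_mult_entry:
  assumes "A \<in> carrier_mat a n" "B \<in> carrier_mat n b" "r < a" "c < b"
  shows "(A * B) $$ (r, c) = (\<Sum>t<n. A $$ (r, t) * B $$ (t, c))"
  using assms by (simp add: scalar_prod_def atLeast0LessThan)

lemma smult_entry:
  "A \<in> carrier_mat n m \<Longrightarrow> r < n \<Longrightarrow> c < m \<Longrightarrow> (a \<cdot>\<^sub>m A) $$ (r, c) = a * A $$ (r, c)"
  by simp

lemma smult_smult_mat: "a \<cdot>\<^sub>m (b \<cdot>\<^sub>m (A :: complex mat)) = (a * b) \<cdot>\<^sub>m A"
  by (intro eq_matI) auto

lemma one_smult_mat: "1 \<cdot>\<^sub>m (A :: complex mat) = A"
  by (intro eq_matI) auto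

lemma smult_mat_vec:
  "A \<in> carrier_mat n m \<Longrightarrow> v \<in> carrier_vec m \<Longrightarrow> (c \<cdot>\<^sub>m A) *\<^sub>v v = c \<cdot>\<^sub>v (A *\<^sub>v (v :: complex vec))"
  by (intro eq_vecI) (auto simp: scalar_prod_def sum_distrib_left mult.assoc)

lemma pow_mat_add:
  assumes "A \<in> carrier_mat n n" shows "A ^\<^sub>m (i + j) = A ^\<^sub>m i * A ^\<^sub>m j"
proof (induction j)
  case (Suc j)
  have "A ^\<^sub>m i * A ^\<^sub>m j * A = A ^\<^sub>m i * (A ^\<^sub>m j * A)"
    using assms by (intro assoc_mult_mat) auto
  then show ?case using Suc by simp
qed (use assms in auto)

lemma diag_power:
  assumes "A = mat n n (\<lambda>(r, j). if r = j then g j else (0::complex))"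
  shows "A ^\<^sub>m k = mat n n (\<lambda>(r, j). if r = j then g j ^ k else 0)"
proof (induction k)
  case 0 show ?case using assms by (intro eq_matI) auto
next
  case (Suc k)
  show ?case
  proof (rule eq_matI)
    fix r j
    assume "r < dim_row (mat n n (\<lambda>(r, j). if r = j then g j ^ Suc k else 0))"
      "j < dim_col (mat n n (\<lambda>(r, j). if r = j then g j ^ Suc k else 0))"
    then have rj: "r < n" "j < n" by auto
    have "(A ^\<^sub>m Suc k) $$ (r, j) = (\<Sum>t<n. (A ^\<^sub>m k) $$ (r, t) * A $$ (t, j))"
      using rj assms by (simp only: pow_mat.simps) (rule mat_mult_entry, auto)
    also have "\<dots> = (\<Sum>t<n. if t = j then (if r = j then g j ^ Suc k else 0) else 0)"
      unfolding Suc using rj assms by (intro sum.cong refl) auto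
    finally show "(A ^\<^sub>m Suc k) $$ (r, j) = mat n n (\<lambda>(r, j). if r = j then g j ^ Suc k else 0) $$ (r, j)"
      using rj by simp
  qed (use assms in auto)
qed

text \<open>Multiplication by such a matrix moves the support of a matrix by \<open>s\<close> diagonals.\<close>

lemma off_diagonal_power:
  assumes "A \<in> carrier_mat n n" "\<And>r j. r < n \<Longrightarrow> j < n \<Longrightarrow> int r - int j \<noteq> s \<Longrightarrow> A $$ (r, j) = (0::complex)"
    and "r < n" "j < n" "int r - int j \<noteq> int k * s"
  shows "(A ^\<^sub>m k) $$ (r, j) = 0"
  using assms(3-5)
proof (induction k arbitrary: r j)
  case 0 then show ?case using assms(1) by auto
next
  case (Suc k)
  have "(A ^\<^sub>m Suc k) $$ (r, j) = (\<Sum>t<n. (A ^\<^sub>m k) $$ (r, t) * A $$ (t, j))"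
    using Suc.prems assms(1) by (simp only: pow_mat.simps) (rule mat_mult_entry, auto)
  also have "\<dots> = 0"
  proof (intro sum.neutral ballI)
    fix t assume t: "t \<in> {..<n}"
    show "(A ^\<^sub>m k) $$ (r, t) * A $$ (t, j) = 0"
    proof (cases "int t - int j = s")
      case True
      then have "int r - int t \<noteq> int k * s" using Suc.prems(3) by (auto simp: algebra_simps)
      then show ?thesis using Suc.IH[of r t] Suc.prems t by simp
    next
      case False then show ?thesis using assms(2)[of t j] Suc.prems t by simp
    qed
  qed
  finally show ?case .
qed

lemma off_diagonal_nilpotent:
  assumes "A \<in> carrier_mat n n" "\<And>r j. r < n \<Longrightarrow> j < n \<Longrightarrow> int r - int j \<noteq> s \<Longrightarrow> A $$ (r, j) = (0::complex)"
    and "\<bar>s\<bar> = 1" "n \<le> d"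
  shows "A ^\<^sub>m d = 0\<^sub>m n n"
proof (rule eq_matI)
  fix r j assume "r < dim_row (0\<^sub>m n n)" "j < dim_col (0\<^sub>m n n)"
  then have rj: "r < n" "j < n" by auto
  then have "\<bar>int r - int j\<bar> < int d" using assms(4) by linarith
  then have "int r - int j \<noteq> int d * s" using assms(3) by (auto simp: abs_mult)
  then show "(A ^\<^sub>m d) $$ (r, j) = 0\<^sub>m n n $$ (r, j)"
    using off_diagonal_power[OF assms(1,2) rj] rj by simp
qed (use assms(1) in auto)

lemma nonzero_mat_entry:
  assumes "A \<in> carrier_mat n n" "A \<noteq> 0\<^sub>m n n"
  shows "\<exists>a b. a < n \<and> b < n \<and> A $$ (a, b) \<noteq> 0"
proof (rule ccontr)
  assume "\<not> ?thesis"
  then have "A = 0\<^sub>m n n" using assms(1) by (intro eq_matI) auto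
  then show False using assms(2) by simp
qed

lemma mat_eq_by_vectors:
  fixes A B :: "complex mat"
  assumes "A \<in> carrier_mat n m" "B \<in> carrier_mat n m"
    and "\<And>v. v \<in> carrier_vec m \<Longrightarrow> A *\<^sub>v v = B *\<^sub>v v"
  shows "A = B"
proof (rule eq_matI)
  fix r j assume rj: "r < dim_row B" "j < dim_col B"
  have "A *\<^sub>v unit_vec m j = B *\<^sub>v unit_vec m j" by (rule assms(3)) simp
  then have "(A *\<^sub>v unit_vec m j) $ r = (B *\<^sub>v unit_vec m j) $ r" by simp
  then show "A $$ (r, j) = B $$ (r, j)" using rj assms(1,2) by simp
qed (use assms in auto)

text \<open>Compare the traces of \<open>X Y\<close> and \<open>Y X\<close>.\<close>

lemma one_sided_inverses_dim:
  assumes "X \<in> carrier_mat m n" "Y \<in> carrier_mat n m" "X * Y = 1\<^sub>m m" "Y * X = (1\<^sub>m n :: complex mat)"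
  shows "m = n"
proof -
  have "complex_of_nat m = (\<Sum>i<m. (X * Y) $$ (i, i))" using assms(3) by simp
  also have "\<dots> = (\<Sum>i<m. \<Sum>t<n. X $$ (i, t) * Y $$ (t, i))"
    by (intro sum.cong refl mat_mult_entry[OF assms(1,2)]) auto
  also have "\<dots> = (\<Sum>t<n. \<Sum>i<m. Y $$ (t, i) * X $$ (i, t))"
    by (subst sum.swap) (simp add: mult.commute)
  also have "\<dots> = (\<Sum>t<n. (Y * X) $$ (t, t))"
    by (intro sum.cong refl mat_mult_entry[OF assms(2,1), symmetric]) auto
  also have "\<dots> = complex_of_nat n" using assms(4) by simp
  finally show ?thesis by (simp only: of_nat_eq_iff)
qed

lemma intertwining_mult:
  assumes "P * X = Z * P" "P' * Z = Y * P'"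
    and "P \<in> carrier_mat n n" "P' \<in> carrier_mat n n"
    and "X \<in> carrier_mat n n" "Y \<in> carrier_mat n n" "Z \<in> carrier_mat n n"
  shows "(P' * P) * X = Y * (P' * P)"
proof -
  have "(P' * P) * X = P' * (P * X)" using assms(3-) by (intro assoc_mult_mat) auto
  also have "\<dots> = (P' * Z) * P" unfolding assms(1) using assms(3-) by (intro assoc_mult_mat[symmetric]) auto
  also have "\<dots> = Y * (P' * P)" unfolding assms(2) using assms(3-) by (intro assoc_mult_mat) auto
  finally show ?thesis .
qed

section \<open>Roots of unity and projections onto weight spaces\<close>

text \<open>A complex algebra with its scaling as an operation. In this form the laws are terminating
  rewrite rules that collect scalars in front of a product of non-commuting factors.\<close>

locale complex_algebra = vector_space scl
  for scl :: "complex \<Rightarrow> 'a::ring_1 \<Rightarrow> 'a" +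
  assumes scl_mult_left: "scl c x * y = scl c (x * y)"
    and scl_mult_right: "x * scl c y = scl c (x * y)"

text \<open>For odd and for even \<open>n\<close> alike, what matters about \<open>q\<close> is that \<open>q\<^sup>2\<close> is a primitive
  \<open>d\<close>-th root of unity; it is called \<open>w\<close> below, and \<open>w ^ a\<close> is the weight with index \<open>a\<close>.\<close>

locale root_of_unity =
  fixes q :: complex and d :: nat
  assumes d_ge_2: "2 \<le> d"
    and q2_power_d: "(q\<^sup>2) ^ d = 1"
    and q2_primitive: "\<And>k. 0 < k \<Longrightarrow> k < d \<Longrightarrow> (q\<^sup>2) ^ k \<noteq> 1"
begin

definition w :: complex where "w = q\<^sup>2"

lemma w_power_d: "w ^ d = 1"
  using q2_power_d by (simp add: w_def)

lemma w_primitive: "0 < k \<Longrightarrow> k < d \<Longrightarrow> w ^ k \<noteq> 1"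
  using q2_primitive by (simp add: w_def)

lemma q_nonzero: "q \<noteq> 0"
  using w_power_d d_ge_2 by (auto simp: w_def power_0_left)

lemma w_nonzero: "w \<noteq> 0"
  using q_nonzero by (simp add: w_def)

lemma q_diff_nonzero: "q - inverse q \<noteq> 0"
proof
  assume "q - inverse q = 0"
  then have "w = 1" using q_nonzero by (simp add: w_def field_simps power2_eq_square)
  then show False using w_primitive[of 1] d_ge_2 by simp
qed

lemma w_power_mod: "w ^ (k mod d) = w ^ k"
proof -
  have "w ^ k = w ^ (d * (k div d) + k mod d)" by simp
  also have "\<dots> = w ^ (k mod d)" by (simp only: power_add power_mult w_power_d power_one mult_1_left)
  finally show ?thesis by simp
qed

lemma w_power_eq_1_iff: "w ^ k = 1 \<longleftrightarrow> d dvd k"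
proof
  assume "w ^ k = 1"
  then have "w ^ (k mod d) = 1" by (simp only: w_power_mod)
  then have "k mod d = 0" using w_primitive[of "k mod d"] d_ge_2 by fastforce
  then show "d dvd k" by auto
next
  assume "d dvd k" then show "w ^ k = 1" using w_power_d by (auto simp only: dvd_def power_mult power_one)
qed

lemma w_power_inj: "j < d \<Longrightarrow> l < d \<Longrightarrow> w ^ j = w ^ l \<longleftrightarrow> j = l"
proof (induction j l rule: linorder_wlog)
  case (le j l)
  have "w ^ l = w ^ j * w ^ (l - j)" using le by (simp flip: power_add)
  then have "w ^ j = w ^ l \<longleftrightarrow> w ^ (l - j) = 1" using w_nonzero by simp
  then show ?case using w_power_eq_1_iff[of "l - j"] le nat_dvd_not_less[of "l - j" d] by (cases "j = l") auto
qed auto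

lemma sum_powers_root_of_unity:
  assumes "z ^ d = (1::complex)" "z \<noteq> 1"
  shows "(\<Sum>i<d. z ^ i) = 0"
  using assms by (simp add: geometric_sum)

text \<open>The powers of \<open>w\<close> are \<open>d\<close> distinct roots of \<open>z ^ d = 1\<close>, hence all of them.\<close>

lemma root_of_unity_is_power:
  assumes "s ^ d = 1" obtains a where "a < d" "s = w ^ a"
proof -
  have fin: "finite {z::complex. z ^ d = 1}" and "card {z::complex. z ^ d = 1} = d"
    using d_ge_2 finite_roots_unity[of d, where 'a = complex] card_roots_unity_eq[of d] by auto
  moreover have "(\<lambda>a. w ^ a) ` {..<d} \<subseteq> {z. z ^ d = 1}"
  proof safe
    fix a have "(w ^ a) ^ d = (w ^ d) ^ a" by (simp only: power_mult[symmetric] mult.commute)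
    then show "(w ^ a) ^ d = 1" by (simp only: w_power_d power_one)
  qed
  moreover have "inj_on (\<lambda>a. w ^ a) {..<d}" by (auto intro!: inj_onI simp: w_power_inj)
  ultimately have "(\<lambda>a. w ^ a) ` {..<d} = {z. z ^ d = 1}"
    by (intro card_subset_eq) (auto simp: card_image)
  then show ?thesis using assms that by (force simp: image_iff)
qed

lemma qint_nonzero:
  assumes "0 < k" "k < d" shows "qint q k \<noteq> 0"
proof
  assume "qint q k = 0"
  then have "q ^ k = inverse q ^ k" using q_diff_nonzero by (simp add: qint_def)
  then have "q ^ k * q ^ k = 1" using q_nonzero by (simp add: field_simps)
  then have "w ^ k = 1" by (simp add: w_def power2_eq_square power_mult_distrib)
  then show False using w_primitive assms by blast
qed

end

locale root_algebra = complex_algebra scl + root_of_unity q d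
  for scl :: "complex \<Rightarrow> 'a::ring_1 \<Rightarrow> 'a" and q :: complex and d :: nat
begin

text \<open>If \<open>K ^ d = 1\<close>, this is the projection onto the eigenspace of \<open>K\<close> with eigenvalue \<open>w ^ j\<close>.
  As a Fourier sum it makes sense in any algebra, and its properties follow from the
  orthogonality of characters of the cyclic group of order \<open>d\<close>.\<close>

definition weight_proj :: "'a \<Rightarrow> nat \<Rightarrow> 'a" where
  "weight_proj K j = scl (1 / of_nat d) (\<Sum>i<d. scl (inverse w ^ (i * j)) (K ^ i))"

lemma q_commute_power:
  assumes "x * y = scl c (y * x)"
  shows "x ^ i * y = scl (c ^ i) (y * x ^ i)"
proof (induction i)
  case (Suc i)
  have "x ^ Suc i * y = x ^ i * (x * y)" by (simp only: power_Suc2 mult.assoc)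
  also have "\<dots> = scl c (x ^ i * y * x)" by (simp add: assms scl_mult_right mult.assoc)
  also have "\<dots> = scl (c ^ Suc i) (y * (x ^ i * x))" by (simp add: Suc scl_mult_left mult.assoc)
  finally show ?case by (simp add: power_commutes)
qed simp

lemma q_commute_powers:
  assumes "x * y = scl c (y * x)"
  shows "x ^ i * y ^ k = scl (c ^ (i * k)) (y ^ k * x ^ i)"
proof (induction k)
  case (Suc k)
  have "x ^ i * y ^ Suc k = (x ^ i * y ^ k) * y" by (simp add: power_commutes mult.assoc)
  also have "\<dots> = scl (c ^ (i * k)) (y ^ k * (x ^ i * y))"
    by (simp add: Suc scl_mult_left mult.assoc)
  also have "\<dots> = scl (c ^ (i * Suc k)) (y ^ k * y * x ^ i)"
    by (simp add: q_commute_power[OF assms] scl_mult_right mult.assoc power_add mult.commute)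
  finally show ?case by (simp add: power_commutes)
qed simp

lemma weight_proj_eigen_left:
  assumes "K ^ d = 1"
  shows "K * weight_proj K j = scl (w ^ j) (weight_proj K j)"
proof -
  define g where "g i = scl (inverse w ^ (i * j)) (K ^ i)" for i
  have "inverse w ^ (d * j) = 1"
    using w_power_d by (simp add: power_mult power_inverse)
  then have "g d = g 0" using assms by (simp add: g_def)
  have "K * g i = scl (w ^ j) (g (Suc i))" for i
    using w_nonzero by (simp add: g_def scl_mult_right power_add power_inverse)
  then have "K * (\<Sum>i<d. g i) = scl (w ^ j) (\<Sum>i<d. g (Suc i))"
    by (simp add: sum_distrib_left scale_sum_right)
  also have "\<dots> = scl (w ^ j) (\<Sum>i<d. g i)"
    using \<open>g d = g 0\<close> by (simp only: sum_cyclic_shift)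
  finally show ?thesis
    by (simp add: weight_proj_def g_def scl_mult_right mult.commute)
qed

lemma weight_proj_eigen_power:
  assumes "K ^ d = 1"
  shows "K ^ i * weight_proj K j = scl (w ^ (i * j)) (weight_proj K j)"
proof (induction i)
  case (Suc i)
  then show ?case
    by (simp add: mult.assoc weight_proj_eigen_left[OF assms] power_commutes scl_mult_right
        power_add mult.commute)
qed simp

lemma weight_proj_mult:
  assumes "K ^ d = 1" "j < d" "l < d"
  shows "weight_proj K j * weight_proj K l = (if j = l then weight_proj K l else 0)"
proof -
  define z where "z = inverse w ^ j * w ^ l"
  have zp: "inverse w ^ (i * j) * w ^ (i * l) = z ^ i" for i
    by (simp add: z_def power_mult_distrib mult.commute flip: power_mult)
  have "weight_proj K j * weight_proj K l = scl (1 / of_nat d * (\<Sum>i<d. z ^ i)) (weight_proj K l)"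
    unfolding weight_proj_def[of K j]
    by (simp add: scl_mult_left sum_distrib_right weight_proj_eigen_power assms
        zp flip: scale_sum_left)
  moreover have "z = 1" if "j = l" using that w_nonzero by (simp add: z_def power_inverse)
  moreover have "(\<Sum>i<d. z ^ i) = 0" if "j \<noteq> l"
  proof (rule sum_powers_root_of_unity)
    have "z ^ d = inverse ((w ^ d) ^ j) * (w ^ d) ^ l"
      by (simp add: z_def power_mult_distrib power_inverse mult.commute flip: power_mult)
    then show "z ^ d = 1" by (simp add: w_power_d)
    have "w ^ j \<noteq> w ^ l" using that assms w_power_inj by blast
    then show "z \<noteq> 1" using w_nonzero by (auto simp: z_def power_inverse field_simps)
  qed
  ultimately show ?thesis using d_ge_2 by auto
qed

lemma sum_weight_proj:
  shows "(\<Sum>j<d. weight_proj K j) = 1"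
proof -
  have inner: "(\<Sum>j<d. inverse w ^ (i * j)) = (if i = 0 then of_nat d else 0)" if "i < d" for i
  proof (cases "i = 0")
    case False
    have "(\<Sum>j<d. (inverse w ^ i) ^ j) = 0"
    proof (rule sum_powers_root_of_unity)
      have "(inverse w ^ i) ^ d = inverse ((w ^ d) ^ i)"
        by (simp add: power_inverse mult.commute flip: power_mult)
      then show "(inverse w ^ i) ^ d = 1" by (simp add: w_power_d)
      show "inverse w ^ i \<noteq> 1"
        using w_primitive[of i] that False w_nonzero by (auto simp: power_inverse)
    qed
    then show ?thesis using False by (simp add: power_mult)
  qed simp
  have "(\<Sum>j<d. weight_proj K j) = scl (1 / of_nat d) (\<Sum>i<d. scl (\<Sum>j<d. inverse w ^ (i * j)) (K ^ i))"
    unfolding weight_proj_def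
    by (subst scale_sum_right[symmetric], subst sum.swap) (simp add: scale_sum_left)
  also have "(\<Sum>i<d. scl (\<Sum>j<d. inverse w ^ (i * j)) (K ^ i)) =
      (\<Sum>i<d. if i = 0 then scl (of_nat d) 1 else 0)"
    by (intro sum.cong) (auto simp: inner)
  finally show ?thesis using d_ge_2 by simp
qed

lemma weight_proj_periodic: "weight_proj K (j mod d) = weight_proj K j"
proof -
  have "inverse w ^ (i * (j mod d)) = inverse w ^ (i * j)" for i
    by (simp add: power_inverse mult.commute[of i] power_mult w_power_mod)
  then show ?thesis by (simp add: weight_proj_def)
qed

text \<open>Such an element \<open>e\<close> raises the weight index by one.\<close>

lemma weight_proj_shift:
  assumes "K * e = scl w (e * K)"
  shows "weight_proj K (Suc j) * e = e * weight_proj K j"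
proof -
  have "scl (inverse w ^ (i * Suc j)) (K ^ i) * e = scl (inverse w ^ (i * j)) (e * K ^ i)" for i
    using w_nonzero
    by (simp add: scl_mult_left q_commute_power[OF assms] power_add power_inverse)
  then show ?thesis
    by (simp add: weight_proj_def scl_mult_left scl_mult_right sum_distrib_left sum_distrib_right)
qed

lemma weight_proj_shift_power:
  assumes "K * e = scl w (e * K)"
  shows "weight_proj K (j + s) * e ^ s = e ^ s * weight_proj K j"
proof (induction s)
  case (Suc s)
  have "weight_proj K (j + Suc s) * e ^ Suc s = e * (weight_proj K (j + s) * e ^ s)"
    using weight_proj_shift[OF assms, of "j + s"] by (simp add: mult.assoc[symmetric])
  then show ?case by (simp add: Suc mult.assoc)
qed simp

lemma weight_proj_commute:
  assumes "K * x = x * K" shows "weight_proj K j * x = x * weight_proj K j"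
proof -
  have "K ^ i * x = x * K ^ i" for i using q_commute_power[of K x 1] assms by simp
  then show ?thesis
    by (simp add: weight_proj_def scl_mult_left scl_mult_right sum_distrib_left sum_distrib_right)
qed

end

section \<open>The R-matrix in an algebra\<close>

text \<open>\<open>E1\<close> and \<open>K1\<close> stand for \<open>E \<otimes> 1\<close> and \<open>K \<otimes> 1\<close>, and \<open>E2\<close>, \<open>F2\<close>, \<open>K2\<close> for \<open>1 \<otimes> E\<close>, \<open>1 \<otimes> F\<close>, \<open>1 \<otimes> K\<close>.
  The coproduct of \<open>E\<close> is then \<open>E2 + E1 * K2\<close>, and the opposite one is \<open>E1 + K1 * E2\<close>.\<close>

locale rmatrix_algebra = root_algebra scl q d
  for scl :: "complex \<Rightarrow> 'a::ring_1 \<Rightarrow> 'a" and q :: complex and d :: nat +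
  fixes E1 K1 E2 F2 K2 :: 'a
  assumes E1_nilpotent: "E1 ^ d = 0" and K1_order: "K1 ^ d = 1" and K2_order: "K2 ^ d = 1"
    and K1_E1: "K1 * E1 = scl w (E1 * K1)"
    and K2_E2: "K2 * E2 = scl w (E2 * K2)"
    and K2_F2: "K2 * F2 = scl (inverse w) (F2 * K2)"
    and E2_F2: "E2 * F2 - F2 * E2 = scl (1 / (q - inverse q)) (K2 - K2 ^ (d - 1))"
    and commute: "E1 * E2 = E2 * E1" "E1 * F2 = F2 * E1" "E1 * K2 = K2 * E1"
      "K1 * E2 = E2 * K1" "K1 * F2 = F2 * K1" "K1 * K2 = K2 * K1"
begin

definition theta_coeff :: "nat \<Rightarrow> complex" where
  "theta_coeff k = (q - inverse q) ^ k / qfact q k * q ^ (k * (k - 1) div 2)"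

text \<open>The quasi-R-matrix: the part of \<open>R\<close> that is a polynomial in \<open>E \<otimes> F\<close>.\<close>

definition Theta :: 'a where
  "Theta = (\<Sum>k<d. scl (theta_coeff k) (E1 ^ k * F2 ^ k))"

text \<open>Acts by \<open>w ^ (a * b)\<close> on vectors of weights \<open>w ^ a\<close> and \<open>w ^ b\<close>.\<close>

definition Cartan :: 'a where
  "Cartan = (\<Sum>j<d. weight_proj K1 j * K2 ^ j)"

definition K2i :: 'a where "K2i = K2 ^ (d - 1)"

lemma K2i_inverse: "K2 * K2i = 1" "K2i * K2 = 1"
proof -
  have "K2 * K2i = K2 ^ d" unfolding K2i_def using d_ge_2 by (metis One_nat_def Suc_diff_1 pos2 order_less_le_trans power_Suc)
  then show "K2 * K2i = 1" by (simp add: K2_order)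
  then show "K2i * K2 = 1" by (simp add: K2i_def power_commutes)
qed

lemma commute_powers:
  "E1 ^ i * E2 = E2 * E1 ^ i" "E1 ^ i * F2 ^ j = F2 ^ j * E1 ^ i" "E1 ^ i * K2 ^ j = K2 ^ j * E1 ^ i"
  "K1 ^ i * E2 = E2 * K1 ^ i" "K1 ^ i * F2 ^ j = F2 ^ j * K1 ^ i" "K1 ^ i * K2 ^ j = K2 ^ j * K1 ^ i"
  using q_commute_power[of E1 E2 1 i] q_commute_powers[of E1 F2 1 i j] q_commute_powers[of E1 K2 1 i j]
    q_commute_power[of K1 E2 1 i] q_commute_powers[of K1 F2 1 i j] q_commute_powers[of K1 K2 1 i j] commute
  by simp_all

lemma K2i_F2: "K2i * F2 = scl w (F2 * K2i)"
proof -
  have "K2i * F2 = scl (inverse w ^ (d - 1)) (F2 * K2i)"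
    unfolding K2i_def by (rule q_commute_power[OF K2_F2])
  also have "inverse w ^ (d - 1) = w"
  proof -
    have "w * w ^ (d - 1) = 1" using w_power_d d_ge_2 by (cases d) auto
    then show ?thesis by (metis inverse_unique mult.commute power_inverse)
  qed
  finally show ?thesis .
qed

text \<open>The commutator of \<open>E\<close> with a power of \<open>F\<close>. The quantum integer arises from summing the
  commutators \<open>E F - F E\<close> over the \<open>k + 1\<close> positions, each conjugated past powers of \<open>F\<close>; in
  the induction this is an identity between Laurent polynomials in \<open>q\<close>.\<close>

lemma E2_F2_power:
  "E2 * F2 ^ Suc k = F2 ^ Suc k * E2 +
     scl (qint q (Suc k) / (q - inverse q)) (F2 ^ k * (scl (inverse q ^ k) K2 - scl (q ^ k) K2i))"
proof (induction k)
  case 0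
  have "qint q (Suc 0) = 1" using q_diff_nonzero by (simp add: qint_def)
  then show ?case using E2_F2[folded K2i_def] by (simp add: algebra_simps)
next
  case (Suc k)
  let ?r = "1 / (q - inverse q)"
  have FE: "E2 * F2 = F2 * E2 + scl ?r (K2 - K2i)" using E2_F2[folded K2i_def] by (simp add: algebra_simps)
  have KF: "(scl (inverse q ^ k) K2 - scl (q ^ k) K2i) * F2
      = F2 * (scl (inverse q ^ (k + 2)) K2 - scl (q ^ (k + 2)) K2i)"
    by (simp add: algebra_simps scl_mult_left scl_mult_right K2_F2 K2i_F2 w_def power2_eq_square
        del: One_nat_def)
  have c1: "?r + qint q (Suc k) / (q - inverse q) * inverse q ^ (k + 2)
      = qint q (Suc (Suc k)) / (q - inverse q) * inverse q ^ Suc k"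
    and c2: "?r + qint q (Suc k) / (q - inverse q) * q ^ (k + 2)
      = qint q (Suc (Suc k)) / (q - inverse q) * q ^ Suc k"
  proof -
    \<comment> \<open>With \<open>x = q\<close>, \<open>y = q\<^sup>-\<^sup>1\<close>, \<open>X = q ^ k\<close>, \<open>Y = q ^ (- k)\<close> the two coefficient identities are
        consequences of \<open>x * y = 1\<close> and \<open>X * Y = 1\<close>.\<close>
    have units: "q * inverse q = 1" "q ^ k * inverse q ^ k = 1"
      using q_nonzero by (simp_all add: power_inverse)
    have clear: "1 / D + A / D / D * Z = B / D / D * Z'" if "D + A * Z = B * Z'" "D \<noteq> 0"
      for A B D Z Z' :: complex
      using that by (simp add: field_simps)
    have step: "(x - y) + (x * X - y * Y) * (Y * (y * y)) = (x * (x * X) - y * (y * Y)) * (y * Y)"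
      if "x * y = 1" "X * Y = 1" for x y X Y :: complex
    proof -
      have e1: "x * X * (Y * (y * y)) = (x * y) * (X * Y) * y" by (simp only: mult_ac)
      have e2: "x * (x * X) * (y * Y) = (x * y) * (X * Y) * x" by (simp only: mult_ac)
      show ?thesis by (simp only: left_diff_distrib e1 e2 that mult_1_left) (simp add: mult_ac)
    qed
    have step': "(x - y) + (x * X - y * Y) * (X * (x * x)) = (x * (x * X) - y * (y * Y)) * (x * X)"
      if "x * y = 1" "X * Y = 1" for x y X Y :: complex
    proof -
      have e1: "y * Y * (X * (x * x)) = (x * y) * (X * Y) * x" by (simp only: mult_ac)
      have e2: "y * (y * Y) * (x * X) = (x * y) * (X * Y) * y" by (simp only: mult_ac)
      show ?thesis by (simp only: left_diff_distrib e1 e2 that mult_1_left) (simp add: mult_ac)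
    qed
    show "?r + qint q (Suc k) / (q - inverse q) * inverse q ^ (k + 2)
      = qint q (Suc (Suc k)) / (q - inverse q) * inverse q ^ Suc k"
      unfolding qint_def power_add power_Suc power2_eq_square
      by (rule clear[OF step[OF units] q_diff_nonzero])
    show "?r + qint q (Suc k) / (q - inverse q) * q ^ (k + 2)
      = qint q (Suc (Suc k)) / (q - inverse q) * q ^ Suc k"
      unfolding qint_def power_add power_Suc power2_eq_square
      by (rule clear[OF step'[OF units] q_diff_nonzero])
  qed
  have "E2 * F2 ^ Suc (Suc k) = (E2 * F2 ^ Suc k) * F2" by (simp only: power_Suc2 mult.assoc)
  also have "\<dots> = F2 ^ Suc k * (E2 * F2) + scl (qint q (Suc k) / (q - inverse q))
      (F2 ^ k * ((scl (inverse q ^ k) K2 - scl (q ^ k) K2i) * F2))"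
    by (simp only: Suc distrib_right scl_mult_left mult.assoc)
  also have "\<dots> = F2 ^ Suc (Suc k) * E2 + scl ?r (F2 ^ Suc k * (K2 - K2i))
      + scl (qint q (Suc k) / (q - inverse q))
         (F2 ^ Suc k * (scl (inverse q ^ (k + 2)) K2 - scl (q ^ (k + 2)) K2i))"
    unfolding FE KF by (simp only: power_Suc2 mult.assoc distrib_left scl_mult_right add.assoc)
  also have "\<dots> = F2 ^ Suc (Suc k) * E2
      + scl (?r + qint q (Suc k) / (q - inverse q) * inverse q ^ (k + 2)) (F2 ^ Suc k * K2)
      - scl (?r + qint q (Suc k) / (q - inverse q) * q ^ (k + 2)) (F2 ^ Suc k * K2i)"
    by (simp only: scale_left_distrib scale_right_diff_distrib right_diff_distrib scl_mult_right scale_scale)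
       (simp only: algebra_simps)
  also have "\<dots> = F2 ^ Suc (Suc k) * E2 + scl (qint q (Suc (Suc k)) / (q - inverse q))
      (F2 ^ Suc k * (scl (inverse q ^ Suc k) K2 - scl (q ^ Suc k) K2i))"
    unfolding c1 c2
    by (simp only: scale_right_diff_distrib right_diff_distrib scl_mult_right scale_scale add_diff_eq)
  finally show ?case .
qed

lemma theta_coeff_0: "theta_coeff 0 = 1" by (simp add: theta_coeff_def qfact_def)

text \<open>The recursion for the coefficients that makes \<open>Theta\<close> transport the coproduct of \<open>E\<close>.\<close>

lemma theta_coeff_Suc:
  assumes "Suc k < d"
  shows "theta_coeff (Suc k) * qint q (Suc k) / (q - inverse q) = theta_coeff k * q ^ k"
proof -
  have "qfact q (Suc k) = qfact q k * qint q (Suc k)" by (simp add: qfact_def)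
  moreover have "qint q (Suc k) \<noteq> 0" using assms by (intro qint_nonzero) auto
  moreover have "Suc k * (Suc k - 1) div 2 = k * (k - 1) div 2 + k"
    using arg_cong[of "Suc k * k" "k * (k - 1) + 2 * k" "\<lambda>x. x div 2"] by (cases k) auto
  ultimately show ?thesis
    using q_diff_nonzero by (simp add: theta_coeff_def power_add)
qed

text \<open>Compare the terms with the same power of \<open>E1\<close>. The commutator of \<open>E2\<close> with the term of index
  \<open>k + 1\<close> cancels against what the summands \<open>E1 * K2\<close> and \<open>E1 * K2i\<close> contribute to the term of
  index \<open>k\<close>, by \<open>E2_F2_power\<close> and \<open>theta_coeff_Suc\<close>.\<close>

lemma Theta_coproduct: "Theta * (E2 + E1 * K2) = (E2 + E1 * K2i) * Theta"
proof -
  define H where "H k = scl (theta_coeff k) (E1 ^ Suc k * (F2 ^ k * K2 - K2i * F2 ^ k))" for k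
  define G where "G k = scl (theta_coeff k) (E1 ^ k * (E2 * F2 ^ k - F2 ^ k * E2))" for k
  have GH: "G (Suc k) = H k" if "Suc k < d" for k
  proof -
    have "K2i * F2 ^ k = scl (w ^ k) (F2 ^ k * K2i)"
      using q_commute_powers[OF K2i_F2, of 1 k] by simp
    then have "H k = scl (theta_coeff k) (E1 ^ Suc k * (F2 ^ k * (K2 - scl (w ^ k) K2i)))"
      by (simp add: H_def right_diff_distrib scl_mult_right)
    moreover have "scl (q ^ k) (scl (inverse q ^ k) K2 - scl (q ^ k) K2i) = K2 - scl (w ^ k) K2i"
      using q_nonzero by (simp add: scale_right_diff_distrib power_inverse w_def power2_eq_square power_mult_distrib)
    moreover have "G (Suc k) = scl (theta_coeff (Suc k) * qint q (Suc k) / (q - inverse q))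
        (E1 ^ Suc k * (F2 ^ k * (scl (inverse q ^ k) K2 - scl (q ^ k) K2i)))"
      unfolding G_def E2_F2_power by (simp only: add_diff_cancel_left' scl_mult_right scale_scale times_divide_eq_right)
    ultimately show ?thesis
      by (simp only: theta_coeff_Suc[OF that] scale_scale[symmetric] scl_mult_right[symmetric])
  qed
  have "Theta * E2 = (\<Sum>k<d. scl (theta_coeff k) (E1 ^ k * (F2 ^ k * E2)))"
    by (simp add: Theta_def sum_distrib_right scl_mult_left mult.assoc)
  moreover have "E2 * (E1 ^ k * F2 ^ k) = E1 ^ k * (E2 * F2 ^ k)" for k
    by (metis mult.assoc commute_powers(1))
  then have "E2 * Theta = (\<Sum>k<d. scl (theta_coeff k) (E1 ^ k * (E2 * F2 ^ k)))"
    by (simp add: Theta_def sum_distrib_left scl_mult_right)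
  ultimately have 1: "E2 * Theta - Theta * E2 = (\<Sum>k<d. G k)"
    by (simp add: G_def right_diff_distrib scale_right_diff_distrib sum_subtractf)
  have "E1 ^ k * (F2 ^ k * (E1 * K2)) = E1 ^ Suc k * (F2 ^ k * K2)" for k
    using commute_powers(2)[of 1 k] by (simp add: power_Suc2 mult.assoc del: power_Suc) (metis mult.assoc)
  then have "Theta * (E1 * K2) = (\<Sum>k<d. scl (theta_coeff k) (E1 ^ Suc k * (F2 ^ k * K2)))"
    by (simp add: Theta_def sum_distrib_right scl_mult_left mult.assoc)
  moreover have "E1 * K2i * (E1 ^ k * F2 ^ k) = E1 ^ Suc k * (K2i * F2 ^ k)" for k
  proof -
    have "E1 * K2i * (E1 ^ k * F2 ^ k) = E1 * (K2i * E1 ^ k) * F2 ^ k" by (simp only: mult.assoc)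
    also have "K2i * E1 ^ k = E1 ^ k * K2i" by (simp only: K2i_def commute_powers(3))
    finally show ?thesis by (simp add: mult.assoc)
  qed
  then have "E1 * K2i * Theta = (\<Sum>k<d. scl (theta_coeff k) (E1 ^ Suc k * (K2i * F2 ^ k)))"
    by (simp add: Theta_def sum_distrib_left scl_mult_right)
  ultimately have 2: "Theta * (E1 * K2) - E1 * K2i * Theta = (\<Sum>k<d. H k)"
    by (simp add: H_def right_diff_distrib scale_right_diff_distrib sum_subtractf)
  \<comment> \<open>The sums of \<open>G\<close> and \<open>H\<close> differ by one index shift; the two terms left over, \<open>G 0\<close> and
      \<open>H (d - 1)\<close>, vanish, the latter because \<open>E1 ^ d = 0\<close>.\<close>
  obtain d' where d': "d = Suc d'" using d_ge_2 by (cases d) auto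
  have "G 0 = 0" by (simp add: G_def)
  then have "(\<Sum>k<d. G k) = (\<Sum>k<d'. G (Suc k))"
    unfolding d' by (simp add: sum.lessThan_Suc_shift del: sum.lessThan_Suc)
  also have "\<dots> = (\<Sum>k<d'. H k)" by (intro sum.cong) (auto simp: GH d')
  also have "\<dots> = (\<Sum>k<d. H k)" using E1_nilpotent unfolding d' by (simp add: H_def)
  finally have "E2 * Theta - Theta * E2 = Theta * (E1 * K2) - E1 * K2i * Theta" using 1 2 by simp
  then show ?thesis by (simp add: algebra_simps)
qed

lemma Theta_K: "Theta * (K1 * K2) = (K1 * K2) * Theta"
proof -
  have "E1 ^ k * F2 ^ k * (K1 * K2) = (K1 * K2) * (E1 ^ k * F2 ^ k)" for k
  proof -
    have a: "K1 * E1 ^ k = scl (w ^ k) (E1 ^ k * K1)" using q_commute_powers[OF K1_E1, of 1 k] by simp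
    have b: "K2 * F2 ^ k = scl (inverse w ^ k) (F2 ^ k * K2)" using q_commute_powers[OF K2_F2, of 1 k] by simp
    have "(K1 * K2) * (E1 ^ k * F2 ^ k) = K1 * (K2 * E1 ^ k) * F2 ^ k" by (simp add: mult.assoc)
    also have "K2 * E1 ^ k = E1 ^ k * K2" using commute_powers(3)[of k 1] by simp
    also have "K1 * (E1 ^ k * K2) * F2 ^ k = (K1 * E1 ^ k) * (K2 * F2 ^ k)" by (simp add: mult.assoc)
    also have "\<dots> = E1 ^ k * (K1 * F2 ^ k) * K2"
      unfolding a b using w_nonzero by (simp add: scl_mult_left scl_mult_right mult.assoc power_inverse)
    also have "K1 * F2 ^ k = F2 ^ k * K1" using commute_powers(5)[of 1 k] by simp
    finally show ?thesis by (simp add: mult.assoc)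
  qed
  then show ?thesis by (simp add: Theta_def sum_distrib_left sum_distrib_right scl_mult_left scl_mult_right)
qed

text \<open>\<open>E1\<close> raises the first weight index \<open>j\<close> by one, which costs one more factor \<open>K2\<close>.\<close>

lemma Cartan_E1: "Cartan * E1 = E1 * K2 * Cartan"
proof -
  have "K2 ^ j * E1 = E1 * K2 ^ j" for j using commute_powers(3)[of 1 j] by simp
  then have "Cartan * E1 = (\<Sum>j<d. weight_proj K1 j * E1 * K2 ^ j)"
    by (simp add: Cartan_def sum_distrib_right mult.assoc)
  also have "\<dots> = (\<Sum>j<d. weight_proj K1 (Suc j) * E1 * K2 ^ Suc j)"
    by (rule sum_cyclic_shift[symmetric])
       (use weight_proj_periodic[of K1 d] in \<open>simp add: K2_order\<close>)
  also have "\<dots> = (\<Sum>j<d. E1 * (weight_proj K1 j * K2) * K2 ^ j)"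
    by (simp add: weight_proj_shift[OF K1_E1] mult.assoc)
  also have "\<dots> = E1 * K2 * Cartan"
    by (simp add: Cartan_def sum_distrib_left weight_proj_commute[OF commute(6)] mult.assoc)
  finally show ?thesis .
qed

text \<open>\<open>K2 ^ j\<close> moves past \<open>E2\<close> at the price of \<open>w ^ j\<close>, the value of \<open>K1\<close> on the \<open>j\<close>-th weight space.\<close>

lemma Cartan_E2: "Cartan * E2 = K1 * E2 * Cartan"
proof -
  have "weight_proj K1 j * K2 ^ j * E2 = K1 * E2 * (weight_proj K1 j * K2 ^ j)" for j
  proof -
    have "weight_proj K1 j * K2 ^ j * E2 = scl (w ^ j) (weight_proj K1 j * E2 * K2 ^ j)"
      by (simp add: q_commute_power[OF K2_E2] scl_mult_right mult.assoc)
    also have "\<dots> = E2 * (K1 * weight_proj K1 j) * K2 ^ j"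
      by (simp add: weight_proj_commute[OF commute(4)] weight_proj_eigen_left[OF K1_order]
          scl_mult_left scl_mult_right mult.assoc)
    finally show ?thesis by (simp add: commute(4) mult.assoc)
  qed
  then show ?thesis by (simp add: Cartan_def sum_distrib_left sum_distrib_right)
qed

lemma Cartan_K: "Cartan * (K1 * K2) = (K1 * K2) * Cartan"
proof -
  have "weight_proj K1 j * K2 ^ j * (K1 * K2) = (K1 * K2) * (weight_proj K1 j * K2 ^ j)" for j
  proof -
    have "weight_proj K1 j * K2 ^ j * (K1 * K2) = weight_proj K1 j * (K2 ^ j * K1) * K2"
      by (simp only: mult.assoc)
    also have "K2 ^ j * K1 = K1 * K2 ^ j"
      using commute_powers(6)[of 1 j] by simp
    also have "weight_proj K1 j * (K1 * K2 ^ j) * K2 = weight_proj K1 j * K1 * (K2 ^ j * K2)"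
      by (simp only: mult.assoc)
    also have "\<dots> = K1 * (weight_proj K1 j * K2) * K2 ^ j"
    proof -
      have "weight_proj K1 j * K1 = K1 * weight_proj K1 j" by (rule weight_proj_commute) simp
      moreover have "K2 ^ j * K2 = K2 * K2 ^ j" by (rule power_commutes)
      ultimately show ?thesis by (metis mult.assoc)
    qed
    also have "\<dots> = (K1 * K2) * (weight_proj K1 j * K2 ^ j)"
      by (simp add: weight_proj_commute[OF commute(6)] mult.assoc)
    finally show ?thesis .
  qed
  then show ?thesis by (simp add: Cartan_def sum_distrib_left sum_distrib_right)
qed

definition R_element :: 'a where
  "R_element = scl (1 / of_nat d) (\<Sum>i<d. \<Sum>j<d. \<Sum>k<d.
     scl (R_coeff q i j k) ((E1 ^ k * K1 ^ i) * (F2 ^ k * K2 ^ j)))"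

text \<open>The mixed exponent \<open>2 k (i - j)\<close> is what it takes to move \<open>E ^ k\<close> and \<open>F ^ k\<close> from the right of
  \<open>K ^ i\<close> and \<open>K ^ j\<close> to the left.\<close>

lemma R_coeff_split:
  "R_coeff q i j k = theta_coeff k * (inverse w ^ (i * j) * (w ^ (i * k) * inverse w ^ (j * k)))"
proof -
  have "int k * (int k - 1) = int (k * (k - 1))" by (cases k) (simp_all add: algebra_simps)
  then have "int k * (int k - 1) div 2 = int (k * (k - 1) div 2)"
    by (simp only: zdiv_int of_nat_numeral)
  then have "int k * (int k - 1) div 2 + 2 * int k * (int i - int j) - 2 * int i * int j
      = int (k * (k - 1) div 2) + int (2 * (i * k)) - int (2 * (j * k)) - int (2 * (i * j))"
    by (simp add: algebra_simps)
  then have "q powi (int k * (int k - 1) div 2 + 2 * int k * (int i - int j) - 2 * int i * int j)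
      = q ^ (k * (k - 1) div 2) * w ^ (i * k) / w ^ (j * k) / w ^ (i * j)"
    using q_nonzero
    by (simp only: power_int_add power_int_diff power_int_of_nat w_def power_mult simp_thms)
  then show ?thesis
    unfolding R_coeff_def theta_coeff_def by (simp add: divide_inverse power_inverse mult_ac)
qed

lemma R_element_eq: "R_element = Cartan * Theta"
proof -
  have "Cartan * Theta = (\<Sum>j<d. \<Sum>k<d. weight_proj K1 j * K2 ^ j * scl (theta_coeff k) (E1 ^ k * F2 ^ k))"
    by (simp add: Cartan_def Theta_def sum_product)
  also have "\<dots> = (\<Sum>j<d. \<Sum>k<d. \<Sum>i<d. scl (1 / of_nat d) (scl (R_coeff q i j k) ((E1 ^ k * K1 ^ i) * (F2 ^ k * K2 ^ j))))"
  proof (intro sum.cong refl)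
    fix j k
    have *: "K1 ^ i * K2 ^ j * (E1 ^ k * F2 ^ k) =
       scl (w ^ (i * k) * inverse w ^ (j * k)) ((E1 ^ k * K1 ^ i) * (F2 ^ k * K2 ^ j))" for i
    proof -
      have "K1 ^ i * K2 ^ j * (E1 ^ k * F2 ^ k) = (K1 ^ i * E1 ^ k) * (K2 ^ j * F2 ^ k)"
        using commute_powers(3)[of k j] by (metis mult.assoc)
      then show ?thesis
        by (simp add: q_commute_powers[OF K1_E1] q_commute_powers[OF K2_F2] scl_mult_left scl_mult_right)
    qed
    show "weight_proj K1 j * K2 ^ j * scl (theta_coeff k) (E1 ^ k * F2 ^ k) =
      (\<Sum>i<d. scl (1 / of_nat d) (scl (R_coeff q i j k) ((E1 ^ k * K1 ^ i) * (F2 ^ k * K2 ^ j))))"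
      by (simp add: weight_proj_def scl_mult_left scl_mult_right sum_distrib_right scale_sum_right *
          R_coeff_split mult.commute mult.left_commute)
  qed
  also have "\<dots> = R_element"
    unfolding R_element_def scale_sum_right
    by (rule sum_rotate)
  finally show ?thesis by simp
qed

lemma R_element_coproduct: "R_element * (E2 + E1 * K2) = (E1 + K1 * E2) * R_element"
proof -
  have "Cartan * (E2 + E1 * K2i) = (E1 + K1 * E2) * Cartan"
  proof -
    have "Cartan * K2i = K2i * Cartan"
    proof -
      have "K2i * weight_proj K1 j = weight_proj K1 j * K2i" for j
        using weight_proj_commute[of K1 K2i j] commute_powers(6)[of 1 "d - 1"] by (simp add: K2i_def)
      moreover have "K2 ^ j * K2i = K2i * K2 ^ j" for j unfolding K2i_def by (metis power_add add.commute)
      ultimately have "weight_proj K1 j * K2 ^ j * K2i = K2i * (weight_proj K1 j * K2 ^ j)" for j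
        by (metis mult.assoc)
      then show ?thesis by (simp add: Cartan_def sum_distrib_left sum_distrib_right)
    qed
    have "Cartan * (E1 * K2i) = E1 * (K2 * (Cartan * K2i))"
      by (simp add: Cartan_E1 flip: mult.assoc)
    also have "\<dots> = E1 * ((K2 * K2i) * Cartan)"
      using \<open>Cartan * K2i = K2i * Cartan\<close> by (simp add: mult.assoc)
    finally have "Cartan * (E1 * K2i) = E1 * Cartan" by (simp add: K2i_inverse)
    then show ?thesis by (simp add: distrib_left distrib_right Cartan_E2 add.commute)
  qed
  then show ?thesis unfolding R_element_eq
    by (metis Theta_coproduct mult.assoc)
qed

lemma R_element_K: "R_element * (K1 * K2) = (K1 * K2) * R_element"
  unfolding R_element_eq by (metis Theta_K Cartan_K mult.assoc)

text \<open>On the weight spaces of \<open>K1\<close> the inverse uses \<open>K2i\<close> in place of \<open>K2\<close>.\<close>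

lemma Cartan_right_inverse: "\<exists>X. Cartan * X = 1"
proof
  let ?X = "\<Sum>l<d. weight_proj K1 l * K2i ^ l"
  have "Cartan * ?X = (\<Sum>j<d. \<Sum>l<d. (weight_proj K1 j * K2 ^ j) * (weight_proj K1 l * K2i ^ l))"
    by (simp add: Cartan_def sum_product)
  also have "\<dots> = (\<Sum>j<d. \<Sum>l<d. if j = l then weight_proj K1 j else 0)"
  proof (intro sum.cong refl)
    fix j l assume "j \<in> {..<d}" "l \<in> {..<d}"
    have "K2 ^ j * weight_proj K1 l = weight_proj K1 l * K2 ^ j"
      using weight_proj_commute[of K1 "K2 ^ j" l] commute_powers(6)[of 1 j] by simp
    then have "(weight_proj K1 j * K2 ^ j) * (weight_proj K1 l * K2i ^ l)
        = (weight_proj K1 j * weight_proj K1 l) * (K2 ^ j * K2i ^ l)"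
      by (metis mult.assoc)
    moreover have "K2 ^ j * K2i ^ j = 1"
      by (rule left_right_inverse_power[OF K2i_inverse(1)])
    ultimately show "(weight_proj K1 j * K2 ^ j) * (weight_proj K1 l * K2i ^ l)
        = (if j = l then weight_proj K1 j else 0)"
      using weight_proj_mult[OF K1_order] \<open>j \<in> {..<d}\<close> \<open>l \<in> {..<d}\<close> by auto
  qed
  also have "\<dots> = 1" by (simp add: sum_weight_proj)
  finally show "Cartan * ?X = 1" .
qed

text \<open>\<open>Theta\<close> is 1 plus a multiple of the nilpotent element \<open>E1 * F2\<close>.\<close>

lemma Theta_right_inverse: "\<exists>X. Theta * X = 1"
proof -
  define z where "z = E1 * F2"
  have zp: "z ^ k = E1 ^ k * F2 ^ k" for k
    unfolding z_def using commute(2) by (rule power_mult_distrib_commute)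
  obtain d' where d': "d = Suc d'" using d_ge_2 by (cases d) auto
  define g where "g = (\<Sum>k<d'. scl (theta_coeff (Suc k)) (z ^ k))"
  have "Theta = 1 + z * g"
  proof -
    have "Theta = (\<Sum>k<Suc d'. scl (theta_coeff k) (z ^ k))" unfolding Theta_def zp d'[symmetric] by (rule refl)
    then show ?thesis unfolding sum.lessThan_Suc_shift
      by (simp add: theta_coeff_0 g_def sum_distrib_left scl_mult_right)
  qed
  moreover have zg: "z * g = g * z"
    by (simp add: g_def sum_distrib_left sum_distrib_right scl_mult_left scl_mult_right power_commutes)
  have "(- (z * g)) ^ d = 0"
    by (subst power_minus) (simp add: power_mult_distrib_commute[OF zg] zp E1_nilpotent)
  ultimately show ?thesis using one_minus_nilpotent_right_inverse[of "- (z * g)" d] by auto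
qed

lemma R_element_right_inverse: "\<exists>X. R_element * X = 1"
proof -
  obtain X Y where "Cartan * X = 1" "Theta * Y = 1"
    using Cartan_right_inverse Theta_right_inverse by blast
  have "R_element * (Y * X) = Cartan * (Theta * Y) * X" by (simp only: R_element_eq mult.assoc)
  then have "R_element * (Y * X) = 1" using \<open>Cartan * X = 1\<close> \<open>Theta * Y = 1\<close> by simp
  then show ?thesis by blast
qed

end

section \<open>Matrices of all sizes inside one algebra\<close>

text \<open>Square matrices whose size is a variable do not form a type, hence no instance of the class of rings in which
  the computations above take place. All of them embed, with their unit, into the ring of linear
  operators on complex sequences.\<close>

typedef opr = "{f :: (nat \<Rightarrow> complex) \<Rightarrow> nat \<Rightarrow> complex.
    \<forall>c x y. f (\<lambda>i. c * x i + y i) = (\<lambda>i. c * f x i + f y i)}"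
  morphisms apply_opr Opr
  by (rule exI[of _ "\<lambda>x. x"]) simp

setup_lifting type_definition_opr

lemma apply_opr_add: "apply_opr f (\<lambda>i. x i + y i) = (\<lambda>i. apply_opr f x i + apply_opr f y i)"
  using apply_opr[of f] by (auto dest: spec[of _ 1])

lemma apply_opr_scale: "apply_opr f (\<lambda>i. c * x i) = (\<lambda>i. c * apply_opr f x i)"
proof -
  have *: "apply_opr f (\<lambda>i. c * x i + y i) = (\<lambda>i. c * apply_opr f x i + apply_opr f y i)" for c x y
    using apply_opr[of f] by blast
  have "apply_opr f (\<lambda>i. 0) = (\<lambda>i. 0)"
    using *[of "-1" "\<lambda>i. 0" "\<lambda>i. 0"] by simp
  then show ?thesis using *[of c x "\<lambda>i. 0"] by simp
qed

instantiation opr :: ring_1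
begin
lift_definition zero_opr :: opr is "\<lambda>x i. 0" by simp
lift_definition one_opr :: opr is "\<lambda>x. x" by simp
lift_definition plus_opr :: "opr \<Rightarrow> opr \<Rightarrow> opr" is "\<lambda>f g x i. f x i + g x i"
  by (simp add: fun_eq_iff algebra_simps)
lift_definition minus_opr :: "opr \<Rightarrow> opr \<Rightarrow> opr" is "\<lambda>f g x i. f x i - g x i"
  by (simp add: fun_eq_iff algebra_simps)
lift_definition uminus_opr :: "opr \<Rightarrow> opr" is "\<lambda>f x i. - f x i"
  by (simp add: fun_eq_iff algebra_simps)
lift_definition times_opr :: "opr \<Rightarrow> opr \<Rightarrow> opr" is "\<lambda>f g x. f (g x)"
  by simp
instance
proof
  fix a b c :: opr
  show "a * (b + c) = a * b + a * c"
    by (simp add: apply_opr_inject[symmetric] plus_opr.rep_eq times_opr.rep_eq fun_eq_iff apply_opr_add)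
  show "(0::opr) \<noteq> 1" by transfer (auto simp: fun_eq_iff intro!: exI[of _ "\<lambda>i. 1"])
qed (transfer; simp add: fun_eq_iff algebra_simps)+
end

lift_definition scale_opr :: "complex \<Rightarrow> opr \<Rightarrow> opr" is "\<lambda>c f x i. c * f x i"
  by (simp add: fun_eq_iff algebra_simps)

interpretation opr: complex_algebra scale_opr
proof
  fix c and x y :: opr
  show "x * scale_opr c y = scale_opr c (x * y)"
    by (simp add: apply_opr_inject[symmetric] scale_opr.rep_eq times_opr.rep_eq fun_eq_iff apply_opr_scale)
qed (transfer; simp add: fun_eq_iff algebra_simps)+

text \<open>The \<open>m \<times> m\<close> matrix with the given entries acts on every block of \<open>m\<close> consecutive coordinates.
  Repeating the block sends the identity matrix to the identity operator.\<close>

lift_definition entries_opr :: "nat \<Rightarrow> (nat \<times> nat \<Rightarrow> complex) \<Rightarrow> opr" is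
  "\<lambda>m g x i. \<Sum>s<m. g (i mod m, s) * x (i - i mod m + s)"
  by (simp add: fun_eq_iff algebra_simps sum.distrib sum_distrib_left)

lemma entries_opr_scale: "entries_opr m (\<lambda>rc. c * g rc) = scale_opr c (entries_opr m g)"
  by transfer (simp add: fun_eq_iff sum_distrib_left mult.assoc)

lemma entries_opr_add: "entries_opr m (\<lambda>rc. f rc + g rc) = entries_opr m f + entries_opr m g"
  by transfer (simp add: fun_eq_iff sum.distrib distrib_right)

lemma entries_opr_0: "entries_opr m (\<lambda>rc. 0) = 0"
  by transfer simp

lemma entries_opr_sum: "entries_opr m (\<lambda>rc. \<Sum>i\<in>I. g i rc) = (\<Sum>i\<in>I. entries_opr m (g i))"
  by (induction I rule: infinite_finite_induct) (simp_all add: entries_opr_0 entries_opr_add)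

lemma entries_opr_cong:
  assumes "0 < m" "\<And>r s. r < m \<Longrightarrow> s < m \<Longrightarrow> f (r, s) = g (r, s)"
  shows "entries_opr m f = entries_opr m g"
  using assms by transfer (simp add: fun_eq_iff)

lemma apply_entries_opr_basis:
  assumes "r < m" "s < m"
  shows "apply_opr (entries_opr m g) (\<lambda>i. if i = s then 1 else 0) r = g (r, s)"
proof -
  have "(\<Sum>t<m. g (r, t) * (if t = s then 1 else 0)) = (\<Sum>t<m. if t = s then g (r, s) else 0)"
    by (intro sum.cong) auto
  then show ?thesis using assms by (simp add: entries_opr.rep_eq)
qed

definition mat_opr :: "nat \<Rightarrow> complex mat \<Rightarrow> opr" where
  "mat_opr m A = entries_opr m (\<lambda>rc. A $$ rc)"

lemma mat_opr_mat: "0 < m \<Longrightarrow> mat_opr m (mat m m g) = entries_opr m g"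
  unfolding mat_opr_def by (rule entries_opr_cong) auto

lemma mat_opr_inject:
  assumes "A \<in> carrier_mat m m" "B \<in> carrier_mat m m" "mat_opr m A = mat_opr m B"
  shows "A = B"
proof (rule eq_matI)
  fix r s assume "r < dim_row B" "s < dim_col B"
  then show "A $$ (r, s) = B $$ (r, s)"
    using assms apply_entries_opr_basis[of r m s] unfolding mat_opr_def by (metis carrier_matD)
qed (use assms in auto)

lemma mat_opr_one: "0 < m \<Longrightarrow> mat_opr m (1\<^sub>m m) = 1"
proof -
  assume m: "0 < m"
  have "apply_opr (mat_opr m (1\<^sub>m m)) x i = x i" for x i
  proof -
    have "(\<Sum>s<m. 1\<^sub>m m $$ (i mod m, s) * x (i - i mod m + s))
      = (\<Sum>s<m. if s = i mod m then x i else 0)"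
      using m by (intro sum.cong) auto
    then show ?thesis using m by (simp add: mat_opr_def entries_opr.rep_eq)
  qed
  then show ?thesis by (simp add: apply_opr_inject[symmetric] one_opr.rep_eq fun_eq_iff)
qed

lemma mat_opr_zero: "0 < m \<Longrightarrow> mat_opr m (0\<^sub>m m m) = 0"
  using mat_opr_mat[of m "\<lambda>_. 0"] by (simp add: zero_mat_def entries_opr_0)

lemma mat_opr_smult:
  "0 < m \<Longrightarrow> A \<in> carrier_mat m m \<Longrightarrow> mat_opr m (c \<cdot>\<^sub>m A) = scale_opr c (mat_opr m A)"
  unfolding mat_opr_def entries_opr_scale[symmetric] by (rule entries_opr_cong) auto

lemma mat_opr_add:
  "0 < m \<Longrightarrow> A \<in> carrier_mat m m \<Longrightarrow> B \<in> carrier_mat m m \<Longrightarrow>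
    mat_opr m (A + B) = mat_opr m A + mat_opr m B"
  unfolding mat_opr_def entries_opr_add[symmetric] by (rule entries_opr_cong) auto

lemma mat_opr_diff:
  assumes "0 < m" "A \<in> carrier_mat m m" "B \<in> carrier_mat m m"
  shows "mat_opr m (A - B) = mat_opr m A - mat_opr m B"
proof -
  have "A = (A - B) + B" using assms by (intro eq_matI) auto
  then have "mat_opr m A = mat_opr m (A - B) + mat_opr m B"
    using mat_opr_add[of m "A - B" B] assms by (metis minus_carrier_mat)
  then show ?thesis by simp
qed

lemma mat_opr_mult:
  assumes "0 < m" "A \<in> carrier_mat m m" "B \<in> carrier_mat m m"
  shows "mat_opr m (A * B) = mat_opr m A * mat_opr m B"
proof -
  have "apply_opr (mat_opr m (A * B)) x i = apply_opr (mat_opr m A * mat_opr m B) x i" for x i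
  proof -
    have "apply_opr (mat_opr m (A * B)) x i =
        (\<Sum>s<m. (\<Sum>t<m. A $$ (i mod m, t) * B $$ (t, s)) * x (i - i mod m + s))"
      unfolding mat_opr_def entries_opr.rep_eq using assms
      by (intro sum.cong refl) (simp add: scalar_prod_def atLeast0LessThan)
    also have "\<dots> = (\<Sum>t<m. A $$ (i mod m, t) * (\<Sum>s<m. B $$ (t, s) * x (i - i mod m + s)))"
      unfolding sum_distrib_right sum_distrib_left by (subst sum.swap) (simp add: mult.assoc)
    also have "\<dots> = apply_opr (mat_opr m A * mat_opr m B) x i"
    proof -
      have a: "(i - i mod m + t) mod m = t" if "t < m" for t
        using that by (metis minus_mod_eq_mult_div mod_less mod_mult_self4)
      show ?thesis
        unfolding times_opr.rep_eq mat_opr_def entries_opr.rep_eq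
        by (intro sum.cong refl) (simp only: lessThan_iff a diff_add_inverse2)
    qed
    finally show ?thesis .
  qed
  then show ?thesis by (simp add: apply_opr_inject[symmetric] fun_eq_iff)
qed

lemma mat_opr_pow:
  assumes "0 < m" "A \<in> carrier_mat m m"
  shows "mat_opr m (A ^\<^sub>m k) = mat_opr m A ^ k"
  using assms
  by (induction k) (simp_all add: mat_opr_one mat_opr_mult pow_carrier_mat power_Suc2 del: power_Suc)

section \<open>Kronecker products and the flip\<close>

lemma kron_carrier [simp, intro]:
  "A \<in> carrier_mat a b \<Longrightarrow> B \<in> carrier_mat c e \<Longrightarrow> kron A B \<in> carrier_mat (a * c) (b * e)"
  by (auto simp: kron_def)

lemma kron_dim [simp]:
  "dim_row (kron A B) = dim_row A * dim_row B" "dim_col (kron A B) = dim_col A * dim_col B"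
  by (simp_all add: kron_def)

lemma kron_index:
  "r < dim_row A * dim_row B \<Longrightarrow> c < dim_col A * dim_col B \<Longrightarrow>
   kron A B $$ (r, c) = A $$ (r div dim_row B, c div dim_col B) * B $$ (r mod dim_row B, c mod dim_col B)"
  by (simp add: kron_def)

lemma div_mod_less:
  fixes r a b :: nat assumes "r < a * b" shows "r div b < a" "r mod b < b"
  using assms by (simp_all add: less_mult_imp_div_less) (metis mod_less_divisor mult_0_right neq0_conv not_less0)

lemma sum_div_mod:
  fixes f :: "nat \<Rightarrow> nat \<Rightarrow> 'a::comm_monoid_add"
  shows "(\<Sum>t<a * b. f (t div b) (t mod b)) = (\<Sum>i<a. \<Sum>j<b. f i j)"
proof -
  have "(\<Sum>t<a * b. f (t div b) (t mod b)) = (\<Sum>(i, j)\<in>{..<a} \<times> {..<b}. f i j)"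
  proof (rule sum.reindex_bij_witness[where i = "\<lambda>(i, j). i * b + j" and j = "\<lambda>t. (t div b, t mod b)"])
    fix p assume "p \<in> {..<a} \<times> {..<b}"
    then obtain i j where p: "p = (i, j)" "i < a" "j < b" by auto
    then have "i * b + j < Suc i * b" by simp
    also have "\<dots> \<le> a * b" using p by (intro mult_le_mono1) simp
    finally show "(case p of (i, j) \<Rightarrow> i * b + j) \<in> {..<a * b}" using p by simp
    show "((case p of (i, j) \<Rightarrow> i * b + j) div b, (case p of (i, j) \<Rightarrow> i * b + j) mod b) = p"
      using p by auto
  qed (auto simp: div_mod_less)
  then show ?thesis by (simp add: sum.cartesian_product)
qed

lemma kron_mult:
  assumes "A \<in> carrier_mat a b" "C \<in> carrier_mat b c" "B \<in> carrier_mat a' b'" "D \<in> carrier_mat b' c'"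
  shows "kron A B * kron C D = kron (A * C) (B * D)"
proof (rule eq_matI)
  fix r s assume "r < dim_row (kron (A * C) (B * D))" "s < dim_col (kron (A * C) (B * D))"
  then have rs: "r < a * a'" "s < c * c'" using assms by auto
  note l = div_mod_less[OF rs(1)] div_mod_less[OF rs(2)]
  have "(kron A B * kron C D) $$ (r, s) = (\<Sum>t<b * b'.
      (A $$ (r div a', t div b') * B $$ (r mod a', t mod b')) * (C $$ (t div b', s div c') * D $$ (t mod b', s mod c')))"
    using rs assms by (simp add: scalar_prod_def kron_index atLeast0LessThan)
  also have "\<dots> = (\<Sum>i<b. \<Sum>j<b'.
      (A $$ (r div a', i) * B $$ (r mod a', j)) * (C $$ (i, s div c') * D $$ (j, s mod c')))"
    by (rule sum_div_mod)
  also have "\<dots> = (\<Sum>i<b. A $$ (r div a', i) * C $$ (i, s div c')) * (\<Sum>j<b'. B $$ (r mod a', j) * D $$ (j, s mod c'))"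
    by (simp add: sum_product mult_ac)
  also have "\<dots> = kron (A * C) (B * D) $$ (r, s)"
    using rs assms l by (simp add: kron_index scalar_prod_def atLeast0LessThan)
  finally show "(kron A B * kron C D) $$ (r, s) = kron (A * C) (B * D) $$ (r, s)" .
qed (use assms in auto)

lemma kron_smult_left: "kron (c \<cdot>\<^sub>m A) B = c \<cdot>\<^sub>m kron A B"
  by (intro eq_matI) (auto simp: kron_index div_mod_less)

lemma kron_smult_right: "kron A (c \<cdot>\<^sub>m B) = c \<cdot>\<^sub>m kron A B"
  by (intro eq_matI) (auto simp: kron_index div_mod_less)

lemma kron_zero_left: "kron (0\<^sub>m a b) B = 0\<^sub>m (a * dim_row B) (b * dim_col B)"
  by (intro eq_matI) (auto simp: kron_index div_mod_less)

lemma kron_one: "kron (1\<^sub>m a) (1\<^sub>m b) = 1\<^sub>m (a * b)"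
proof (rule eq_matI)
  fix r s assume "r < dim_row (1\<^sub>m (a * b))" "s < dim_col (1\<^sub>m (a * b))"
  then have rs: "r < a * b" "s < a * b" by auto
  have "r = s \<longleftrightarrow> r div b = s div b \<and> r mod b = s mod b" by (metis div_mult_mod_eq)
  then show "kron (1\<^sub>m a) (1\<^sub>m b) $$ (r, s) = 1\<^sub>m (a * b) $$ (r, s)"
    using rs div_mod_less[OF rs(1)] div_mod_less[OF rs(2)] by (auto simp: kron_index)
qed auto

lemma kron_one_left: "kron (1\<^sub>m 1) A = A"
  by (intro eq_matI) (auto simp: kron_index)

lemma kron_pow_left:
  assumes "A \<in> carrier_mat m m"
  shows "kron A (1\<^sub>m n) ^\<^sub>m k = kron (A ^\<^sub>m k) (1\<^sub>m n)"
proof (induction k)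
  case 0 then show ?case using assms by (simp add: kron_one)
next
  case (Suc k)
  then show ?case using kron_mult[of "A ^\<^sub>m k" m m A m "1\<^sub>m n" n n "1\<^sub>m n" n] assms
    by (simp add: pow_carrier_mat)
qed

lemma kron_pow_right:
  assumes "B \<in> carrier_mat n n"
  shows "kron (1\<^sub>m m) B ^\<^sub>m k = kron (1\<^sub>m m) (B ^\<^sub>m k)"
proof (induction k)
  case 0 then show ?case using assms by (simp add: kron_one)
next
  case (Suc k)
  then show ?case using kron_mult[of "1\<^sub>m m" m m "1\<^sub>m m" m "B ^\<^sub>m k" n n B n] assms
    by (simp add: pow_carrier_mat)
qed

lemma flip_carrier [simp, intro]: "flip_mat m n \<in> carrier_mat (n * m) (m * n)"
  by (simp add: flip_mat_def)

text \<open>\<open>flip_mat\<close> is the permutation matrix of the bijection that sends the index \<open>a * n + b\<close> to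
  \<open>b * m + a\<close>; it and its inverse are given by the same formula with \<open>m\<close> and \<open>n\<close> exchanged.\<close>

lemma swap_index_less:
  fixes c m n :: nat assumes "c < m * n" shows "(c mod n) * m + c div n < n * m"
proof -
  have "c div n < m" "c mod n < n" using assms by (auto simp: div_mod_less)
  then have "(c mod n) * m + c div n < Suc (c mod n) * m" by simp
  also have "\<dots> \<le> n * m" using \<open>c mod n < n\<close> by (intro mult_le_mono1) simp
  finally show ?thesis .
qed

lemma swap_index_iff:
  fixes c m n r :: nat assumes "c < m * n" "r < n * m"
  shows "r = (c mod n) * m + c div n \<longleftrightarrow> c = (r mod m) * n + r div m"
proof -
  have c: "c div n < m" "c mod n < n" and r: "r div m < n" "r mod m < m"
    using assms by (auto simp: div_mod_less)
  have "r = (c mod n) * m + c div n \<longleftrightarrow> r div m = c mod n \<and> r mod m = c div n"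
    using c by (auto simp: mult.commute) (metis div_mult_mod_eq mult.commute)
  also have "\<dots> \<longleftrightarrow> c = (r mod m) * n + r div m"
    using r by (auto simp: mult.commute)
  finally show ?thesis .
qed

lemma flip_mult_left:
  assumes "X \<in> carrier_mat (m * n) k" "r < n * m" "c < k"
  shows "(flip_mat m n * X) $$ (r, c) = X $$ ((r mod m) * n + r div m, c)"
proof -
  have "(flip_mat m n * X) $$ (r, c) = (\<Sum>t<m * n. flip_mat m n $$ (r, t) * X $$ (t, c))"
    using assms by (simp add: scalar_prod_def atLeast0LessThan flip_mat_def)
  also have "\<dots> = (\<Sum>t<m * n. if t = (r mod m) * n + r div m then X $$ (t, c) else 0)"
    using assms by (intro sum.cong refl) (auto simp: flip_mat_def swap_index_iff[of _ m n r])
  also have "\<dots> = X $$ ((r mod m) * n + r div m, c)"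
    using swap_index_less[of r n m] assms by simp
  finally show ?thesis .
qed

lemma flip_mult_right:
  assumes "X \<in> carrier_mat k (n * m)" "r < k" "c < m * n"
  shows "(X * flip_mat m n) $$ (r, c) = X $$ (r, (c mod n) * m + c div n)"
proof -
  have "(X * flip_mat m n) $$ (r, c) = (\<Sum>t<n * m. X $$ (r, t) * flip_mat m n $$ (t, c))"
    using assms by (simp add: scalar_prod_def atLeast0LessThan flip_mat_def)
  also have "\<dots> = (\<Sum>t<n * m. if t = (c mod n) * m + c div n then X $$ (r, t) else 0)"
    using assms by (intro sum.cong refl) (auto simp: flip_mat_def)
  also have "\<dots> = X $$ (r, (c mod n) * m + c div n)"
    using swap_index_less[of c m n] assms by simp
  finally show ?thesis .
qed

lemma flip_kron:
  assumes "A \<in> carrier_mat m m" "B \<in> carrier_mat n n"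
  shows "flip_mat m n * kron A B = kron B A * flip_mat m n"
proof (rule eq_matI)
  fix r c assume "r < dim_row (kron B A * flip_mat m n)" "c < dim_col (kron B A * flip_mat m n)"
  then have rc: "r < n * m" "c < m * n" using assms by (auto simp: flip_mat_def)
  have l: "r div m < n" "r mod m < m" "c div n < m" "c mod n < n"
    using rc by (auto simp: div_mod_less)
  have lt: "(r mod m) * n + r div m < m * n" "(c mod n) * m + c div n < n * m"
    using swap_index_less rc by auto
  show "(flip_mat m n * kron A B) $$ (r, c) = (kron B A * flip_mat m n) $$ (r, c)"
    using flip_mult_left[of "kron A B" m n "m * n" r c] flip_mult_right[of "kron B A" "n * m" n m r c]
      assms rc l lt by (auto simp: kron_index)
qed (use assms in \<open>auto simp: flip_mat_def\<close>)

lemma flip_flip: "flip_mat m n * flip_mat n m = 1\<^sub>m (n * m)"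
proof (rule eq_matI)
  fix r c assume "r < dim_row (1\<^sub>m (n * m))" "c < dim_col (1\<^sub>m (n * m))"
  then have rc: "r < n * m" "c < n * m" by auto
  have "(flip_mat m n * flip_mat n m) $$ (r, c) = flip_mat n m $$ ((r mod m) * n + r div m, c)"
    using rc by (intro flip_mult_left[where k = "n * m"]) auto
  also have "\<dots> = 1\<^sub>m (n * m) $$ (r, c)"
    using rc swap_index_less[of r n m] swap_index_iff[of c n m "(r mod m) * n + r div m"] swap_index_iff[of r n m "(r mod m) * n + r div m"]
    by (auto simp: flip_mat_def)
  finally show "(flip_mat m n * flip_mat n m) $$ (r, c) = 1\<^sub>m (n * m) $$ (r, c)" .
qed (auto simp: flip_mat_def)

section \<open>Modules by generators and relations\<close>

definition carrier_mod :: "uqp_mod \<Rightarrow> bool" where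
  "carrier_mod M \<longleftrightarrow> mE M \<in> carrier_mat (mdim M) (mdim M) \<and> mK M \<in> carrier_mat (mdim M) (mdim M)"

text \<open>The relations of \<open>u_q^+\<close> for the matrices of \<open>E\<close> and \<open>K\<close>, and below those of \<open>u_q\<close> with a third
  matrix for \<open>F\<close>.\<close>

definition borel_action :: "complex \<Rightarrow> nat \<Rightarrow> uqp_mod \<Rightarrow> bool" where
  "borel_action q d M \<longleftrightarrow> carrier_mod M \<and>
     mE M ^\<^sub>m d = 0\<^sub>m (mdim M) (mdim M) \<and> mK M ^\<^sub>m d = 1\<^sub>m (mdim M) \<and>
     mK M * mE M = q\<^sup>2 \<cdot>\<^sub>m (mE M * mK M)"

definition sl2_action :: "complex \<Rightarrow> nat \<Rightarrow> uqp_mod \<Rightarrow> complex mat \<Rightarrow> bool" where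
  "sl2_action q d M F \<longleftrightarrow> borel_action q d M \<and> F \<in> carrier_mat (mdim M) (mdim M) \<and>
     F ^\<^sub>m d = 0\<^sub>m (mdim M) (mdim M) \<and> mK M * F = inverse (q\<^sup>2) \<cdot>\<^sub>m (F * mK M) \<and>
     mE M * F - F * mE M = (1 / (q - inverse q)) \<cdot>\<^sub>m (mK M - mK M ^\<^sub>m (d - 1))"

lemma borel_actionD:
  assumes "borel_action q d M"
  shows "carrier_mod M" "mE M \<in> carrier_mat (mdim M) (mdim M)" "mK M \<in> carrier_mat (mdim M) (mdim M)"
    "mE M ^\<^sub>m d = 0\<^sub>m (mdim M) (mdim M)" "mK M ^\<^sub>m d = 1\<^sub>m (mdim M)"
    "mK M * mE M = q\<^sup>2 \<cdot>\<^sub>m (mE M * mK M)"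
  using assms by (auto simp: borel_action_def carrier_mod_def)

lemma carrier_modD:
  assumes "carrier_mod M"
  shows "mE M \<in> carrier_mat (mdim M) (mdim M)" "mK M \<in> carrier_mat (mdim M) (mdim M)"
  using assms by (auto simp: carrier_mod_def)

text \<open>The inverse \<open>X\<close> in the ring of operators need not come from a matrix. As the operator of \<open>A\<close> maps
  the first block to itself, the part of \<open>X\<close> in that block already inverts \<open>A\<close>.\<close>

lemma mat_right_inverse_from_opr:
  assumes "A \<in> carrier_mat m m" "mat_opr m A * X = 1"
  shows "\<exists>Z\<in>carrier_mat m m. A * Z = 1\<^sub>m m"
proof
  define Z where "Z = mat m m (\<lambda>(r, s). apply_opr X (\<lambda>i. if i = s then 1 else 0) r)"
  show "A * Z = 1\<^sub>m m"
  proof (rule eq_matI)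
    fix r s assume "r < dim_row (1\<^sub>m m)" "s < dim_col (1\<^sub>m m)"
    then have rs: "r < m" "s < m" by auto
    let ?e = "\<lambda>i. if i = s then 1 else 0"
    have "(A * Z) $$ (r, s) = apply_opr (mat_opr m A) (apply_opr X ?e) r"
      using rs assms by (simp add: Z_def scalar_prod_def atLeast0LessThan mat_opr_def entries_opr.rep_eq)
    also have "\<dots> = apply_opr (mat_opr m A * X) ?e r" by (simp add: times_opr.rep_eq)
    also have "\<dots> = 1\<^sub>m m $$ (r, s)" using rs assms(2) by (simp add: one_opr.rep_eq)
    finally show "(A * Z) $$ (r, s) = 1\<^sub>m m $$ (r, s)" .
  qed (use assms in \<open>auto simp: Z_def\<close>)
  show "Z \<in> carrier_mat m m" by (simp add: Z_def)
qed

section \<open>Isomorphisms\<close>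

lemma mod_isoI:
  assumes "P \<in> carrier_mat (mdim M) (mdim M)" "mdim N = mdim M"
    and "Q \<in> carrier_mat (mdim M) (mdim M)" "P * Q = 1\<^sub>m (mdim M)"
    and "P * mE M = mE N * P" "P * mK M = mK N * P"
  shows "mod_iso P M N"
proof -
  have "Q * P = 1\<^sub>m (mdim M)" using mat_mult_left_right_inverse assms by blast
  then have "invertible_mat P"
    using assms unfolding invertible_mat_def inverts_mat_def by (auto intro!: exI[of _ Q])
  then show ?thesis using assms by (simp add: mod_iso_def)
qed

lemma mod_isoE:
  assumes "mod_iso P M N"
  obtains Q where "mdim N = mdim M" "P \<in> carrier_mat (mdim M) (mdim M)" "Q \<in> carrier_mat (mdim M) (mdim M)"
    "P * Q = 1\<^sub>m (mdim M)" "Q * P = 1\<^sub>m (mdim M)"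
    "P * mE M = mE N * P" "P * mK M = mK N * P"
proof -
  have P: "P \<in> carrier_mat (mdim N) (mdim M)" "invertible_mat P" using assms by (auto simp: mod_iso_def)
  then have n: "mdim N = mdim M" by (auto simp: invertible_mat_def)
  obtain Q where Q: "P * Q = 1\<^sub>m (dim_row P)" "Q * P = 1\<^sub>m (dim_row Q)"
    using P by (auto simp: invertible_mat_def inverts_mat_def)
  have "dim_row Q = mdim M" using arg_cong[OF Q(2), of dim_col] P by simp
  moreover have "dim_col Q = mdim M" using arg_cong[OF Q(1), of dim_col] P n by simp
  ultimately have "Q \<in> carrier_mat (mdim M) (mdim M)" by auto
  then show ?thesis using that[of Q] P n Q assms by (auto simp: mod_iso_def)
qed

lemma mod_iso_dim: "mod_iso P M N \<Longrightarrow> mdim M = mdim N"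
  by (erule mod_isoE) simp

lemma mod_iso_refl:
  assumes "carrier_mod M" shows "mod_iso (1\<^sub>m (mdim M)) M M"
  using assms by (intro mod_isoI[of _ M M "1\<^sub>m (mdim M)"]) (auto simp: carrier_mod_def)

lemma mod_iso_comp:
  assumes "mod_iso P L M" "mod_iso P' M N" "carrier_mod L" "carrier_mod M" "carrier_mod N"
  shows "mod_iso (P' * P) L N"
proof -
  let ?n = "mdim L"
  obtain Q where Q: "mdim M = ?n" "P \<in> carrier_mat ?n ?n" "Q \<in> carrier_mat ?n ?n" "P * Q = 1\<^sub>m ?n"
    "P * mE L = mE M * P" "P * mK L = mK M * P"
    using assms(1) by (elim mod_isoE) auto
  obtain Q' where Q': "mdim N = ?n" "P' \<in> carrier_mat ?n ?n" "Q' \<in> carrier_mat ?n ?n" "P' * Q' = 1\<^sub>m ?n"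
    "P' * mE M = mE N * P'" "P' * mK M = mK N * P'"
    using assms(2) Q(1) by (elim mod_isoE) auto
  note c = assms(3-5)[unfolded carrier_mod_def Q(1) Q'(1)]
  have "(P' * P) * (Q * Q') = P' * (P * (Q * Q'))"
    using Q Q' by (intro assoc_mult_mat) auto
  also have "P * (Q * Q') = (P * Q) * Q'" using Q Q' by (intro assoc_mult_mat[symmetric]) auto
  also have "P' * \<dots> = 1\<^sub>m ?n" using Q Q' by simp
  finally have inv: "(P' * P) * (Q * Q') = 1\<^sub>m ?n" .
  have "(P' * P) * mE L = mE N * (P' * P)" using Q Q' c by (intro intertwining_mult[of _ _ "mE M"]) auto
  moreover have "(P' * P) * mK L = mK N * (P' * P)" using Q Q' c by (intro intertwining_mult[of _ _ "mK M"]) auto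
  ultimately show ?thesis using Q Q' inv by (intro mod_isoI[of _ L N "Q * Q'"]) auto
qed

lemma mod_iso_sym:
  assumes "mod_iso P M N" "carrier_mod M" "carrier_mod N"
  shows "\<exists>Q. mod_iso Q N M"
proof -
  let ?n = "mdim M"
  obtain Q where Q: "mdim N = ?n" "P \<in> carrier_mat ?n ?n" "Q \<in> carrier_mat ?n ?n"
    "P * Q = 1\<^sub>m ?n" "Q * P = 1\<^sub>m ?n" "P * mE M = mE N * P" "P * mK M = mK N * P"
    using assms(1) by (elim mod_isoE) auto
  have i: "Q * Y = X * Q" if "P * X = Y * P" "X \<in> carrier_mat ?n ?n" "Y \<in> carrier_mat ?n ?n" for X Y
  proof -
    have "Q * Y = Q * (Y * (P * Q))" using Q that by simp
    also have "Y * (P * Q) = (P * X) * Q" unfolding that(1) using Q that by (intro assoc_mult_mat[symmetric]) auto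
    also have "Q * \<dots> = Q * (P * (X * Q))" using Q that by (intro arg_cong[of _ _ "\<lambda>A. Q * A"] assoc_mult_mat) auto
    also have "\<dots> = (Q * P) * (X * Q)" using Q that by (intro assoc_mult_mat[symmetric]) auto
    finally show ?thesis using Q that by simp
  qed
  have "mod_iso Q N M"
    using Q assms(2,3) by (intro mod_isoI[of _ N M P]) (auto intro!: i simp: carrier_mod_def)
  then show ?thesis by blast
qed

lemma isomorphic_refl: "carrier_mod M \<Longrightarrow> isomorphic M M"
  using mod_iso_refl by (auto simp: isomorphic_def)

lemma isomorphic_sym: "isomorphic M N \<Longrightarrow> carrier_mod M \<Longrightarrow> carrier_mod N \<Longrightarrow> isomorphic N M"
  using mod_iso_sym by (auto simp: isomorphic_def)

lemma isomorphic_trans: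
  "isomorphic L M \<Longrightarrow> isomorphic M N \<Longrightarrow> carrier_mod L \<Longrightarrow> carrier_mod M \<Longrightarrow> carrier_mod N \<Longrightarrow>
    isomorphic L N"
  unfolding isomorphic_def by (blast intro: mod_iso_comp)

lemma isomorphic_dim: "isomorphic M N \<Longrightarrow> mdim M = mdim N"
  using mod_iso_dim by (auto simp: isomorphic_def)

section \<open>Tensor products\<close>

lemma mod_tensor_sel [simp]:
  "mdim (mod_tensor M N) = mdim M * mdim N"
  "mE (mod_tensor M N) = kron (1\<^sub>m (mdim M)) (mE N) + kron (mE M) (mK N)"
  "mK (mod_tensor M N) = kron (mK M) (mK N)"
  by (simp_all add: mod_tensor_def)

lemma carrier_mod_tensor: "carrier_mod M \<Longrightarrow> carrier_mod N \<Longrightarrow> carrier_mod (mod_tensor M N)"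
  by (auto simp: carrier_mod_def)

lemma mod_iso_tensor:
  assumes "mod_iso P M M'" "mod_iso P' N N'" "carrier_mod M" "carrier_mod M'" "carrier_mod N" "carrier_mod N'"
  shows "mod_iso (kron P P') (mod_tensor M N) (mod_tensor M' N')"
proof -
  let ?m = "mdim M" and ?n = "mdim N"
  obtain Q where Q: "mdim M' = ?m" "P \<in> carrier_mat ?m ?m" "Q \<in> carrier_mat ?m ?m"
    "P * Q = 1\<^sub>m ?m" "P * mE M = mE M' * P" "P * mK M = mK M' * P"
    using assms(1) by (elim mod_isoE) auto
  obtain Q' where Q': "mdim N' = ?n" "P' \<in> carrier_mat ?n ?n" "Q' \<in> carrier_mat ?n ?n"
    "P' * Q' = 1\<^sub>m ?n" "P' * mE N = mE N' * P'" "P' * mK N = mK N' * P'"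
    using assms(2) by (elim mod_isoE) auto
  have c: "mE M \<in> carrier_mat ?m ?m" "mK M \<in> carrier_mat ?m ?m" "mE M' \<in> carrier_mat ?m ?m" "mK M' \<in> carrier_mat ?m ?m"
    "mE N \<in> carrier_mat ?n ?n" "mK N \<in> carrier_mat ?n ?n" "mE N' \<in> carrier_mat ?n ?n" "mK N' \<in> carrier_mat ?n ?n"
    using assms(3-6) Q(1) Q'(1) by (auto simp: carrier_mod_def)
  have km: "kron P P' * kron X Y = kron (P * X) (P' * Y)" "kron X Y * kron P P' = kron (X * P) (Y * P')"
    if "X \<in> carrier_mat ?m ?m" "Y \<in> carrier_mat ?n ?n" for X Y
    using Q Q' that by (auto intro!: kron_mult)
  show ?thesis
  proof (rule mod_isoI[where Q = "kron Q Q'"])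
    show "kron P P' * kron Q Q' = 1\<^sub>m (mdim (mod_tensor M N))"
      using km[of Q Q'] Q Q' by (simp add: kron_one)
    show "kron P P' * mK (mod_tensor M N) = mK (mod_tensor M' N') * kron P P'"
      using c Q Q' by (simp add: km)
    have "kron P P' * mE (mod_tensor M N) = kron P P' * kron (1\<^sub>m ?m) (mE N) + kron P P' * kron (mE M) (mK N)"
      unfolding mod_tensor_sel using c Q Q' by (intro mult_add_distrib_mat) auto
    also have "\<dots> = kron (1\<^sub>m ?m) (mE N') * kron P P' + kron (mE M') (mK N') * kron P P'"
      using c Q Q' by (simp add: km)
    also have "\<dots> = mE (mod_tensor M' N') * kron P P'"
      unfolding mod_tensor_sel Q(1) using c Q Q' by (intro add_mult_distrib_mat[symmetric]) auto
    finally show "kron P P' * mE (mod_tensor M N) = mE (mod_tensor M' N') * kron P P'" .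
  qed (use Q Q' in auto)
qed

text \<open>For a \<open>d\<close>-th root of unity \<open>s\<close>, the simple module on which \<open>K\<close> acts by \<open>s\<close>.\<close>

definition line :: "complex \<Rightarrow> uqp_mod" where
  "line s = \<lparr>mdim = 1, mE = 0\<^sub>m 1 1, mK = s \<cdot>\<^sub>m 1\<^sub>m 1\<rparr>"

text \<open>The tensor product with \<open>line s\<close> on the left; see \<open>line_tensor\<close>.\<close>

definition twist :: "complex \<Rightarrow> uqp_mod \<Rightarrow> uqp_mod" where
  "twist s M = \<lparr>mdim = mdim M, mE = mE M, mK = s \<cdot>\<^sub>m mK M\<rparr>"

lemma line_sel [simp]: "mdim (line s) = 1" "mE (line s) = 0\<^sub>m 1 1" "mK (line s) = s \<cdot>\<^sub>m 1\<^sub>m 1"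
  by (simp_all add: line_def)

lemma twist_sel [simp]: "mdim (twist s M) = mdim M" "mE (twist s M) = mE M" "mK (twist s M) = s \<cdot>\<^sub>m mK M"
  by (simp_all add: twist_def)

lemma carrier_mod_line: "carrier_mod (line s)" by (auto simp: carrier_mod_def)

lemma carrier_mod_twist: "carrier_mod M \<Longrightarrow> carrier_mod (twist s M)" by (auto simp: carrier_mod_def)

text \<open>Since \<open>E\<close> acts by 0 on \<open>line s\<close> and the Kronecker product with a \<open>1 \<times> 1\<close> matrix is scaling, this
  is an equality and not just an isomorphism.\<close>

lemma line_tensor: "carrier_mod M \<Longrightarrow> mod_tensor (line s) M = twist s M"
proof -
  assume c: "carrier_mod M"
  note d = carrier_modD[OF c]
  have "mE M + 0\<^sub>m (mdim M) (mdim M) = mE M" using d by auto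
  then show ?thesis using d
    by (simp add: mod_tensor_def twist_def kron_zero_left kron_smult_left kron_one_left[simplified])
qed

text \<open>
  Both modules carry the same \<open>K\<close>. In the first, \<open>E \<otimes> K\<close> is multiplied by the scalar \<open>s'\<close>;
  conjugation by \<open>K ^ t\<close> on \<open>X\<close> multiplies \<open>E\<close> by \<open>w ^ t\<close>, which removes it when \<open>w ^ t\<close> is the
  inverse of \<open>s'\<close>.\<close>

lemma mod_iso_twist_tensor:
  assumes "root_of_unity q d" "borel_action q d X" "carrier_mod Y" "s' ^ d = 1"
  shows "\<exists>P. mod_iso P (mod_tensor (twist s X) (twist s' Y)) (twist (s * s') (mod_tensor X Y))"
proof -
  interpret root_of_unity q d by fact
  let ?m = "mdim X" and ?n = "mdim Y"
  note X = borel_actionD[OF assms(2)] and Y = carrier_modD[OF assms(3)]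
  have "inverse s' ^ d = 1" using assms(4) by (simp add: power_inverse)
  then obtain t where t: "t < d" "inverse s' = w ^ t" by (rule root_of_unity_is_power)
  have s': "s' \<noteq> 0" using assms(4) d_ge_2 by (auto simp: power_0_left)
  define T where "T = mK X ^\<^sub>m t"
  define T' where "T' = mK X ^\<^sub>m (d - t)"
  have T: "T \<in> carrier_mat ?m ?m" "T' \<in> carrier_mat ?m ?m" using X by (auto simp: T_def T'_def)
  have TT': "T * T' = 1\<^sub>m ?m"
  proof -
    have "mK X ^\<^sub>m (t + (d - t)) = T * T'" unfolding T_def T'_def using X(3) by (rule pow_mat_add)
    then show ?thesis using t X by simp
  qed
  have TE: "mK X ^\<^sub>m k * mE X = w ^ k \<cdot>\<^sub>m (mE X * mK X ^\<^sub>m k)" for k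
  proof (induction k)
    case (Suc k)
    let ?K = "mK X" and ?E = "mE X"
    have kk: "?K ^\<^sub>m k \<in> carrier_mat ?m ?m" using X by simp
    have "?K ^\<^sub>m Suc k * ?E = ?K ^\<^sub>m k * (?K * ?E)" unfolding pow_mat.simps
      using X kk by (intro assoc_mult_mat) auto
    also have "\<dots> = w \<cdot>\<^sub>m (?K ^\<^sub>m k * (?E * ?K))"
      unfolding X(6) w_def using X kk by (intro mult_smult_distrib) auto
    also have "?K ^\<^sub>m k * (?E * ?K) = (?K ^\<^sub>m k * ?E) * ?K" using X kk by (intro assoc_mult_mat[symmetric]) auto
    also have "\<dots> = w ^ k \<cdot>\<^sub>m (?E * ?K ^\<^sub>m k * ?K)" unfolding Suc using X kk by (intro mult_smult_assoc_mat) auto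
    also have "?E * ?K ^\<^sub>m k * ?K = ?E * (?K ^\<^sub>m k * ?K)" using X kk by (intro assoc_mult_mat) auto
    finally show ?case by (simp add: smult_smult_mat mult.commute)
  qed (use X in \<open>simp, intro eq_matI, auto\<close>)
  have TK: "T * mK X = mK X * T" unfolding T_def
    using pow_mat_add[OF X(3), of t 1] pow_mat_add[OF X(3), of 1 t] X(3) by (simp add: add.commute)
  have km: "kron T (1\<^sub>m ?n) * kron A B = kron (T * A) B" "kron A B * kron T (1\<^sub>m ?n) = kron (A * T) B"
    if "A \<in> carrier_mat ?m ?m" "B \<in> carrier_mat ?n ?n" for A B
    using kron_mult[of T ?m ?m A ?m "1\<^sub>m ?n" ?n ?n B ?n] kron_mult[of A ?m ?m T ?m B ?n ?n "1\<^sub>m ?n" ?n] that T by auto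
  have "mod_iso (kron T (1\<^sub>m ?n)) (mod_tensor (twist s X) (twist s' Y)) (twist (s * s') (mod_tensor X Y))"
  proof (rule mod_isoI[where Q = "kron T' (1\<^sub>m ?n)"])
    show "kron T (1\<^sub>m ?n) * kron T' (1\<^sub>m ?n) = 1\<^sub>m (mdim (mod_tensor (twist s X) (twist s' Y)))"
      using T by (simp add: km TT' kron_one)
    show "kron T (1\<^sub>m ?n) * mK (mod_tensor (twist s X) (twist s' Y)) = mK (twist (s * s') (mod_tensor X Y)) * kron T (1\<^sub>m ?n)"
    proof -
      have "kron T (1\<^sub>m ?n) * mK (mod_tensor (twist s X) (twist s' Y)) = kron T (1\<^sub>m ?n) * ((s * s') \<cdot>\<^sub>m kron (mK X) (mK Y))"
        by (simp add: kron_smult_left kron_smult_right smult_smult_mat mult.commute)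
      also have "\<dots> = (s * s') \<cdot>\<^sub>m (kron (mK X) (mK Y) * kron T (1\<^sub>m ?n))"
        using X Y T by (subst mult_smult_distrib[of _ "?m * ?n" "?m * ?n" _ "?m * ?n"]) (auto simp: km TK)
      also have "\<dots> = mK (twist (s * s') (mod_tensor X Y)) * kron T (1\<^sub>m ?n)"
        using X Y T by (simp, intro mult_smult_assoc_mat[symmetric]) auto
      finally show ?thesis .
    qed
    show "kron T (1\<^sub>m ?n) * mE (mod_tensor (twist s X) (twist s' Y)) = mE (twist (s * s') (mod_tensor X Y)) * kron T (1\<^sub>m ?n)"
    proof -
      have "kron T (1\<^sub>m ?n) * mE (mod_tensor (twist s X) (twist s' Y))
         = kron T (1\<^sub>m ?n) * kron (1\<^sub>m ?m) (mE Y) + kron T (1\<^sub>m ?n) * kron (mE X) (s' \<cdot>\<^sub>m mK Y)"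
        unfolding mod_tensor_sel twist_sel using X Y T by (intro mult_add_distrib_mat) auto
      also have "\<dots> = kron T (mE Y) + kron (T * mE X) (s' \<cdot>\<^sub>m mK Y)"
        using X Y T by (simp add: km)
      also have "kron (T * mE X) (s' \<cdot>\<^sub>m mK Y) = kron (mE X * T) (mK Y)"
        using right_inverse[OF s']
        by (simp add: T_def TE kron_smult_left kron_smult_right smult_smult_mat one_smult_mat flip: t(2))
      also have "kron T (mE Y) + kron (mE X * T) (mK Y)
         = kron (1\<^sub>m ?m) (mE Y) * kron T (1\<^sub>m ?n) + kron (mE X) (mK Y) * kron T (1\<^sub>m ?n)"
        using X Y T by (simp add: km)
      also have "\<dots> = mE (twist (s * s') (mod_tensor X Y)) * kron T (1\<^sub>m ?n)"
        unfolding mod_tensor_sel twist_sel using X Y T by (intro add_mult_distrib_mat[symmetric]) auto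
      finally show ?thesis .
    qed
  qed (use T X Y in auto)
  then show ?thesis by blast
qed

section \<open>The braiding\<close>

text \<open>The operators of the two tensor factors on \<open>X \<otimes> Y\<close> satisfy the assumptions of
  \<open>rmatrix_algebra\<close>, and the matrix \<open>R_action\<close> is \<open>R_element\<close>. So it is invertible and turns the
  coproduct into the opposite one, which the flip turns into the coproduct on \<open>Y \<otimes> X\<close>.\<close>

lemma mod_iso_braiding:
  assumes "root_of_unity q d" "borel_action q d X" "sl2_action q d Y F" "0 < mdim X" "0 < mdim Y"
  shows "mod_iso (braiding q d X Y F) (mod_tensor X Y) (mod_tensor Y X)"
proof -
  interpret root_of_unity q d by fact
  let ?m = "mdim X" and ?n = "mdim Y"
  let ?N = "?m * ?n"
  have Ya: "borel_action q d Y" and F: "F \<in> carrier_mat ?n ?n"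
    "mK Y * F = inverse (q\<^sup>2) \<cdot>\<^sub>m (F * mK Y)"
    "mE Y * F - F * mE Y = (1 / (q - inverse q)) \<cdot>\<^sub>m (mK Y - mK Y ^\<^sub>m (d - 1))"
    using assms(3) by (auto simp: sl2_action_def)
  note X = borel_actionD[OF assms(2)] and Y = borel_actionD[OF Ya]
  have N: "0 < ?N" using assms by simp
  define lo where "lo A = mat_opr ?N (kron A (1\<^sub>m ?n))" for A
  define ro where "ro B = mat_opr ?N (kron (1\<^sub>m ?m) B)" for B
  have lo_mult: "lo (A * B) = lo A * lo B" if "A \<in> carrier_mat ?m ?m" "B \<in> carrier_mat ?m ?m" for A B
    unfolding lo_def using that N kron_mult[of A ?m ?m B ?m "1\<^sub>m ?n" ?n ?n "1\<^sub>m ?n" ?n]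
    by (subst mat_opr_mult[symmetric]) auto
  have ro_mult: "ro (A * B) = ro A * ro B" if "A \<in> carrier_mat ?n ?n" "B \<in> carrier_mat ?n ?n" for A B
    unfolding ro_def using that N kron_mult[of "1\<^sub>m ?m" ?m ?m "1\<^sub>m ?m" ?m A ?n ?n B ?n]
    by (subst mat_opr_mult[symmetric]) auto
  have lo_pow: "lo (A ^\<^sub>m k) = lo A ^ k" if "A \<in> carrier_mat ?m ?m" for A k
    unfolding lo_def using that N by (simp add: mat_opr_pow[symmetric] kron_carrier kron_pow_left)
  have ro_pow: "ro (A ^\<^sub>m k) = ro A ^ k" if "A \<in> carrier_mat ?n ?n" for A k
    unfolding ro_def using that N by (simp add: mat_opr_pow[symmetric] kron_carrier kron_pow_right)
  have lo_smult: "lo (c \<cdot>\<^sub>m A) = scale_opr c (lo A)" if "A \<in> carrier_mat ?m ?m" for c A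
    unfolding lo_def kron_smult_left using that N by (intro mat_opr_smult) auto
  have ro_smult: "ro (c \<cdot>\<^sub>m A) = scale_opr c (ro A)" if "A \<in> carrier_mat ?n ?n" for c A
    unfolding ro_def kron_smult_right using that N by (intro mat_opr_smult) auto
  have ro_diff: "ro (A - B) = ro A - ro B" if "A \<in> carrier_mat ?n ?n" "B \<in> carrier_mat ?n ?n" for A B
  proof -
    have "kron (1\<^sub>m ?m) (A - B) = kron (1\<^sub>m ?m) A - kron (1\<^sub>m ?m) B"
      using that by (intro eq_matI) (auto simp: kron_index div_mod_less right_diff_distrib)
    then show ?thesis unfolding ro_def using that N by (simp add: mat_opr_diff kron_carrier)
  qed
  have lo_ro: "lo A * ro B = mat_opr ?N (kron A B)" "ro B * lo A = mat_opr ?N (kron A B)"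
    if "A \<in> carrier_mat ?m ?m" "B \<in> carrier_mat ?n ?n" for A B
    unfolding lo_def ro_def using that N
      kron_mult[of A ?m ?m "1\<^sub>m ?m" ?m "1\<^sub>m ?n" ?n ?n B ?n] kron_mult[of "1\<^sub>m ?m" ?m ?m A ?m B ?n ?n "1\<^sub>m ?n" ?n]
    by (simp_all add: mat_opr_mult[symmetric] kron_carrier)
  interpret R: rmatrix_algebra scale_opr q d "lo (mE X)" "lo (mK X)" "ro (mE Y)" "ro F" "ro (mK Y)"
  proof
    show "lo (mE X) ^ d = 0" 
      using X N by (simp add: lo_pow[symmetric]) (simp add: lo_def kron_zero_left mat_opr_zero)
    show "lo (mK X) ^ d = 1" 
      using X N by (simp add: lo_pow[symmetric]) (simp add: lo_def kron_one mat_opr_one)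
    show "ro (mK Y) ^ d = 1" 
      using Y N by (simp add: ro_pow[symmetric]) (simp add: ro_def kron_one mat_opr_one)
    show "lo (mK X) * lo (mE X) = scale_opr w (lo (mE X) * lo (mK X))"
      using X by (simp add: lo_mult[symmetric] lo_smult w_def)
    show "ro (mK Y) * ro (mE Y) = scale_opr w (ro (mE Y) * ro (mK Y))"
      using Y by (simp add: ro_mult[symmetric] ro_smult w_def)
    show "ro (mK Y) * ro F = scale_opr (inverse w) (ro F * ro (mK Y))"
      using Y F by (simp add: ro_mult[symmetric] ro_smult w_def)
    show "ro (mE Y) * ro F - ro F * ro (mE Y) = scale_opr (1 / (q - inverse q)) (ro (mK Y) - ro (mK Y) ^ (d - 1))"
      using Y F by (simp add: ro_mult[symmetric] ro_diff[symmetric] ro_pow[symmetric] ro_smult[symmetric]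
          mult_carrier_mat[of _ ?n ?n] pow_carrier_mat minus_carrier_mat)
  qed (use X Y F in \<open>simp_all add: lo_ro\<close>)
  define Rm where "Rm = R_action q d X Y F"
  have Rc: "Rm \<in> carrier_mat ?N ?N" by (simp add: Rm_def R_action_def)
  have Ro: "mat_opr ?N Rm = R.R_element"
  proof -
    have k: "mat_opr ?N (kron (mE X ^\<^sub>m k * mK X ^\<^sub>m i) (F ^\<^sub>m k * mK Y ^\<^sub>m j))
      = (lo (mE X) ^ k * lo (mK X) ^ i) * (ro F ^ k * ro (mK Y) ^ j)" for i j k
      using X Y F by (subst lo_ro(1)[symmetric])
        (auto simp: lo_mult ro_mult lo_pow ro_pow intro!: mult_carrier_mat pow_carrier_mat)
    show ?thesis
      unfolding Rm_def R_action_def mat_opr_mat[OF N] entries_opr_scale entries_opr_sum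
      unfolding R.R_element_def k[symmetric] mat_opr_def ..
  qed
  obtain Z where Z: "Z \<in> carrier_mat ?N ?N" "Rm * Z = 1\<^sub>m ?N"
    using mat_right_inverse_from_opr[OF Rc] R.R_element_right_inverse unfolding Ro by blast
  let ?D = "kron (1\<^sub>m ?m) (mE Y) + kron (mE X) (mK Y)"
  let ?D' = "kron (mE X) (1\<^sub>m ?n) + kron (mK X) (mE Y)"
  have D: "?D \<in> carrier_mat ?N ?N" "?D' \<in> carrier_mat ?N ?N" using X Y by auto
  have RE: "Rm * ?D = ?D' * Rm"
  proof (rule mat_opr_inject[of _ ?N])
    have "mat_opr ?N ?D = ro (mE Y) + lo (mE X) * ro (mK Y)"
      using X Y N by (simp add: mat_opr_add kron_carrier lo_ro ro_def[symmetric])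
    moreover have "mat_opr ?N ?D' = lo (mE X) + lo (mK X) * ro (mE Y)"
      using X Y N by (simp add: mat_opr_add kron_carrier lo_ro lo_def[symmetric])
    ultimately show "mat_opr ?N (Rm * ?D) = mat_opr ?N (?D' * Rm)"
      using N D Rc by (simp only: mat_opr_mult Ro R.R_element_coproduct)
  qed (use Rc D in auto)
  have RK: "Rm * kron (mK X) (mK Y) = kron (mK X) (mK Y) * Rm"
  proof (rule mat_opr_inject[of _ ?N])
    show "mat_opr ?N (Rm * kron (mK X) (mK Y)) = mat_opr ?N (kron (mK X) (mK Y) * Rm)"
      using N X Y Rc R.R_element_K by (simp add: mat_opr_mult kron_carrier Ro lo_ro)
  qed (use Rc X Y in auto)
  let ?f = "flip_mat ?m ?n" and ?g = "flip_mat ?n ?m"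
  have fg: "?f \<in> carrier_mat ?N ?N" "?g \<in> carrier_mat ?N ?N"
    using flip_carrier[of ?m ?n] flip_carrier[of ?n ?m] by (simp_all add: mult.commute)
  have fD: "?f * ?D' = mE (mod_tensor Y X) * ?f"
  proof -
    have "?f * ?D' = ?f * kron (mE X) (1\<^sub>m ?n) + ?f * kron (mK X) (mE Y)"
      using X Y fg by (intro mult_add_distrib_mat) auto
    also have "\<dots> = kron (1\<^sub>m ?n) (mE X) * ?f + kron (mE Y) (mK X) * ?f"
      using X Y by (simp add: flip_kron)
    also have "\<dots> = mE (mod_tensor Y X) * ?f"
      unfolding mod_tensor_sel using X Y 
      by (intro add_mult_distrib_mat[symmetric, of _ "?n * ?m" "?n * ?m" _ _ "?m * ?n"]) auto
    finally show ?thesis .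
  qed
  have fK: "?f * kron (mK X) (mK Y) = mK (mod_tensor Y X) * ?f"
    using X Y by (simp add: flip_kron)
  have br: "braiding q d X Y F = ?f * Rm" by (simp add: braiding_def Rm_def)
  have "?f * Rm * (Z * ?g) = 1\<^sub>m ?N"
  proof -
    have "?f * Rm * (Z * ?g) = ?f * (Rm * (Z * ?g))" using fg Rc Z by (intro assoc_mult_mat) auto
    also have "Rm * (Z * ?g) = (Rm * Z) * ?g" using fg Rc Z by (intro assoc_mult_mat[symmetric]) auto
    finally show ?thesis using fg Z by (simp add: flip_flip mult.commute)
  qed
  moreover have Dc: "mE (mod_tensor Y X) \<in> carrier_mat ?N ?N" "mK (mod_tensor Y X) \<in> carrier_mat ?N ?N"
    using carrier_modD[OF carrier_mod_tensor[OF Y(1) X(1)]] by (simp_all add: mult.commute)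
  have "?f * Rm * ?D = mE (mod_tensor Y X) * (?f * Rm)" by (rule intertwining_mult[OF RE fD Rc fg(1) D(1) Dc(1) D(2)])
  moreover have "?f * Rm * kron (mK X) (mK Y) = mK (mod_tensor Y X) * (?f * Rm)"
    using X Y by (intro intertwining_mult[OF RK fK Rc fg(1) _ Dc(2)]) auto
  ultimately show ?thesis
    unfolding br using fg Rc Z by (intro mod_isoI[where Q = "Z * ?g"]) (auto simp: mult.commute)
qed

section \<open>The quotient algebra of the free algebra\<close>

lemma ring_free_ring: "ring free_ring"
proof (rule ringI)
  show "abelian_group free_ring"
    by (rule abelian_groupI) (auto simp: free_ring_def add_ac intro: exI[of _ "- x" for x] left_minus)
  show "monoid free_ring" by standard (auto simp: free_ring_def mult.assoc)
qed (auto simp: free_ring_def algebra_simps)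

lemma free_ring_sel [simp]:
  "carrier free_ring = UNIV" "x \<otimes>\<^bsub>free_ring\<^esub> y = x * y" "x \<oplus>\<^bsub>free_ring\<^esub> y = x + y"
  "\<one>\<^bsub>free_ring\<^esub> = 1" "\<zero>\<^bsub>free_ring\<^esub> = 0"
  by (simp_all add: free_ring_def)

lemma ideal_uq_ideal: "ideal (uq_ideal q d) free_ring"
  unfolding uq_ideal_def by (rule ring.genideal_ideal[OF ring_free_ring]) simp

lemma ring_uq: "ring (uq q d)"
  unfolding uq_def by (rule ideal.quotient_is_ring[OF ideal_uq_ideal])

lemma carrier_uq: "carrier (uq q d) = range (uq_class q d)"
  by (auto simp: uq_def FactRing_def A_RCOSETS_def' uq_class_def)

lemma uq_class_hom:
  "uq_class q d (x * y) = uq_class q d x \<otimes>\<^bsub>uq q d\<^esub> uq_class q d y"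
  "uq_class q d (x + y) = uq_class q d x \<oplus>\<^bsub>uq q d\<^esub> uq_class q d y"
  "uq_class q d 1 = \<one>\<^bsub>uq q d\<^esub>"
proof -
  have h: "uq_class q d \<in> Ring.ring_hom free_ring (uq q d)"
    using ideal.rcos_ring_hom[OF ideal_uq_ideal[of q d]] unfolding uq_def uq_class_def[abs_def] .
  show "uq_class q d (x * y) = uq_class q d x \<otimes>\<^bsub>uq q d\<^esub> uq_class q d y"
    "uq_class q d (x + y) = uq_class q d x \<oplus>\<^bsub>uq q d\<^esub> uq_class q d y"
    "uq_class q d 1 = \<one>\<^bsub>uq q d\<^esub>"
    using ring_hom_mult[OF h, of x y] ring_hom_add[OF h, of x y] ring_hom_one[OF h] by simp_all
qed

lemma uq_class_0: "uq_class q d 0 = \<zero>\<^bsub>uq q d\<^esub>"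
proof -
  interpret U: ring "uq q d" by (rule ring_uq)
  have "uq_class q d 0 \<oplus>\<^bsub>uq q d\<^esub> uq_class q d 0 = uq_class q d 0"
    by (simp flip: uq_class_hom)
  then show ?thesis using U.add.l_cancel_one[of "uq_class q d 0" "uq_class q d 0"] carrier_uq[of q d] by auto
qed

lemma uq_class_eqI:
  assumes "x - y \<in> uq_relators q d"
  shows "uq_class q d x = uq_class q d y"
proof -
  interpret ideal "uq_ideal q d" free_ring by (rule ideal_uq_ideal)
  have "x - y \<in> uq_ideal q d"
    using assms ring.genideal_self[OF ring_free_ring, of "uq_relators q d"] by (auto simp: uq_ideal_def)
  moreover have "0 \<in> uq_ideal q d" using additive_subgroup.zero_closed[OF is_additive_subgroup] by simp
  ultimately have "uq_class q d (x - y) = uq_class q d 0"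
    by (simp add: uq_class_def a_rcos_const)
  then have "uq_class q d ((x - y) + y) = uq_class q d (0 + y)"
    by (simp only: uq_class_hom)
  then show ?thesis by simp
qed

lemma uq_relators_mem:
  "var GE ^ d \<in> uq_relators q d" "var GF ^ d \<in> uq_relators q d" "var GK ^ d - 1 \<in> uq_relators q d"
  "var GK * var GE - const (q\<^sup>2) * var GE * var GK \<in> uq_relators q d"
  "var GK * var GF - const (inverse (q\<^sup>2)) * var GF * var GK \<in> uq_relators q d"
  "var GE * var GF - var GF * var GE - const (1 / (q - inverse q)) * (var GK - var GK ^ (d - 1))
    \<in> uq_relators q d"
  unfolding uq_relators_def Let_def by blast+

lemma const_1: "const 1 = 1"
  by (simp add: const_def single_one[symmetric] zero_list_def del: single_one)

lemma const_0: "const 0 = 0"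
  by (simp add: const_def)

lemma const_minus: "const (- a) = - const a"
  by (simp add: const_def Poly_Mapping.single_uminus)

section \<open>The relations hold in every representation\<close>

text \<open>A representation of a subalgebra \<open>C\<close> of \<open>u_q\<close>, so that \<open>u_q\<close> and \<open>u_q^+\<close> are treated at once. It
  is pulled back to the elements of the free algebra whose classes lie in \<open>C\<close>.\<close>

locale subalgebra_rep =
  fixes q :: complex and d m :: nat and C :: "free_alg set set" and \<rho> :: "free_alg set \<Rightarrow> complex mat"
  assumes rep: "algebra_rep q d ((uq q d)\<lparr>carrier := C\<rparr>) m \<rho>"
    and C_mult: "x \<in> C \<Longrightarrow> y \<in> C \<Longrightarrow> x \<otimes>\<^bsub>uq q d\<^esub> y \<in> C"
    and C_add: "x \<in> C \<Longrightarrow> y \<in> C \<Longrightarrow> x \<oplus>\<^bsub>uq q d\<^esub> y \<in> C"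
    and C_const: "uq_class q d (const c) \<in> C"
begin

definition lifts :: "free_alg set" where "lifts = {x. uq_class q d x \<in> C}"
definition act :: "free_alg \<Rightarrow> complex mat" where "act x = \<rho> (uq_class q d x)"

lemma lifts_closed: "x \<in> lifts \<Longrightarrow> y \<in> lifts \<Longrightarrow> x * y \<in> lifts" "x \<in> lifts \<Longrightarrow> y \<in> lifts \<Longrightarrow> x + y \<in> lifts" "const c \<in> lifts"
  using C_mult C_add C_const by (auto simp: lifts_def uq_class_hom)

lemma one_lifts: "1 \<in> lifts" using lifts_closed(3)[of 1] by (simp add: const_1)

lemma lifts_power: "x \<in> lifts \<Longrightarrow> x ^ k \<in> lifts"
  by (induction k) (auto intro: lifts_closed one_lifts)

lemma act:
  "x \<in> lifts \<Longrightarrow> act x \<in> carrier_mat m m"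
  "x \<in> lifts \<Longrightarrow> y \<in> lifts \<Longrightarrow> act (x * y) = act x * act y"
  "x \<in> lifts \<Longrightarrow> y \<in> lifts \<Longrightarrow> act (x + y) = act x + act y"
  "act (const c) = c \<cdot>\<^sub>m 1\<^sub>m m"
proof -
  have h: "\<rho> \<in> Ring.ring_hom ((uq q d)\<lparr>carrier := C\<rparr>) (ring_mat TYPE(complex) m ())"
    and c: "\<rho> (uq_class q d (const c)) = c \<cdot>\<^sub>m 1\<^sub>m m"
    using rep by (auto simp: algebra_rep_def)
  show "act (const c) = c \<cdot>\<^sub>m 1\<^sub>m m" using c by (simp add: act_def)
  show "x \<in> lifts \<Longrightarrow> act x \<in> carrier_mat m m"
    using ring_hom_closed[OF h] by (simp add: act_def lifts_def ring_mat_def)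
  show "x \<in> lifts \<Longrightarrow> y \<in> lifts \<Longrightarrow> act (x * y) = act x * act y"
    using ring_hom_mult[OF h] by (simp add: act_def lifts_def ring_mat_def uq_class_hom)
  show "x \<in> lifts \<Longrightarrow> y \<in> lifts \<Longrightarrow> act (x + y) = act x + act y"
    using ring_hom_add[OF h] by (simp add: act_def lifts_def ring_mat_def uq_class_hom)
qed

lemma act_1: "act 1 = 1\<^sub>m m" using act(4)[of 1] by (simp add: const_1) (intro eq_matI; simp)
lemma act_0: "act 0 = 0\<^sub>m m m" using act(4)[of 0] by (simp add: const_0) (intro eq_matI; simp)

lemma act_power: "x \<in> lifts \<Longrightarrow> act (x ^ k) = act x ^\<^sub>m k"
proof (induction k)
  case 0 then show ?case using act(1) by (auto simp: act_1)
next
  case (Suc k) then show ?case by (simp add: power_Suc2 act lifts_power del: power_Suc)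
qed

lemma act_cong: "x - y \<in> uq_relators q d \<Longrightarrow> act x = act y"
  by (simp add: act_def uq_class_eqI)

lemma act_const_mult:
  assumes "x \<in> lifts" shows "act (const c * x) = c \<cdot>\<^sub>m act x"
proof -
  have "act (const c * x) = (c \<cdot>\<^sub>m 1\<^sub>m m) * act x" using assms by (simp add: act lifts_closed)
  also have "\<dots> = c \<cdot>\<^sub>m (1\<^sub>m m * act x)" using act(1)[OF assms] by (intro mult_smult_assoc_mat) auto
  finally show ?thesis using act(1)[OF assms] by simp
qed

text \<open>Each relator has class 0, so its two sides act alike.\<close>

lemma borel_relations:
  assumes E: "var GE \<in> lifts" and K: "var GK \<in> lifts"
  shows "act (var GE) ^\<^sub>m d = 0\<^sub>m m m" "act (var GK) ^\<^sub>m d = 1\<^sub>m m"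
    "act (var GK) * act (var GE) = q\<^sup>2 \<cdot>\<^sub>m (act (var GE) * act (var GK))"
proof -
  have "act (var GE ^ d) = act 0" using uq_relators_mem(1) by (intro act_cong) simp
  then show "act (var GE) ^\<^sub>m d = 0\<^sub>m m m" using E by (simp add: act_power act_0)
  have "act (var GK ^ d) = act 1" using uq_relators_mem(3) by (intro act_cong) simp
  then show "act (var GK) ^\<^sub>m d = 1\<^sub>m m" using K by (simp add: act_power act_1)
  have "act (var GK * var GE) = act (const (q\<^sup>2) * (var GE * var GK))"
    using uq_relators_mem(4) by (intro act_cong) (simp add: mult.assoc)
  then show "act (var GK) * act (var GE) = q\<^sup>2 \<cdot>\<^sub>m (act (var GE) * act (var GK))"
    using E K by (metis act(2) act_const_mult lifts_closed(1))
qed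

lemma sl2_relations:
  assumes E: "var GE \<in> lifts" and K: "var GK \<in> lifts" and F: "var GF \<in> lifts"
  shows "act (var GF) ^\<^sub>m d = 0\<^sub>m m m"
    "act (var GK) * act (var GF) = inverse (q\<^sup>2) \<cdot>\<^sub>m (act (var GF) * act (var GK))"
    "act (var GE) * act (var GF) - act (var GF) * act (var GE) =
       (1 / (q - inverse q)) \<cdot>\<^sub>m (act (var GK) - act (var GK) ^\<^sub>m (d - 1))"
proof -
  let ?E = "act (var GE)" and ?F = "act (var GF)" and ?K = "act (var GK)"
  have c: "?E \<in> carrier_mat m m" "?F \<in> carrier_mat m m" "?K \<in> carrier_mat m m" using act(1) E F K by auto
  have "act (var GF ^ d) = act 0" using uq_relators_mem(2) by (intro act_cong) simp
  then show "?F ^\<^sub>m d = 0\<^sub>m m m" using F by (simp add: act_power act_0)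
  have "act (var GK * var GF) = act (const (inverse (q\<^sup>2)) * (var GF * var GK))"
    using uq_relators_mem(5) by (intro act_cong) (simp add: mult.assoc)
  then show "?K * ?F = inverse (q\<^sup>2) \<cdot>\<^sub>m (?F * ?K)"
    using F K by (metis act(2) act_const_mult lifts_closed(1))
  let ?c = "1 / (q - inverse q)"
  have "act (var GE * var GF) = act (var GF * var GE + const ?c * (var GK + const (- 1) * var GK ^ (d - 1)))"
  proof (rule act_cong)
    have "const (- 1) * x = - x" for x by (simp add: const_minus const_1)
    then show "var GE * var GF - (var GF * var GE + const ?c * (var GK + const (- 1) * var GK ^ (d - 1)))
        \<in> uq_relators q d"
      using uq_relators_mem(6)[of q d] by (simp only: diff_diff_add add_uminus_conv_diff)
  qed
  note * = this
  have **: "?E * ?F = ?F * ?E + ?c \<cdot>\<^sub>m (?K + (- 1) \<cdot>\<^sub>m ?K ^\<^sub>m (d - 1))"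
  proof -
    have "var GK ^ (d - 1) \<in> lifts" "const (- 1) * var GK ^ (d - 1) \<in> lifts"
      "var GK + const (- 1) * var GK ^ (d - 1) \<in> lifts"
      using K by (auto intro: lifts_closed lifts_power)
    with E F K show ?thesis
      using * by (simp only: act(2)[OF E F] act(2)[OF F E] act(3) act_const_mult act_power[OF K] lifts_closed)
  qed
  show "?E * ?F - ?F * ?E = ?c \<cdot>\<^sub>m (?K - ?K ^\<^sub>m (d - 1))"
  proof -
    have cancel: "A + a \<cdot>\<^sub>m (B + (- 1) \<cdot>\<^sub>m L) - A = a \<cdot>\<^sub>m (B - L)"
      if "A \<in> carrier_mat m m" "B \<in> carrier_mat m m" "L \<in> carrier_mat m m" for A B L :: "complex mat" and a
      using that by (intro eq_matI) (auto simp: algebra_simps)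
    show ?thesis unfolding ** using c by (intro cancel) (auto intro: pow_carrier_mat)
  qed
qed

end

lemma carrier_update_self: "R\<lparr>carrier := carrier R\<rparr> = R"
  by simp

lemma carrier_update_carrier: "carrier (R\<lparr>carrier := C\<rparr>) = C"
  by simp

lemma uq_plus_eq: "(uq q d)\<lparr>carrier := carrier (uq_plus q d)\<rparr> = uq_plus q d"
  unfolding uq_plus_def carrier_update_carrier by (rule refl)

lemmas uq_eq = carrier_update_self[of "uq q d" for q d]

lemma carrier_uq_plus:
  "carrier (uq_plus q d) = generate_ring (uq q d) (uq_class q d ` (range const \<union> {var GE, var GK}))"
  unfolding uq_plus_def carrier_update_carrier by (rule refl)

lemma carrier_uq_plus_subset: "carrier (uq_plus q d) \<subseteq> carrier (uq q d)"
proof -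
  have "uq_class q d ` (range const \<union> {var GE, var GK}) \<subseteq> carrier (uq q d)"
    by (auto simp: carrier_uq)
  then show ?thesis
    unfolding carrier_uq_plus by (intro subsetI) (rule ring.generate_ring_in_carrier[OF ring_uq])
qed

lemma uq_plus_subalgebra_rep:
  assumes "algebra_rep q d (uq_plus q d) m \<rho>"
  shows "subalgebra_rep q d m (carrier (uq_plus q d)) \<rho>"
proof
  show "algebra_rep q d ((uq q d)\<lparr>carrier := carrier (uq_plus q d)\<rparr>) m \<rho>"
    using assms by (simp only: uq_plus_eq)
qed (auto simp: carrier_uq_plus intro: generate_ring.intros)

lemma uq_subalgebra_rep:
  assumes "algebra_rep q d (uq q d) m \<rho>"
  shows "subalgebra_rep q d m (carrier (uq q d)) \<rho>"
proof
  show "algebra_rep q d ((uq q d)\<lparr>carrier := carrier (uq q d)\<rparr>) m \<rho>"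
    using assms by (simp only: uq_eq)
  interpret ring "uq q d" by (rule ring_uq)
  show "x \<in> carrier (uq q d) \<Longrightarrow> y \<in> carrier (uq q d) \<Longrightarrow> x \<otimes>\<^bsub>uq q d\<^esub> y \<in> carrier (uq q d)" for x y by simp
  show "x \<in> carrier (uq q d) \<Longrightarrow> y \<in> carrier (uq q d) \<Longrightarrow> x \<oplus>\<^bsub>uq q d\<^esub> y \<in> carrier (uq q d)" for x y by simp
  show "uq_class q d (const c) \<in> carrier (uq q d)" for c by (simp add: carrier_uq)
qed

lemma uqp_module_borel_action:
  assumes "uqp_module q d M" shows "borel_action q d M"
proof -
  obtain \<rho> where \<rho>: "algebra_rep q d (uq_plus q d) (mdim M) \<rho>"
    "\<rho> (uq_class q d (var GE)) = mE M" "\<rho> (uq_class q d (var GK)) = mK M"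
    using assms by (auto simp: uqp_module_def)
  interpret subalgebra_rep q d "mdim M" "carrier (uq_plus q d)" \<rho>
    by (rule uq_plus_subalgebra_rep[OF \<rho>(1)])
  have P: "var GE \<in> lifts" "var GK \<in> lifts"
    unfolding lifts_def mem_Collect_eq unfolding carrier_uq_plus by (auto intro: generate_ring.incl)
  then show ?thesis
    using act(1)[OF P(1)] act(1)[OF P(2)] borel_relations[OF P] \<rho>(2,3)
    by (simp add: borel_action_def carrier_mod_def act_def)
qed

lemma uq_extension_sl2_action:
  assumes "uq_extension q d M F" shows "sl2_action q d M F"
proof -
  obtain \<rho> where \<rho>: "algebra_rep q d (uq q d) (mdim M) \<rho>"
    "\<rho> (uq_class q d (var GE)) = mE M" "\<rho> (uq_class q d (var GK)) = mK M" "\<rho> (uq_class q d (var GF)) = F"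
    using assms by (auto simp: uq_extension_def)
  interpret subalgebra_rep q d "mdim M" "carrier (uq q d)" \<rho>
    by (rule uq_subalgebra_rep[OF \<rho>(1)])
  have P: "x \<in> lifts" for x unfolding lifts_def mem_Collect_eq unfolding carrier_uq by simp
  show ?thesis
    using act(1)[OF P, of "var GE"] act(1)[OF P, of "var GK"] act(1)[OF P, of "var GF"]
      borel_relations[OF P P] sl2_relations[OF P P P] \<rho>(2-4)
    by (simp add: sl2_action_def borel_action_def carrier_mod_def act_def)
qed

lemma algebra_rep_subset:
  assumes "algebra_rep q d ((uq q d)\<lparr>carrier := C\<rparr>) m \<rho>" "C' \<subseteq> C"
  shows "algebra_rep q d ((uq q d)\<lparr>carrier := C'\<rparr>) m \<rho>"
  using assms by (auto simp: algebra_rep_def Ring.ring_hom_def subset_eq Pi_iff)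

lemma uq_extension_uqp_module:
  assumes "uq_extension q d M F" shows "uqp_module q d M"
proof -
  obtain \<rho> where \<rho>: "algebra_rep q d (uq q d) (mdim M) \<rho>"
    "\<rho> (uq_class q d (var GE)) = mE M" "\<rho> (uq_class q d (var GK)) = mK M"
    using assms by (auto simp: uq_extension_def)
  have "algebra_rep q d ((uq q d)\<lparr>carrier := carrier (uq_plus q d)\<rparr>) (mdim M) \<rho>"
    by (rule algebra_rep_subset[OF _ carrier_uq_plus_subset]) (use \<rho>(1) in \<open>simp only: uq_eq\<close>)
  then have "algebra_rep q d (uq_plus q d) (mdim M) \<rho>" by (simp only: uq_plus_eq)
  then show ?thesis using \<rho>(2,3) by (auto simp: uqp_module_def)
qed

section \<open>The universal property\<close>

definition word_opr :: "(gen \<Rightarrow> opr) \<Rightarrow> gen list \<Rightarrow> opr" where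
  "word_opr g v = prod_list (map g v)"

definition free_eval :: "(gen \<Rightarrow> opr) \<Rightarrow> free_alg \<Rightarrow> opr" where
  "free_eval g p = (\<Sum>v\<in>Poly_Mapping.keys p. scale_opr (Poly_Mapping.lookup p v) (word_opr g v))"

lemma free_eval_superset:
  assumes "finite S" "Poly_Mapping.keys p \<subseteq> S"
  shows "free_eval g p = (\<Sum>v\<in>S. scale_opr (Poly_Mapping.lookup p v) (word_opr g v))"
  unfolding free_eval_def using assms
  by (intro sum.mono_neutral_left) (auto simp: Poly_Mapping.in_keys_iff)

lemma free_eval_add: "free_eval g (p + r) = free_eval g p + free_eval g r"
proof -
  let ?S = "Poly_Mapping.keys p \<union> Poly_Mapping.keys r"
  have "Poly_Mapping.keys (p + r) \<subseteq> ?S" by (rule Poly_Mapping.keys_add)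
  then show ?thesis
    by (simp add: free_eval_superset[of ?S] Poly_Mapping.lookup_add opr.scale_left_distrib sum.distrib)
qed

lemma free_eval_0: "free_eval g 0 = 0" by (simp add: free_eval_def)

lemma free_eval_sum: "free_eval g (\<Sum>i\<in>I. f i) = (\<Sum>i\<in>I. free_eval g (f i))"
  by (induction I rule: infinite_finite_induct) (simp_all add: free_eval_0 free_eval_add)

lemma free_eval_single: "free_eval g (Poly_Mapping.single v c) = scale_opr c (word_opr g v)"
  by (subst free_eval_superset[of "{v}"]) (auto simp: Poly_Mapping.lookup_single)

lemma free_alg_sum_singles:
  "(p :: free_alg) = (\<Sum>v\<in>Poly_Mapping.keys p. Poly_Mapping.single v (Poly_Mapping.lookup p v))"
proof (rule Poly_Mapping.poly_mapping_eqI)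
  fix u
  have "(\<Sum>v\<in>Poly_Mapping.keys p. Poly_Mapping.lookup p v when v = u) = Poly_Mapping.lookup p u"
    by (auto simp: when_def Poly_Mapping.in_keys_iff)
  then show "Poly_Mapping.lookup p u = Poly_Mapping.lookup
      (\<Sum>v\<in>Poly_Mapping.keys p. Poly_Mapping.single v (Poly_Mapping.lookup p v)) u"
    by (simp add: Poly_Mapping.lookup_sum Poly_Mapping.lookup_single)
qed

lemma free_eval_mult: "free_eval g (p * r) = free_eval g p * free_eval g r"
proof -
  have single: "free_eval g (Poly_Mapping.single u a * Poly_Mapping.single v b)
      = free_eval g (Poly_Mapping.single u a) * free_eval g (Poly_Mapping.single v b)" for u v a b
    by (simp add: Poly_Mapping.mult_single free_eval_single word_opr_def plus_list_def
        opr.scl_mult_left opr.scl_mult_right mult.commute)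
  let ?expand = "\<lambda>p. \<Sum>v\<in>Poly_Mapping.keys p. Poly_Mapping.single v (Poly_Mapping.lookup p v)"
  have "free_eval g (?expand p * ?expand r) = free_eval g (?expand p) * free_eval g (?expand r)"
    by (simp only: sum_product free_eval_sum single)
  then show ?thesis by (simp only: free_alg_sum_singles[symmetric])
qed

lemma free_eval_const: "free_eval g (const c) = scale_opr c 1"
  by (simp add: const_def free_eval_single word_opr_def)

lemma free_eval_1: "free_eval g 1 = 1"
  using free_eval_const[of g 1] by (simp add: const_1)

lemma free_eval_var: "free_eval g (var x) = g x"
  by (simp add: var_def free_eval_single word_opr_def)

lemma free_eval_power: "free_eval g (p ^ k) = free_eval g p ^ k"
  by (induction k) (simp_all add: free_eval_1 free_eval_mult)

lemma free_eval_diff: "free_eval g (p - r) = free_eval g p - free_eval g r"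
  using free_eval_add[of g "p - r" r] by (simp add: algebra_simps)

text \<open>The ideal generated by the relators is contained in this one once the relators evaluate to 0.\<close>

lemma ideal_free_eval_kernel: "ideal {p. free_eval g p = 0} free_ring"
proof (rule idealI[OF ring_free_ring])
  interpret ring free_ring by (rule ring_free_ring)
  show "subgroup {p. free_eval g p = 0} (add_monoid free_ring)"
  proof (rule add.subgroupI)
    fix a assume a: "a \<in> {p. free_eval g p = 0}"
    have i: "\<ominus>\<^bsub>free_ring\<^esub> a = - a"
      by (rule minus_equality) simp_all
    show "\<ominus>\<^bsub>free_ring\<^esub> a \<in> {p. free_eval g p = 0}"
      unfolding i using a free_eval_diff[of g 0 a] by (simp add: free_eval_0)
  qed (auto simp: free_eval_add intro!: exI[of _ 0] free_eval_0)
qed (auto simp: free_eval_mult)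

text \<open>The universal property of the presentation: evaluation at \<open>E\<close>, \<open>F\<close>, \<open>K\<close> kills the ideal of
  relations and descends to \<open>u_q\<close>. Evaluation takes place in the ring of operators, but its values
  come from matrices, because such operators are closed under sums, products and scaling.\<close>

lemma sl2_action_uq_extension:
  assumes "sl2_action q d M F" "0 < mdim M"
  shows "uq_extension q d M F"
proof -
  let ?m = "mdim M"
  have B: "borel_action q d M" and F: "F \<in> carrier_mat ?m ?m" "F ^\<^sub>m d = 0\<^sub>m ?m ?m"
    "mK M * F = inverse (q\<^sup>2) \<cdot>\<^sub>m (F * mK M)"
    "mE M * F - F * mE M = (1 / (q - inverse q)) \<cdot>\<^sub>m (mK M - mK M ^\<^sub>m (d - 1))"
    using assms(1) by (auto simp: sl2_action_def)
  note M = borel_actionD[OF B]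
  define g where "g = case_gen (mat_opr ?m (mE M)) (mat_opr ?m F) (mat_opr ?m (mK M))"
  define \<phi> where "\<phi> = free_eval g"
  note op = mat_opr_mult[OF assms(2)] mat_opr_pow[OF assms(2)] mat_opr_smult[OF assms(2)]
    mat_opr_diff[OF assms(2)] mat_opr_zero[OF assms(2)] mat_opr_one[OF assms(2)]
  have ker: "uq_ideal q d \<subseteq> {p. free_eval g p = 0}"
    unfolding uq_ideal_def
  proof (rule ring.genideal_minimal[OF ring_free_ring ideal_free_eval_kernel])
    have g: "g GE = mat_opr ?m (mE M)" "g GF = mat_opr ?m F" "g GK = mat_opr ?m (mK M)"
      by (simp_all add: g_def)
    have mult: "mat_opr ?m A * mat_opr ?m B = mat_opr ?m (A * B)"
      if "A \<in> carrier_mat ?m ?m" "B \<in> carrier_mat ?m ?m" for A B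
      using op(1) that by simp
    have "mat_opr ?m (mE M) ^ d = 0" "mat_opr ?m F ^ d = 0" "mat_opr ?m (mK M) ^ d = 1"
      using op(2)[OF M(2), of d] op(2)[OF M(3), of d] op(2)[OF F(1), of d] M(4,5) F(2) op(5,6) by simp_all
    moreover have "mat_opr ?m (mK M) * mat_opr ?m (mE M) = scale_opr (q\<^sup>2) (mat_opr ?m (mE M) * mat_opr ?m (mK M))"
      using M(2,3) by (simp only: mult M(6)) (intro op(3), auto)
    moreover have "mat_opr ?m (mK M) * mat_opr ?m F = scale_opr (inverse (q\<^sup>2)) (mat_opr ?m F * mat_opr ?m (mK M))"
      using M(3) F(1) by (simp only: mult F(3)) (intro op(3), auto)
    moreover have "mat_opr ?m (mE M) * mat_opr ?m F - mat_opr ?m F * mat_opr ?m (mE M)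
      = scale_opr (1 / (q - inverse q)) (mat_opr ?m (mK M) - mat_opr ?m (mK M) ^ (d - 1))"
    proof -
      have "mat_opr ?m (mE M) * mat_opr ?m F - mat_opr ?m F * mat_opr ?m (mE M) = mat_opr ?m (mE M * F - F * mE M)"
        unfolding mult[OF M(2) F(1)] mult[OF F(1) M(2)] using M F by (intro op(4)[symmetric]) auto
      also have "\<dots> = scale_opr (1 / (q - inverse q)) (mat_opr ?m (mK M - mK M ^\<^sub>m (d - 1)))"
        unfolding F(4) using M(3) by (intro op(3) minus_carrier_mat pow_carrier_mat)
      also have "mat_opr ?m (mK M - mK M ^\<^sub>m (d - 1)) = mat_opr ?m (mK M) - mat_opr ?m (mK M) ^ (d - 1)"
        unfolding op(2)[OF M(3), symmetric] using M(3) by (intro op(4) pow_carrier_mat)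
      finally show ?thesis .
    qed
    ultimately have "free_eval g (var GE ^ d) = 0" "free_eval g (var GF ^ d) = 0"
      "free_eval g (var GK ^ d - 1) = 0"
      "free_eval g (var GK * var GE - const (q\<^sup>2) * var GE * var GK) = 0"
      "free_eval g (var GK * var GF - const (inverse (q\<^sup>2)) * var GF * var GK) = 0"
      "free_eval g (var GE * var GF - var GF * var GE - const (1 / (q - inverse q)) * (var GK - var GK ^ (d - 1))) = 0"
      by (simp_all only: g free_eval_power free_eval_var free_eval_diff free_eval_mult
          free_eval_1 free_eval_const opr.scl_mult_left mult_1_left diff_self)
    then show "uq_relators q d \<subseteq> {p. free_eval g p = 0}"
      unfolding uq_relators_def Let_def insert_subset mem_Collect_eq by (intro conjI empty_subsetI)
  qed
  \<comment> \<open>A left inverse of \<open>mat_opr\<close>: read off the first block of an operator.\<close>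
  define block where "block f = mat ?m ?m (\<lambda>(r, s). apply_opr f (\<lambda>i. if i = s then 1 else 0) r)" for f
  have block: "block (mat_opr ?m A) = A" if "A \<in> carrier_mat ?m ?m" for A
    unfolding block_def mat_opr_def using that by (intro eq_matI) (auto simp: apply_entries_opr_basis)
  have img: "\<phi> p \<in> mat_opr ?m ` carrier_mat ?m ?m" for p
  proof -
    have word: "word_opr g v \<in> mat_opr ?m ` carrier_mat ?m ?m" for v
    proof (induction v)
      case Nil
      have "word_opr g [] = mat_opr ?m (1\<^sub>m ?m)" by (simp add: word_opr_def op(6))
      then show ?case by (rule image_eqI) simp
    next
      case (Cons x v)
      then obtain A where A: "A \<in> carrier_mat ?m ?m" "word_opr g v = mat_opr ?m A" by auto
      obtain B where Bx: "B \<in> carrier_mat ?m ?m" "g x = mat_opr ?m B"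
        using M(2,3) F(1) by (cases x) (auto simp: g_def)
      have "word_opr g (x # v) = mat_opr ?m (B * A)" using A Bx by (simp add: word_opr_def op(1))
      then show ?case by (rule image_eqI) (use A Bx in \<open>auto intro: mult_carrier_mat\<close>)
    qed
    have "(\<Sum>v\<in>S. scale_opr (Poly_Mapping.lookup p v) (word_opr g v)) \<in> mat_opr ?m ` carrier_mat ?m ?m"
      if "finite S" for S using that
    proof induction
      case empty
      have "(\<Sum>v\<in>{}. scale_opr (Poly_Mapping.lookup p v) (word_opr g v)) = mat_opr ?m (0\<^sub>m ?m ?m)"
        by (simp add: op(5))
      then show ?case by (rule image_eqI) simp
    next
      case (insert v S)
      then obtain A where A: "A \<in> carrier_mat ?m ?m"
        "(\<Sum>v\<in>S. scale_opr (Poly_Mapping.lookup p v) (word_opr g v)) = mat_opr ?m A" by auto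
      obtain B where Bv: "B \<in> carrier_mat ?m ?m" "word_opr g v = mat_opr ?m B" using word[of v] by auto
      have "(\<Sum>v\<in>insert v S. scale_opr (Poly_Mapping.lookup p v) (word_opr g v))
          = mat_opr ?m (Poly_Mapping.lookup p v \<cdot>\<^sub>m B + A)"
        using insert.hyps A Bv assms(2) by (simp add: mat_opr_add op(3))
      then show ?case by (rule image_eqI) (use A Bv in auto)
    qed
    then show ?thesis by (simp add: \<phi>_def free_eval_def)
  qed
  define \<psi> where "\<psi> p = block (\<phi> p)" for p
  have \<psi>: "\<psi> p \<in> carrier_mat ?m ?m" "mat_opr ?m (\<psi> p) = \<phi> p" for p
  proof -
    obtain A where A: "A \<in> carrier_mat ?m ?m" "\<phi> p = mat_opr ?m A" using img[of p] by blast
    then show "\<psi> p \<in> carrier_mat ?m ?m" "mat_opr ?m (\<psi> p) = \<phi> p"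
      by (simp_all add: \<psi>_def block)
  qed
  have \<psi>_eq: "\<psi> p = A" if "A \<in> carrier_mat ?m ?m" "\<phi> p = mat_opr ?m A" for p A
    using that block by (simp add: \<psi>_def)
  have \<psi>_hom: "\<psi> (p * r) = \<psi> p * \<psi> r" "\<psi> (p + r) = \<psi> p + \<psi> r" "\<psi> (const c) = c \<cdot>\<^sub>m 1\<^sub>m ?m"
    for p r c
  proof -
    show "\<psi> (p * r) = \<psi> p * \<psi> r"
      by (rule \<psi>_eq) (simp_all add: \<psi>(1) mult_carrier_mat[of _ ?m ?m] op(1), simp add: \<psi>(2) \<phi>_def free_eval_mult)
    show "\<psi> (p + r) = \<psi> p + \<psi> r"
      by (rule \<psi>_eq) (simp_all add: \<psi>(1) mat_opr_add assms(2), simp add: \<psi>(2) \<phi>_def free_eval_add)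
    show "\<psi> (const c) = c \<cdot>\<^sub>m 1\<^sub>m ?m"
      by (rule \<psi>_eq) (simp_all add: op(3,6) \<phi>_def free_eval_const)
  qed
  have \<psi>_1: "\<psi> 1 = 1\<^sub>m ?m" by (rule \<psi>_eq) (simp_all add: op(6) \<phi>_def free_eval_1)
  define \<rho> where "\<rho> c = \<psi> (SOME p. p \<in> c)" for c
  interpret I: ideal "uq_ideal q d" free_ring by (rule ideal_uq_ideal)
  have \<rho>_class: "\<rho> (uq_class q d p) = \<psi> p" for p
  proof -
    have "p \<in> uq_class q d p" unfolding uq_class_def by (rule I.a_rcos_self) simp
    then have "(SOME r. r \<in> uq_class q d p) \<in> uq_class q d p" by (rule someI)
    then obtain h where "h \<in> uq_ideal q d" "(SOME r. r \<in> uq_class q d p) = h + p"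
      by (auto simp: uq_class_def a_r_coset_def')
    then have "\<phi> (SOME r. r \<in> uq_class q d p) = \<phi> p"
      using ker by (auto simp: \<phi>_def free_eval_add)
    then show ?thesis by (simp add: \<rho>_def \<psi>_def)
  qed
  have "\<rho> \<in> Ring.ring_hom (uq q d) (ring_mat TYPE(complex) ?m ())"
  proof (rule ring_hom_memI)
    fix x y assume "x \<in> carrier (uq q d)" "y \<in> carrier (uq q d)"
    then obtain p r where pr: "x = uq_class q d p" "y = uq_class q d r" unfolding carrier_uq by blast
    show "\<rho> (x \<otimes>\<^bsub>uq q d\<^esub> y) = \<rho> x \<otimes>\<^bsub>ring_mat TYPE(complex) ?m ()\<^esub> \<rho> y"
      unfolding pr uq_class_hom[symmetric] \<rho>_class \<psi>_hom by (simp add: ring_mat_def)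
    show "\<rho> (x \<oplus>\<^bsub>uq q d\<^esub> y) = \<rho> x \<oplus>\<^bsub>ring_mat TYPE(complex) ?m ()\<^esub> \<rho> y"
      unfolding pr uq_class_hom[symmetric] \<rho>_class \<psi>_hom by (simp add: ring_mat_def)
    show "\<rho> x \<in> carrier (ring_mat TYPE(complex) ?m ())"
      unfolding pr \<rho>_class using \<psi>(1) by (simp add: ring_mat_def)
  next
    show "\<rho> \<one>\<^bsub>uq q d\<^esub> = \<one>\<^bsub>ring_mat TYPE(complex) ?m ()\<^esub>"
      unfolding uq_class_hom[symmetric] \<rho>_class \<psi>_1 by (simp add: ring_mat_def)
  qed
  then have "algebra_rep q d (uq q d) ?m \<rho>" by (simp add: algebra_rep_def \<rho>_class \<psi>_hom)
  moreover have "\<psi> (var GE) = mE M" "\<psi> (var GK) = mK M" "\<psi> (var GF) = F"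
    using M F by (auto intro!: \<psi>_eq simp: \<phi>_def free_eval_var g_def)
  ultimately show ?thesis by (auto simp: uq_extension_def \<rho>_class)
qed

section \<open>Submodules and isomorphic copies of modules\<close>

text \<open>
  The span of the last \<open>u\<close> basis vectors is stable under \<open>E\<close> and \<open>K\<close>, hence under the subalgebra
  that they generate. Taking the lower right block is multiplicative on the matrices that preserve
  this span.\<close>

lemma uqp_module_block:
  assumes "uqp_module q d M" "mdim M = p + u"
    and low: "\<And>r j. r < p \<Longrightarrow> p \<le> j \<Longrightarrow> j < p + u \<Longrightarrow> mE M $$ (r, j) = 0 \<and> mK M $$ (r, j) = 0"
    and N: "mdim N = u" "mE N = mat u u (\<lambda>(r, j). mE M $$ (p + r, p + j))"
      "mK N = mat u u (\<lambda>(r, j). mK M $$ (p + r, p + j))"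
  shows "uqp_module q d N"
proof -
  let ?m = "p + u"
  obtain \<rho> where \<rho>: "algebra_rep q d (uq_plus q d) ?m \<rho>"
    "\<rho> (uq_class q d (var GE)) = mE M" "\<rho> (uq_class q d (var GK)) = mK M"
    using assms(1,2) by (auto simp: uqp_module_def)
  let ?A = "uq_plus q d"
  have h: "\<rho> \<in> Ring.ring_hom ?A (ring_mat TYPE(complex) ?m ())"
    and hc: "\<And>c. \<rho> (uq_class q d (const c)) = c \<cdot>\<^sub>m 1\<^sub>m ?m"
    using \<rho>(1) by (auto simp: algebra_rep_def)
  have sel: "x \<otimes>\<^bsub>?A\<^esub> y = x \<otimes>\<^bsub>uq q d\<^esub> y" "x \<oplus>\<^bsub>?A\<^esub> y = x \<oplus>\<^bsub>uq q d\<^esub> y"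
    "\<one>\<^bsub>?A\<^esub> = \<one>\<^bsub>uq q d\<^esub>" for x y by (simp_all add: uq_plus_def)
  have c: "\<rho> x \<in> carrier_mat ?m ?m" if "x \<in> carrier ?A" for x
    using ring_hom_closed[OF h that] by (simp add: ring_mat_def)
  have mult: "\<rho> (x \<otimes>\<^bsub>uq q d\<^esub> y) = \<rho> x * \<rho> y" "\<rho> (x \<oplus>\<^bsub>uq q d\<^esub> y) = \<rho> x + \<rho> y"
    if "x \<in> carrier ?A" "y \<in> carrier ?A" for x y
    using ring_hom_mult[OF h that] ring_hom_add[OF h that] by (simp_all add: ring_mat_def sel)
  have one: "\<rho> \<one>\<^bsub>uq q d\<^esub> = 1\<^sub>m ?m" using ring_hom_one[OF h] by (simp add: ring_mat_def sel)
  have tri: "\<forall>r j. r < p \<longrightarrow> p \<le> j \<longrightarrow> j < ?m \<longrightarrow> \<rho> x $$ (r, j) = 0" if "x \<in> carrier ?A" for x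
    using that unfolding carrier_uq_plus
  proof (induction x rule: generate_ring.induct)
    case one then show ?case by (simp add: \<open>\<rho> \<one>\<^bsub>uq q d\<^esub> = 1\<^sub>m ?m\<close>)
  next
    case (incl x) then show ?case using low by (auto simp: hc \<rho>)
  next
    case (a_inv x)
    then have x: "x \<in> carrier ?A" "\<ominus>\<^bsub>uq q d\<^esub> x \<in> carrier ?A"
      by (auto simp: carrier_uq_plus intro: generate_ring.intros)
    interpret ring "uq q d" by (rule ring_uq)
    have "x \<oplus>\<^bsub>uq q d\<^esub> \<ominus>\<^bsub>uq q d\<^esub> x = uq_class q d (const 0)"
      using x(1) carrier_uq_plus_subset[of q d] r_neg[of x] by (auto simp: const_0 uq_class_0)
    then have "\<rho> x + \<rho> (\<ominus>\<^bsub>uq q d\<^esub> x) = 0 \<cdot>\<^sub>m 1\<^sub>m ?m" using mult(2)[OF x] by (simp add: hc)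
    then have sum0: "(\<rho> x + \<rho> (\<ominus>\<^bsub>uq q d\<^esub> x)) $$ (r, j) = 0" if "r < ?m" "j < ?m" for r j
      using that by simp
    show ?case
    proof (intro allI impI)
      fix r j assume rj: "r < p" "p \<le> j" "j < ?m"
      then show "\<rho> (\<ominus>\<^bsub>uq q d\<^esub> x) $$ (r, j) = 0"
        using sum0[of r j] a_inv.IH c[OF x(1)] c[OF x(2)] by simp
    qed
  next
    case (eng_add x y)
    then have "x \<in> carrier ?A" "y \<in> carrier ?A" by (auto simp: carrier_uq_plus)
    then show ?case using eng_add.IH c[of x] c[of y] by (auto simp: mult)
  next
    case (eng_mult x y)
    then have xy: "x \<in> carrier ?A" "y \<in> carrier ?A" by (auto simp: carrier_uq_plus)
    show ?case
    proof (intro allI impI)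
      fix r j assume rj: "r < p" "p \<le> j" "j < ?m"
      have "\<rho> x $$ (r, t) * \<rho> y $$ (t, j) = 0" if "t < ?m" for t
        using eng_mult.IH rj that by (cases "t < p") auto
      then have "(\<Sum>t = 0..<?m. \<rho> x $$ (r, t) * \<rho> y $$ (t, j)) = 0"
        by (intro sum.neutral) auto
      then show "\<rho> (x \<otimes>\<^bsub>uq q d\<^esub> y) $$ (r, j) = 0"
        using rj c[OF xy(1)] c[OF xy(2)] by (simp add: mult[OF xy] scalar_prod_def)
    qed
  qed
  define B where "B A = mat u u (\<lambda>(r, j). (A :: complex mat) $$ (p + r, p + j))" for A
  have Bm: "B (\<rho> x * \<rho> y) = B (\<rho> x) * B (\<rho> y)" if "x \<in> carrier ?A" "y \<in> carrier ?A" for x y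
  proof (rule eq_matI)
    fix r j assume "r < dim_row (B (\<rho> x) * B (\<rho> y))" "j < dim_col (B (\<rho> x) * B (\<rho> y))"
    then have rj: "r < u" "j < u" by (auto simp: B_def)
    have "(\<Sum>t<?m. \<rho> x $$ (p + r, t) * \<rho> y $$ (t, p + j)) = (\<Sum>t\<in>{p..<?m}. \<rho> x $$ (p + r, t) * \<rho> y $$ (t, p + j))"
      using tri[OF that(2)] rj by (intro sum.mono_neutral_right) auto
    also have "\<dots> = (\<Sum>t<u. \<rho> x $$ (p + r, p + t) * \<rho> y $$ (p + t, p + j))"
      using sum.shift_bounds_nat_ivl[of "\<lambda>t. \<rho> x $$ (p + r, t) * \<rho> y $$ (t, p + j)" 0 p u]
      by (simp add: atLeast0LessThan add.commute)
    finally show "B (\<rho> x * \<rho> y) $$ (r, j) = (B (\<rho> x) * B (\<rho> y)) $$ (r, j)"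
      using rj c[OF that(1)] c[OF that(2)] by (simp add: B_def scalar_prod_def atLeast0LessThan)
  qed (auto simp: B_def)
  have Ba: "B (\<rho> x + \<rho> y) = B (\<rho> x) + B (\<rho> y)" if "x \<in> carrier ?A" "y \<in> carrier ?A" for x y
    using c[OF that(1)] c[OF that(2)] by (intro eq_matI) (auto simp: B_def)
  have Bc: "B (c \<cdot>\<^sub>m 1\<^sub>m ?m) = c \<cdot>\<^sub>m 1\<^sub>m u" for c
    by (intro eq_matI) (auto simp: B_def)
  have B1: "B (1\<^sub>m ?m) = 1\<^sub>m u" by (intro eq_matI) (auto simp: B_def)
  have "(\<lambda>x. B (\<rho> x)) \<in> Ring.ring_hom ?A (ring_mat TYPE(complex) u ())"
    by (rule ring_hom_memI) (auto simp: sel ring_mat_def mult Bm Ba one B1, simp add: B_def)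
  then have "algebra_rep q d ?A (mdim N) (\<lambda>x. B (\<rho> x))"
    by (simp add: algebra_rep_def hc Bc N(1))
  then show ?thesis using N(2,3) \<rho>(2,3) by (auto simp: uqp_module_def B_def)
qed

text \<open>Conjugate the representation.\<close>

lemma uqp_module_isomorphic:
  assumes "uqp_module q d M" "isomorphic M N" "carrier_mod N"
  shows "uqp_module q d N"
proof -
  obtain P where P: "mod_iso P M N" using assms(2) by (auto simp: isomorphic_def)
  let ?n = "mdim M"
  have M: "carrier_mod M" using uqp_module_borel_action[OF assms(1)] by (rule borel_actionD)
  obtain Q where Q: "mdim N = ?n" "P \<in> carrier_mat ?n ?n" "Q \<in> carrier_mat ?n ?n" "P * Q = 1\<^sub>m ?n"
    "Q * P = 1\<^sub>m ?n" "P * mE M = mE N * P" "P * mK M = mK N * P"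
    using P by (elim mod_isoE) auto
  obtain \<rho> where \<rho>: "algebra_rep q d (uq_plus q d) ?n \<rho>"
    "\<rho> (uq_class q d (var GE)) = mE M" "\<rho> (uq_class q d (var GK)) = mK M"
    using assms(1) by (auto simp: uqp_module_def)
  let ?A = "uq_plus q d"
  have h: "\<rho> \<in> Ring.ring_hom ?A (ring_mat TYPE(complex) ?n ())"
    and hc: "\<And>c. \<rho> (uq_class q d (const c)) = c \<cdot>\<^sub>m 1\<^sub>m ?n"
    using \<rho>(1) by (auto simp: algebra_rep_def)
  define B where "B A = P * A * Q" for A
  have Bm: "B (X * Y) = B X * B Y" if "X \<in> carrier_mat ?n ?n" "Y \<in> carrier_mat ?n ?n" for X Y
  proof -
    have "B X * B Y = P * X * (Q * (P * Y * Q))"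
      unfolding B_def using Q that by (intro assoc_mult_mat) auto
    also have "Q * (P * Y * Q) = Q * (P * (Y * Q))" using Q that by (simp add: assoc_mult_mat[of _ ?n ?n _ ?n _ ?n])
    also have "\<dots> = (Q * P) * (Y * Q)" using Q that by (intro assoc_mult_mat[symmetric]) auto
    also have "P * X * \<dots> = P * X * Y * Q" using Q that by (simp add: assoc_mult_mat[of _ ?n ?n _ ?n _ ?n])
    also have "P * X * Y = P * (X * Y)" using Q that by (intro assoc_mult_mat) auto
    finally show ?thesis by (simp add: B_def)
  qed
  have Ba: "B (X + Y) = B X + B Y" if "X \<in> carrier_mat ?n ?n" "Y \<in> carrier_mat ?n ?n" for X Y
  proof -
    have "P * (X + Y) * Q = (P * X + P * Y) * Q" using Q that by (simp add: mult_add_distrib_mat[of _ ?n ?n])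
    also have "\<dots> = P * X * Q + P * Y * Q" using Q that by (intro add_mult_distrib_mat) auto
    finally show ?thesis by (simp add: B_def)
  qed
  have B1: "B (1\<^sub>m ?n) = 1\<^sub>m ?n" using Q by (simp add: B_def)
  have Bc: "B (c \<cdot>\<^sub>m 1\<^sub>m ?n) = c \<cdot>\<^sub>m 1\<^sub>m ?n" for c
  proof -
    have "P * (c \<cdot>\<^sub>m 1\<^sub>m ?n) = c \<cdot>\<^sub>m P" using Q mult_smult_distrib[of P ?n ?n "1\<^sub>m ?n" ?n c] by simp
    then show ?thesis using Q mult_smult_assoc_mat[of P ?n ?n Q ?n c] by (simp add: B_def)
  qed
  have Bi: "B X = Y" if "P * X = Y * P" "X \<in> carrier_mat ?n ?n" "Y \<in> carrier_mat ?n ?n" for X Y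
  proof -
    have "B X = Y * (P * Q)" unfolding B_def that(1) using Q that by (intro assoc_mult_mat) auto
    then show ?thesis using Q that by simp
  qed
  have "(\<lambda>x. B (\<rho> x)) \<in> Ring.ring_hom ?A (ring_mat TYPE(complex) ?n ())"
    using ring_hom_closed[OF h] ring_hom_mult[OF h] ring_hom_add[OF h] ring_hom_one[OF h] Q
    by (intro ring_hom_memI)
      (simp_all add: ring_mat_def Bm Ba B1, auto simp: B_def intro!: mult_carrier_mat[of _ ?n ?n])
  then have "algebra_rep q d ?A (mdim N) (\<lambda>x. B (\<rho> x))"
    by (simp add: algebra_rep_def hc Bc Q(1))
  moreover have "B (mE M) = mE N" "B (mK M) = mK N"
    using Q M assms(3) by (auto intro!: Bi simp: carrier_mod_def)
  ultimately show ?thesis using \<rho>(2,3) by (auto simp: uqp_module_def)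
qed

section \<open>The modules \<open>M_i^u\<close>\<close>

context root_of_unity
begin

lemma even_power_q: "q ^ (2 * k) = w ^ k"
  by (simp add: w_def power_mult)

lemma std_mod_sel:
  "mdim (std_mod q i u) = Suc u"
  "mE (std_mod q i u) = mat (Suc u) (Suc u) (\<lambda>(r, j). if r = j + 1 then 1 else 0)"
  "mK (std_mod q i u) = mat (Suc u) (Suc u) (\<lambda>(r, j). if r = j then w ^ (i + j) else 0)"
  unfolding std_mod_def even_power_q by simp_all

lemma carrier_std_mod: "carrier_mod (std_mod q i u)"
  by (simp add: carrier_mod_def std_mod_sel)

lemma borel_action_std_mod:
  assumes "u < d" shows "borel_action q d (std_mod q i u)"
  unfolding borel_action_def
proof (intro conjI)
  let ?n = "Suc u" and ?E = "mE (std_mod q i u)" and ?K = "mK (std_mod q i u)"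
  have c: "?E \<in> carrier_mat ?n ?n" "?K \<in> carrier_mat ?n ?n" by (auto simp: std_mod_sel)
  show "carrier_mod (std_mod q i u)" by (rule carrier_std_mod)
  have "?E ^\<^sub>m d = 0\<^sub>m ?n ?n"
    by (rule off_diagonal_nilpotent[where s = 1]) (use assms in \<open>auto simp: std_mod_sel\<close>)
  then show "?E ^\<^sub>m d = 0\<^sub>m (mdim (std_mod q i u)) (mdim (std_mod q i u))" by (simp add: std_mod_sel)
  have "(w ^ j) ^ d = 1" for j
    by (metis power_mult mult.commute w_power_d power_one)
  then show "?K ^\<^sub>m d = 1\<^sub>m (mdim (std_mod q i u))"
    using diag_power[of ?K ?n "\<lambda>j. w ^ (i + j)" d] by (intro eq_matI) (auto simp: std_mod_sel)
  show "?K * ?E = q\<^sup>2 \<cdot>\<^sub>m (?E * ?K)"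
  proof (rule eq_matI)
    fix r j assume "r < dim_row (q\<^sup>2 \<cdot>\<^sub>m (?E * ?K))" "j < dim_col (q\<^sup>2 \<cdot>\<^sub>m (?E * ?K))"
    then have rj: "r < ?n" "j < ?n" using c by auto
    have "(?K * ?E) $$ (r, j) = (\<Sum>t<?n. if t = r then w ^ (i + r) * ?E $$ (r, j) else 0)"
      unfolding mat_mult_entry[OF c(2) c(1) rj] by (intro sum.cong refl) (use rj in \<open>auto simp: std_mod_sel\<close>)
    moreover have "(?E * ?K) $$ (r, j) = (\<Sum>t<?n. if t = j then w ^ (i + j) * ?E $$ (r, j) else 0)"
      unfolding mat_mult_entry[OF c rj] by (intro sum.cong refl) (use rj in \<open>auto simp: std_mod_sel\<close>)
    ultimately show "(?K * ?E) $$ (r, j) = (q\<^sup>2 \<cdot>\<^sub>m (?E * ?K)) $$ (r, j)"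
      using rj c by (auto simp: std_mod_sel w_def[symmetric])
  qed (use c in auto)
qed

text \<open>With \<open>F\<close> sending \<open>e^j\<close> to \<open>f j\<close> times \<open>e^(j-1)\<close>, the diagonal entries of \<open>E F - F E\<close> are
  \<open>f j - f (j + 1)\<close> for \<open>j < u\<close> and \<open>f u\<close> for \<open>j = u\<close>. The relation defines \<open>f\<close> recursively from
  \<open>f 0 = 0\<close>, and the hypothesis on the weights says that \<open>f (u + 1) = 0\<close>, as the last entry
  demands.\<close>

lemma sl2_action_std_mod:
  assumes "u < d" "(\<Sum>j\<le>u. w ^ (c + j)) = (\<Sum>j\<le>u. inverse w ^ (c + j))"
  shows "\<exists>F. sl2_action q d (std_mod q c u) F"
proof -
  let ?n = "Suc u" and ?E = "mE (std_mod q c u)" and ?K = "mK (std_mod q c u)"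
  define f where "f j = - (\<Sum>t<j. (w ^ (c + t) - inverse w ^ (c + t)) / (q - inverse q))" for j
  define F where "F = mat ?n ?n (\<lambda>(r, j). if j = r + 1 then f j else 0)"
  have cE: "?E \<in> carrier_mat ?n ?n" and cK: "?K \<in> carrier_mat ?n ?n" and cF: "F \<in> carrier_mat ?n ?n"
    by (auto simp: std_mod_sel F_def)
  have f0: "f 0 = 0" by (simp add: f_def)
  have fu: "f ?n = 0"
    using assms(2) by (simp add: f_def sum_divide_distrib[symmetric] sum_subtractf lessThan_Suc_atMost del: sum.lessThan_Suc)
  have fS: "f r - f (Suc r) = (w ^ (c + r) - inverse w ^ (c + r)) / (q - inverse q)" for r
    by (simp add: f_def)
  have "F ^\<^sub>m d = 0\<^sub>m ?n ?n"
    by (rule off_diagonal_nilpotent[where s = "- 1"]) (use assms in \<open>auto simp: F_def\<close>)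
  moreover have "?K * F = inverse (q\<^sup>2) \<cdot>\<^sub>m (F * ?K)"
  proof (rule eq_matI)
    fix r j assume "r < dim_row (inverse (q\<^sup>2) \<cdot>\<^sub>m (F * ?K))" "j < dim_col (inverse (q\<^sup>2) \<cdot>\<^sub>m (F * ?K))"
    then have rj: "r < ?n" "j < ?n" using cF cK by auto
    have "(?K * F) $$ (r, j) = (\<Sum>t<?n. if t = r then w ^ (c + r) * F $$ (r, j) else 0)"
      unfolding mat_mult_entry[OF cK cF rj] by (intro sum.cong refl) (use rj in \<open>auto simp: std_mod_sel\<close>)
    moreover have "(F * ?K) $$ (r, j) = (\<Sum>t<?n. if t = j then w ^ (c + j) * F $$ (r, j) else 0)"
      unfolding mat_mult_entry[OF cF cK rj] by (intro sum.cong refl) (use rj in \<open>auto simp: std_mod_sel\<close>)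
    ultimately show "(?K * F) $$ (r, j) = (inverse (q\<^sup>2) \<cdot>\<^sub>m (F * ?K)) $$ (r, j)"
      using rj cF cK w_nonzero by (auto simp: F_def w_def[symmetric])
  qed (use cF cK in auto)
  moreover have "?E * F - F * ?E = (1 / (q - inverse q)) \<cdot>\<^sub>m (?K - ?K ^\<^sub>m (d - 1))"
  proof (rule eq_matI)
    fix r j assume "r < dim_row ((1 / (q - inverse q)) \<cdot>\<^sub>m (?K - ?K ^\<^sub>m (d - 1)))"
      "j < dim_col ((1 / (q - inverse q)) \<cdot>\<^sub>m (?K - ?K ^\<^sub>m (d - 1)))"
    then have rj: "r < ?n" "j < ?n" using cK by (auto split: if_splits)
    have "(?E * F) $$ (r, j) = (\<Sum>t<?n. if t = r - 1 then (if r = j then f r else 0) else 0)"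
      unfolding mat_mult_entry[OF cE cF rj]
      by (intro sum.cong refl) (use rj f0 in \<open>cases r; auto simp: std_mod_sel F_def\<close>)
    then have EF: "(?E * F) $$ (r, j) = (if r = j then f r else 0)" using less_imp_diff_less[OF rj(1), of 1] by (simp del: sum.lessThan_Suc)
    have "(F * ?E) $$ (r, j) = (\<Sum>t<?n. if t = Suc j then (if r = j then f (Suc r) else 0) else 0)"
      unfolding mat_mult_entry[OF cF cE rj]
      by (intro sum.cong refl) (use rj in \<open>auto simp: std_mod_sel F_def\<close>)
    then have FE: "(F * ?E) $$ (r, j) = (if r = j then f (Suc r) else 0)"
      using rj fu by (auto simp: less_Suc_eq)
    have "(w ^ k) ^ (d - 1) = inverse w ^ k" for k
    proof -
      have "(w ^ k) ^ (d - 1) * w ^ k = (w ^ k) ^ d" using d_ge_2 by (cases d) auto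
      also have "\<dots> = 1" by (metis power_mult mult.commute w_power_d power_one)
      finally show ?thesis by (metis inverse_unique mult.commute power_inverse)
    qed
    then have "(?K ^\<^sub>m (d - 1)) $$ (r, j) = (if r = j then inverse w ^ (c + j) else 0)"
      using diag_power[of ?K ?n "\<lambda>j. w ^ (c + j)" "d - 1"] rj by (auto simp: std_mod_sel)
    then show "(?E * F - F * ?E) $$ (r, j) = ((1 / (q - inverse q)) \<cdot>\<^sub>m (?K - ?K ^\<^sub>m (d - 1))) $$ (r, j)"
      using rj cE cF cK EF FE fS[of r] pow_carrier_mat[OF cK, of "d - 1"] by (auto simp: std_mod_sel)
  qed (use cE cF cK in auto)
  ultimately have "sl2_action q d (std_mod q c u) F"
    unfolding sl2_action_def using cF borel_action_std_mod[OF assms(1)] by (simp add: std_mod_sel)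
  then show ?thesis by blast
qed

lemma uq_extension_std_mod:
  assumes "u < d" "(\<Sum>j\<le>u. w ^ (c + j)) = (\<Sum>j\<le>u. inverse w ^ (c + j))"
  shows "\<exists>F. uq_extension q d (std_mod q c u) F"
  using sl2_action_std_mod[OF assms] sl2_action_uq_extension by (force simp: std_mod_sel)

text \<open>The map \<open>j \<mapsto> u - j\<close> sends each weight to its inverse.\<close>

lemma weights_symmetric:
  assumes "w ^ (2 * c + u) = 1"
  shows "(\<Sum>j\<le>u. w ^ (c + j)) = (\<Sum>j\<le>u. inverse w ^ (c + j))"
proof -
  have "(\<Sum>j\<le>u. w ^ (c + j)) = (\<Sum>j\<le>u. w ^ (c + (u - j)))"
    by (rule sum.reindex_bij_witness[of _ "\<lambda>j. u - j" "\<lambda>j. u - j"]) auto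
  also have "\<dots> = (\<Sum>j\<le>u. inverse w ^ (c + j))"
  proof (intro sum.cong refl)
    fix j assume "j \<in> {..u}"
    then have "(c + j) + (c + (u - j)) = 2 * c + u" by simp
    then have "w ^ (c + j) * w ^ (c + (u - j)) = 1" using assms by (simp only: flip: power_add)
    then show "w ^ (c + (u - j)) = inverse w ^ (c + j)" by (metis inverse_unique power_inverse)
  qed
  finally show ?thesis .
qed

text \<open>Solve \<open>2 c + u = 0\<close> modulo \<open>d\<close>: use \<open>2 c + u = 2 d\<close> for even \<open>u\<close>, and \<open>2 c + u = d\<close> otherwise.\<close>

lemma symmetric_shift_exists:
  assumes "u < d" "odd d \<or> even u"
  obtains c where "w ^ (2 * c + u) = 1"
proof (cases "even u")
  case True
  then have "2 * (d - u div 2) + u = 2 * d" using assms by auto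
  then have "w ^ (2 * (d - u div 2) + u) = 1" using w_power_eq_1_iff[of "2 * d"] by simp
  then show ?thesis by (rule that)
next
  case False
  then have "2 * ((d - u) div 2) + u = d" using assms by auto
  then have "w ^ (2 * ((d - u) div 2) + u) = 1" using w_power_d by simp
  then show ?thesis by (rule that)
qed

text \<open>In dimension \<open>d\<close> every weight occurs once, and both sums of weights vanish.\<close>

lemma uq_extension_std_mod_full: "\<exists>F. uq_extension q d (std_mod q c (d - 1)) F"
proof (rule uq_extension_std_mod)
  have full: "(\<Sum>j\<le>d - 1. z ^ (c + j)) = 0" if "z ^ d = 1" "z \<noteq> 1" for z :: complex
  proof -
    have "{..d - 1} = {..<d}" using d_ge_2 by auto
    then show ?thesis using sum_powers_root_of_unity[OF that] by (simp add: power_add flip: sum_distrib_left)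
  qed
  have "w \<noteq> 1" using w_primitive[of 1] d_ge_2 by simp
  then show "(\<Sum>j\<le>d - 1. w ^ (c + j)) = (\<Sum>j\<le>d - 1. inverse w ^ (c + j))"
    using full[of w] full[of "inverse w"] w_power_d w_nonzero by (simp add: power_inverse)
qed (use d_ge_2 in simp)

lemma std_mod_cong:
  assumes "w ^ i = w ^ j" shows "std_mod q i u = std_mod q j u"
  unfolding std_mod_def even_power_q power_add assms by (rule refl)

text \<open>\<open>M_i^u\<close> is the submodule of a \<open>d\<close>-dimensional extendable module spanned by the last \<open>u + 1\<close> basis vectors.\<close>

lemma uqp_module_std_mod:
  assumes "u < d" shows "uqp_module q d (std_mod q i u)"
proof -
  define p where "p = d - 1 - u"
  \<comment> \<open>The basis vector with index \<open>p\<close> of \<open>M_c^(d-1)\<close> must have weight \<open>w ^ i\<close>.\<close>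
  define c where "c = i + d - p"
  have pu: "p + Suc u = d" "c + p = i + d" using assms by (auto simp: p_def c_def)
  obtain F where "uq_extension q d (std_mod q c (d - 1)) F" using uq_extension_std_mod_full by blast
  then have "uqp_module q d (std_mod q c (d - 1))" by (rule uq_extension_uqp_module)
  then show ?thesis
  proof (rule uqp_module_block)
    show "mdim (std_mod q c (d - 1)) = p + Suc u" using d_ge_2 pu by (simp add: std_mod_sel)
    show "mE (std_mod q c (d - 1)) $$ (r, j) = 0 \<and> mK (std_mod q c (d - 1)) $$ (r, j) = 0"
      if "r < p" "p \<le> j" "j < p + Suc u" for r j using that pu d_ge_2 by (simp add: std_mod_sel)
    show "mE (std_mod q i u) = mat (Suc u) (Suc u) (\<lambda>(r, j). mE (std_mod q c (d - 1)) $$ (p + r, p + j))"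
      using pu d_ge_2 by (intro eq_matI) (auto simp: std_mod_sel)
    have "w ^ (c + (p + j)) = w ^ (i + j)" for j
    proof -
      have "c + (p + j) = d + (i + j)" using pu by simp
      then show ?thesis by (simp only: power_add w_power_d mult_1_left)
    qed
    then show "mK (std_mod q i u) = mat (Suc u) (Suc u) (\<lambda>(r, j). mK (std_mod q c (d - 1)) $$ (p + r, p + j))"
      using pu d_ge_2 by (intro eq_matI) (auto simp: std_mod_sel)
  qed (simp add: std_mod_sel)
qed

lemma twist_std_mod: "twist (w ^ a) (std_mod q c u) = std_mod q (a + c) u"
proof -
  have "w ^ a \<cdot>\<^sub>m mK (std_mod q c u) = mK (std_mod q (a + c) u)"
    by (intro eq_matI) (auto simp: std_mod_sel power_add)
  then show ?thesis by (simp add: twist_def) (simp add: std_mod_def)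
qed

lemma line_std_mod: "line (w ^ a) = std_mod q a 0"
proof -
  have "mE (std_mod q a 0) = 0\<^sub>m 1 1" "mK (std_mod q a 0) = w ^ a \<cdot>\<^sub>m 1\<^sub>m 1"
    by (auto simp: std_mod_sel)
  then show ?thesis by (simp add: line_def std_mod_def)
qed

section \<open>Indecomposable modules\<close>

text \<open>The image of \<open>X\<close> and the kernel of \<open>Y\<close> are complementary submodules of \<open>M\<close>, and the former is
  not 0.\<close>

lemma split_mono_into_indecomposable:
  assumes M: "indecomposable q d M" and N: "carrier_mod N" "0 < mdim N"
    and X: "X \<in> carrier_mat (mdim M) (mdim N)" and Y: "Y \<in> carrier_mat (mdim N) (mdim M)"
    and YX: "Y * X = 1\<^sub>m (mdim N)"
    and XE: "X * mE N = mE M * X" and XK: "X * mK N = mK M * X"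
    and YE: "Y * mE M = mE N * Y" and YK: "Y * mK M = mK N * Y"
  shows "mod_iso X N M"
proof -
  let ?m = "mdim M" and ?n = "mdim N"
  have "borel_action q d M" using M by (auto simp: indecomposable_def intro: uqp_module_borel_action)
  note Mc = borel_actionD(2,3)[OF this] and Nc = carrier_modD[OF N(1)]
  define V where "V = {X *\<^sub>v a | a. a \<in> carrier_vec ?n}"
  define W where "W = {v \<in> carrier_vec ?m. Y *\<^sub>v v = 0\<^sub>v ?n}"
  have Vin: "X *\<^sub>v a \<in> V" if "a \<in> carrier_vec ?n" for a using that by (auto simp: V_def)
  have move: "A *\<^sub>v (X *\<^sub>v a) = X *\<^sub>v (B *\<^sub>v a)"
    if "X * B = A * X" "A \<in> carrier_mat ?m ?m" "B \<in> carrier_mat ?n ?n" "a \<in> carrier_vec ?n" for A B a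
    using that X by (metis assoc_mult_mat_vec)
  have V: "submod M V"
    unfolding submod_def
  proof (intro conjI ballI allI)
    show "V \<subseteq> carrier_vec ?m" using X by (auto simp: V_def)
    have "X *\<^sub>v 0\<^sub>v ?n = 0\<^sub>v ?m" using X by auto
    then show "0\<^sub>v ?m \<in> V" using Vin[of "0\<^sub>v ?n"] by simp
    fix v assume "v \<in> V"
    then obtain a where a: "a \<in> carrier_vec ?n" "v = X *\<^sub>v a" by (auto simp: V_def)
    show "c \<cdot>\<^sub>v v \<in> V" for c
      using a X Vin[of "c \<cdot>\<^sub>v a"] by (simp add: mult_mat_vec)
    show "mE M *\<^sub>v v \<in> V" "mK M *\<^sub>v v \<in> V"
      using a Nc by (auto simp: move[OF XE Mc(1) Nc(1)] move[OF XK Mc(2) Nc(2)] intro: Vin)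
    fix v' assume "v' \<in> V"
    then obtain a' where a': "a' \<in> carrier_vec ?n" "v' = X *\<^sub>v a'" by (auto simp: V_def)
    show "v + v' \<in> V"
      using a a' X Vin[of "a + a'"] by (simp add: mult_add_distrib_mat_vec)
  qed
  have moveY: "Y *\<^sub>v (A *\<^sub>v v) = B *\<^sub>v (Y *\<^sub>v v)"
    if "Y * A = B * Y" "A \<in> carrier_mat ?m ?m" "B \<in> carrier_mat ?n ?n" "v \<in> carrier_vec ?m" for A B v
    using that Y by (metis assoc_mult_mat_vec)
  have W: "submod M W"
    unfolding submod_def
  proof (intro conjI ballI allI)
    show "W \<subseteq> carrier_vec ?m" "0\<^sub>v ?m \<in> W" using Y by (auto simp: W_def)
    fix v assume v: "v \<in> W"
    have "c \<cdot>\<^sub>v 0\<^sub>v ?n = 0\<^sub>v ?n" for c :: complex by (intro eq_vecI) auto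
    then show "c \<cdot>\<^sub>v v \<in> W" for c using v Y by (simp add: W_def mult_mat_vec)
    have "B *\<^sub>v 0\<^sub>v ?n = 0\<^sub>v ?n" if "B \<in> carrier_mat ?n ?n" for B :: "complex mat" using that by auto
    then show "mE M *\<^sub>v v \<in> W" "mK M *\<^sub>v v \<in> W"
      using v Mc Nc by (auto simp: W_def moveY[OF YE Mc(1) Nc(1)] moveY[OF YK Mc(2) Nc(2)])
    fix v' assume "v' \<in> W"
    then show "v + v' \<in> W" using v Y by (simp add: W_def mult_add_distrib_mat_vec)
  qed
  have YXa: "Y *\<^sub>v (X *\<^sub>v a) = a" if "a \<in> carrier_vec ?n" for a
    using that X Y YX by (metis assoc_mult_mat_vec one_mult_mat_vec)
  have VW: "V \<inter> W = {0\<^sub>v ?m}"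
  proof
    have "0\<^sub>v ?m \<in> V" "0\<^sub>v ?m \<in> W" using V W by (auto simp: submod_def)
    then show "{0\<^sub>v ?m} \<subseteq> V \<inter> W" by simp
    show "V \<inter> W \<subseteq> {0\<^sub>v ?m}" using YXa X by (auto simp: V_def W_def)
  qed
  have rest: "v - X *\<^sub>v (Y *\<^sub>v v) \<in> W" if v: "v \<in> carrier_vec ?m" for v
  proof -
    have Yv: "Y *\<^sub>v v \<in> carrier_vec ?n" using Y v by simp
    then have "Y *\<^sub>v (v - X *\<^sub>v (Y *\<^sub>v v)) = Y *\<^sub>v v - Y *\<^sub>v (X *\<^sub>v (Y *\<^sub>v v))"
      using X Y v by (intro mult_minus_distrib_mat_vec) auto
    also have "\<dots> = 0\<^sub>v ?n" using YXa[OF Yv] Yv by simp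
    finally show ?thesis using X Y v by (simp add: W_def)
  qed
  have sum: "{v + v' | v v'. v \<in> V \<and> v' \<in> W} = carrier_vec ?m"
  proof
    show "{v + v' | v v'. v \<in> V \<and> v' \<in> W} \<subseteq> carrier_vec ?m"
      using V W by (auto simp: submod_def subset_eq)
    show "carrier_vec ?m \<subseteq> {v + v' | v v'. v \<in> V \<and> v' \<in> W}"
    proof
      fix v :: "complex vec" assume v: "v \<in> carrier_vec ?m"
      have "X *\<^sub>v (Y *\<^sub>v v) \<in> carrier_vec ?m" using X Y v by simp
      then have "v = X *\<^sub>v (Y *\<^sub>v v) + (v - X *\<^sub>v (Y *\<^sub>v v))" using v X by (intro eq_vecI) auto
      moreover have "X *\<^sub>v (Y *\<^sub>v v) \<in> V" using Y v by (intro Vin) simp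
      ultimately show "v \<in> {v + v' | v v'. v \<in> V \<and> v' \<in> W}" using rest[OF v] by blast
    qed
  qed
  have "V \<noteq> {0\<^sub>v ?m}"
  proof
    assume V0: "V = {0\<^sub>v ?m}"
    have "X *\<^sub>v unit_vec ?n 0 = 0\<^sub>v ?m" using Vin[of "unit_vec ?n 0"] V0 by simp
    then have "(unit_vec ?n 0 :: complex vec) = Y *\<^sub>v 0\<^sub>v ?m" using YXa[of "unit_vec ?n 0"] by simp
    also have "Y *\<^sub>v 0\<^sub>v ?m = 0\<^sub>v ?n" using Y by auto
    finally have "unit_vec ?n 0 $ 0 = (0\<^sub>v ?n :: complex vec) $ 0" by simp
    then show False using N(2) by simp
  qed
  then have W0: "W = {0\<^sub>v ?m}" using M V W VW sum unfolding indecomposable_def by blast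
  have XY: "X * Y = 1\<^sub>m ?m"
  proof (rule mat_eq_by_vectors)
    fix v :: "complex vec" assume v: "v \<in> carrier_vec ?m"
    have c: "X *\<^sub>v (Y *\<^sub>v v) \<in> carrier_vec ?m" using X Y v by simp
    have "v - X *\<^sub>v (Y *\<^sub>v v) = 0\<^sub>v ?m" using rest[OF v] W0 by simp
    then have "(v - X *\<^sub>v (Y *\<^sub>v v)) $ i = 0" if "i < ?m" for i using that by simp
    then have "v $ i = (X *\<^sub>v (Y *\<^sub>v v)) $ i" if "i < ?m" for i
      using that v c by (metis index_minus_vec(1) carrier_vecD eq_iff_diff_eq_0)
    then have "v = X *\<^sub>v (Y *\<^sub>v v)" using v X by (intro eq_vecI) (auto simp del: index_mult_mat_vec)
    then show "X * Y *\<^sub>v v = 1\<^sub>m ?m *\<^sub>v v" using X Y v by (simp add: assoc_mult_mat_vec)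
  qed (use X Y in auto)
  have mn: "?m = ?n" using one_sided_inverses_dim[OF X Y XY YX] .
  show ?thesis using X Y XY XE XK mn by (intro mod_isoI[where Q = Y]) auto
qed

text \<open>Let \<open>E ^ r\<close> be the last nonzero power of \<open>E\<close>. As the weight projections sum to 1, some weight
  vector \<open>x\<close> has \<open>E ^ r x \<noteq> 0\<close>, and some coordinate functional, projected to the weight of
  \<open>E ^ r x\<close>, gives a weight functional \<open>f\<close> with \<open>f (E ^ r x) = 1\<close>. The vectors \<open>E ^ t x\<close> and the
  functionals \<open>f E ^ (r - s)\<close> are biorthogonal: \<open>f (E ^ (r - s + t) x)\<close> is 0 for \<open>t > s\<close> because
  \<open>E ^ (r + 1) = 0\<close>, and for \<open>t < s\<close> because the weights of \<open>f\<close> and of its argument differ by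
  \<open>w ^ (s - t)\<close> with \<open>0 < s - t < d\<close>. They define maps from a module \<open>M_j^r\<close> to \<open>M\<close> and back, and
  \<open>split_mono_into_indecomposable\<close> applies.\<close>

lemma indecomposable_is_std_mod:
  assumes M: "indecomposable q d M"
  shows "\<exists>i u. u < d \<and> isomorphic (std_mod q i u) M"
proof -
  let ?m = "mdim M" and ?E = "mE M" and ?K = "mK M"
  have "borel_action q d M" and m: "0 < ?m"
    using M by (auto simp: indecomposable_def intro: uqp_module_borel_action)
  note B = borel_actionD[OF this(1)]
  interpret A: root_algebra scale_opr q d ..
  define e where "e = mat_opr ?m ?E"
  define k where "k = mat_opr ?m ?K"
  have op_mult: "mat_opr ?m (A * C) = mat_opr ?m A * mat_opr ?m C"
    if "A \<in> carrier_mat ?m ?m" "C \<in> carrier_mat ?m ?m" for A C using mat_opr_mult[OF m that] .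
  have e_pow: "mat_opr ?m (?E ^\<^sub>m s) = e ^ s" for s using mat_opr_pow[OF m B(2)] by (simp add: e_def)
  have k_ord: "k ^ d = 1" using mat_opr_pow[OF m B(3), of d] B(5) mat_opr_one[OF m] by (simp add: k_def)
  have ke: "k * e = scale_opr w (e * k)"
    using op_mult[OF B(3,2)] op_mult[OF B(2,3)] mat_opr_smult[OF m mult_carrier_mat[OF B(2,3)], of "q\<^sup>2"]
    by (simp add: B(6) k_def e_def w_def)
  define L where "L = (LEAST s. ?E ^\<^sub>m s = 0\<^sub>m ?m ?m)"
  have L: "?E ^\<^sub>m L = 0\<^sub>m ?m ?m" "L \<le> d"
    unfolding L_def using B(4) by (auto intro: LeastI Least_le)
  have "?E ^\<^sub>m 0 \<noteq> 0\<^sub>m ?m ?m"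
  proof
    assume "?E ^\<^sub>m 0 = 0\<^sub>m ?m ?m"
    then have "(?E ^\<^sub>m 0) $$ (0, 0) = 0" using m by simp
    then show False using m B(2) by auto
  qed
  then have "L \<noteq> 0" using L(1) by auto
  then obtain r where r: "L = Suc r" by (cases L) auto
  have rd: "r < d" using L(2) r by simp
  have Er: "?E ^\<^sub>m r \<noteq> 0\<^sub>m ?m ?m" using not_less_Least[of r "\<lambda>s. ?E ^\<^sub>m s = 0\<^sub>m ?m ?m"] r by (auto simp: L_def)
  have e_big: "e ^ s = 0" if "r < s" for s
  proof -
    have "e ^ Suc r = 0" using e_pow[of "Suc r"] L(1) r mat_opr_zero[OF m] by simp
    moreover have "s = Suc r + (s - Suc r)" using that by simp
    ultimately show ?thesis by (metis power_add mult_zero_left)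
  qed
  \<comment> \<open>The matrices behind the weight projections, which live in the ring of operators.\<close>
  define Pm where "Pm j = mat ?m ?m (\<lambda>rc. 1 / of_nat d * (\<Sum>i<d. inverse w ^ (i * j) * (?K ^\<^sub>m i) $$ rc))" for j
  have Pc: "Pm j \<in> carrier_mat ?m ?m" for j by (simp add: Pm_def)
  have P: "mat_opr ?m (Pm j) = A.weight_proj k j" for j
    unfolding Pm_def A.weight_proj_def k_def mat_opr_mat[OF m] entries_opr_scale entries_opr_sum
    unfolding mat_opr_pow[OF m B(3), symmetric] unfolding mat_opr_def ..
  have "e ^ r \<noteq> 0"
    using mat_opr_inject[of "?E ^\<^sub>m r" ?m "0\<^sub>m ?m ?m"] Er e_pow[of r] mat_opr_zero[OF m] B(2) by auto
  then have "(\<Sum>j<d. e ^ r * A.weight_proj k j) \<noteq> 0"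
    by (simp add: A.sum_weight_proj flip: sum_distrib_left)
  then obtain j where j: "j < d" "e ^ r * A.weight_proj k j \<noteq> 0"
    by (meson lessThan_iff sum.neutral)
  have EPc: "?E ^\<^sub>m s * Pm i \<in> carrier_mat ?m ?m" "Pm i * ?E ^\<^sub>m s \<in> carrier_mat ?m ?m" for s i
    using mult_carrier_mat[OF pow_carrier_mat[OF B(2)] Pc] mult_carrier_mat[OF Pc pow_carrier_mat[OF B(2)]]
    by blast+
  have EP: "mat_opr ?m (?E ^\<^sub>m s * Pm i) = e ^ s * A.weight_proj k i"
    "mat_opr ?m (Pm i * ?E ^\<^sub>m s) = A.weight_proj k i * e ^ s" for s i
    using B(2) Pc by (simp_all add: op_mult P e_pow)
  have "?E ^\<^sub>m r * Pm j \<noteq> 0\<^sub>m ?m ?m"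
    using EP(1)[of r j] j(2) mat_opr_zero[OF m] by auto
  then obtain a b where ab: "a < ?m" "b < ?m" "(?E ^\<^sub>m r * Pm j) $$ (a, b) \<noteq> 0"
    using nonzero_mat_entry[OF EPc(1)] by blast
  define c where "c = (?E ^\<^sub>m r * Pm j) $$ (a, b)"
  define l where "l = j + r"
  have key: "A.weight_proj k l * e ^ s * A.weight_proj k j = (if s = r then e ^ r * A.weight_proj k j else 0)" for s
  proof (cases "s \<le> r")
    case True
    have "l = (j + (r - s)) + s" using True by (simp add: l_def)
    then have "A.weight_proj k l * e ^ s * A.weight_proj k j
        = e ^ s * (A.weight_proj k (j + (r - s)) * A.weight_proj k j)"
      by (simp add: A.weight_proj_shift_power[OF ke] mult.assoc)
    also have "A.weight_proj k (j + (r - s)) * A.weight_proj k j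
        = (if (j + (r - s)) mod d = j then A.weight_proj k j else 0)"
      using A.weight_proj_mult[OF k_ord, of "(j + (r - s)) mod d" j] j(1) d_ge_2
      by (simp add: A.weight_proj_periodic)
    also have "(j + (r - s)) mod d = j \<longleftrightarrow> s = r"
    proof
      assume "(j + (r - s)) mod d = j"
      moreover have "(j + (r - s)) mod d = (if j + (r - s) < d then j + (r - s) else j + (r - s) - d)"
        using rd j(1) by (simp add: le_mod_geq)
      ultimately show "s = r" using rd True j(1) by (simp split: if_splits)
    qed (use j(1) in simp)
    finally show ?thesis by simp
  qed (simp add: e_big)
  \<comment> \<open>The vector \<open>x\<close> is column \<open>b\<close> of \<open>Pm j\<close>, and \<open>f\<close> is row \<open>a\<close> of \<open>Pm l\<close> divided by \<open>c\<close>; the columns of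
      \<open>X\<close> are the \<open>E ^ t x\<close>, the rows of \<open>Y\<close> the \<open>f E ^ (r - t)\<close>.\<close>
  define X where "X = mat ?m (Suc r) (\<lambda>(i, t). (?E ^\<^sub>m t * Pm j) $$ (i, b))"
  define Y where "Y = mat (Suc r) ?m (\<lambda>(t, i). (Pm l * ?E ^\<^sub>m (r - t)) $$ (a, i) / c)"
  have Xc: "X \<in> carrier_mat ?m (Suc r)" and Yc: "Y \<in> carrier_mat (Suc r) ?m" by (simp_all add: X_def Y_def)
  let ?N = "std_mod q j r"
  have Nc: "mE ?N \<in> carrier_mat (Suc r) (Suc r)" "mK ?N \<in> carrier_mat (Suc r) (Suc r)"
    by (simp_all add: std_mod_sel)
  have YX: "Y * X = 1\<^sub>m (Suc r)"
  proof (rule eq_matI)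
    fix s t assume "s < dim_row (1\<^sub>m (Suc r))" "t < dim_col (1\<^sub>m (Suc r))"
    then have st: "s < Suc r" "t < Suc r" by auto
    let ?Z = "(Pm l * ?E ^\<^sub>m (r - s)) * (?E ^\<^sub>m t * Pm j)"
    have "(Y * X) $$ (s, t) = (\<Sum>i<?m. (Pm l * ?E ^\<^sub>m (r - s)) $$ (a, i) * (?E ^\<^sub>m t * Pm j) $$ (i, b)) / c"
      unfolding mat_mult_entry[OF Yc Xc st] sum_divide_distrib
      by (intro sum.cong refl) (use st in \<open>simp add: X_def Y_def\<close>)
    also have "\<dots> = ?Z $$ (a, b) / c"
      using mat_mult_entry[OF EPc(2) EPc(1) ab(1,2)] by simp
    also have "?Z = (if s = t then ?E ^\<^sub>m r * Pm j else 0\<^sub>m ?m ?m)"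
    proof (rule mat_opr_inject[of _ ?m])
      have "mat_opr ?m ?Z = A.weight_proj k l * e ^ (r - s + t) * A.weight_proj k j"
        by (simp add: op_mult[OF EPc(2) EPc(1)] EP power_add mult.assoc)
      also have "\<dots> = (if s = t then e ^ r * A.weight_proj k j else 0)"
        using st by (auto simp: key)
      finally show "mat_opr ?m ?Z = mat_opr ?m (if s = t then ?E ^\<^sub>m r * Pm j else 0\<^sub>m ?m ?m)"
        by (simp add: EP mat_opr_zero[OF m])
    qed (use mult_carrier_mat[OF EPc(2)[of l "r - s"] EPc(1)[of t j]] EPc(1)[of r j] in auto)
    finally show "(Y * X) $$ (s, t) = 1\<^sub>m (Suc r) $$ (s, t)"
      using st ab by (auto simp: c_def)
  qed (use Xc Yc in auto)
  have XE: "X * mE ?N = ?E * X"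
  proof (rule eq_matI)
    fix i t assume "i < dim_row (?E * X)" "t < dim_col (?E * X)"
    then have it: "i < ?m" "t < Suc r" using B(2) Xc by auto
    have "(X * mE ?N) $$ (i, t) = (\<Sum>s<Suc r. if s = Suc t then X $$ (i, Suc t) else 0)"
      unfolding mat_mult_entry[OF Xc Nc(1) it] by (intro sum.cong refl) (use it in \<open>auto simp: std_mod_sel\<close>)
    also have "\<dots> = (if t < r then X $$ (i, Suc t) else 0)" by (simp del: sum.lessThan_Suc)
    also have "\<dots> = (?E ^\<^sub>m Suc t * Pm j) $$ (i, b)"
    proof (cases "t < r")
      case False
      then have "t = r" using it by simp
      then have "?E ^\<^sub>m Suc t * Pm j = 0\<^sub>m ?m ?m" using L(1) Pc[of j] r by (simp del: pow_mat.simps)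
      then show ?thesis using False it ab by simp
    qed (use it in \<open>simp add: X_def\<close>)
    also have "?E ^\<^sub>m Suc t * Pm j = ?E * (?E ^\<^sub>m t * Pm j)"
    proof -
      have "?E ^\<^sub>m Suc t = ?E * ?E ^\<^sub>m t" using pow_mat_add[OF B(2), of 1 t] B(2) by simp
      then show ?thesis using B(2) Pc[of j] by (simp only:) (intro assoc_mult_mat, auto)
    qed
    also have "\<dots> $$ (i, b) = (?E * X) $$ (i, t)"
      unfolding mat_mult_entry[OF B(2) EPc(1) it(1) ab(2)] mat_mult_entry[OF B(2) Xc it]
      by (intro sum.cong refl) (use it in \<open>simp add: X_def\<close>)
    finally show "(X * mE ?N) $$ (i, t) = (?E * X) $$ (i, t)" .
  qed (use B(2) Xc Nc in auto)
  have XK: "X * mK ?N = ?K * X"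
  proof (rule eq_matI)
    fix i t assume "i < dim_row (?K * X)" "t < dim_col (?K * X)"
    then have it: "i < ?m" "t < Suc r" using B(3) Xc by auto
    have "(X * mK ?N) $$ (i, t) = (\<Sum>s<Suc r. if s = t then w ^ (j + t) * X $$ (i, t) else 0)"
      unfolding mat_mult_entry[OF Xc Nc(2) it] by (intro sum.cong refl) (use it in \<open>auto simp: std_mod_sel\<close>)
    also have "\<dots> = w ^ (j + t) * X $$ (i, t)" using it by (simp del: sum.lessThan_Suc)
    also have "\<dots> = (w ^ (j + t) \<cdot>\<^sub>m (?E ^\<^sub>m t * Pm j)) $$ (i, b)"
      using it by (simp add: X_def smult_entry[OF EPc(1) it(1) ab(2)])
    also have "w ^ (j + t) \<cdot>\<^sub>m (?E ^\<^sub>m t * Pm j) = ?K * (?E ^\<^sub>m t * Pm j)"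
    proof (rule mat_opr_inject[of _ ?m])
      have "k * e ^ t = scale_opr (w ^ t) (e ^ t * k)" using A.q_commute_powers[OF ke, of 1 t] by simp
      then have "k * (e ^ t * A.weight_proj k j) = scale_opr (w ^ (j + t)) (e ^ t * A.weight_proj k j)"
        by (simp add: mult.assoc[symmetric] opr.scl_mult_left)
          (simp add: mult.assoc A.weight_proj_eigen_left[OF k_ord] opr.scl_mult_right power_add mult.commute)
      then show "mat_opr ?m (w ^ (j + t) \<cdot>\<^sub>m (?E ^\<^sub>m t * Pm j)) = mat_opr ?m (?K * (?E ^\<^sub>m t * Pm j))"
        by (simp add: mat_opr_smult[OF m EPc(1)] op_mult[OF B(3) EPc(1)] EP k_def)
    qed (use B(3) EPc(1)[of t j] in auto)
    also have "\<dots> $$ (i, b) = (?K * X) $$ (i, t)"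
      unfolding mat_mult_entry[OF B(3) EPc(1) it(1) ab(2)] mat_mult_entry[OF B(3) Xc it]
      by (intro sum.cong refl) (use it in \<open>simp add: X_def\<close>)
    finally show "(X * mK ?N) $$ (i, t) = (?K * X) $$ (i, t)" .
  qed (use B(3) Xc Nc in auto)
  have YE: "Y * ?E = mE ?N * Y"
  proof (rule eq_matI)
    fix t i assume "t < dim_row (mE ?N * Y)" "i < dim_col (mE ?N * Y)"
    then have ti: "t < Suc r" "i < ?m" using Nc Yc by auto
    have "(mE ?N * Y) $$ (t, i) = (\<Sum>s<Suc r. if s = t - 1 then (if 0 < t then Y $$ (t - 1, i) else 0) else 0)"
      unfolding mat_mult_entry[OF Nc(1) Yc ti] by (intro sum.cong refl) (use ti in \<open>cases t; auto simp: std_mod_sel\<close>)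
    also have "\<dots> = (if 0 < t then Y $$ (t - 1, i) else 0)"
      using less_imp_diff_less[OF ti(1), of 1] by (simp del: sum.lessThan_Suc)
    also have "\<dots> = (Pm l * ?E ^\<^sub>m Suc (r - t)) $$ (a, i) / c"
    proof (cases "0 < t")
      case True
      then have "r - (t - 1) = Suc (r - t)" using ti by simp
      then show ?thesis using True ti by (simp add: Y_def del: pow_mat.simps)
    next
      case False
      then have "Pm l * ?E ^\<^sub>m Suc (r - t) = 0\<^sub>m ?m ?m" using L(1) Pc[of l] r by (simp del: pow_mat.simps)
      then show ?thesis using False ti ab by (simp del: pow_mat.simps)
    qed
    also have "Pm l * ?E ^\<^sub>m Suc (r - t) = (Pm l * ?E ^\<^sub>m (r - t)) * ?E"
      using B(2) Pc[of l] by (simp only: pow_mat.simps) (intro assoc_mult_mat[symmetric], auto)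
    also have "\<dots> $$ (a, i) / c = (Y * ?E) $$ (t, i)"
      unfolding mat_mult_entry[OF EPc(2) B(2) ab(1) ti(2)] mat_mult_entry[OF Yc B(2) ti] sum_divide_distrib
      by (intro sum.cong refl) (use ti in \<open>simp add: Y_def\<close>)
    finally show "(Y * ?E) $$ (t, i) = (mE ?N * Y) $$ (t, i)" by simp
  qed (use B(2) Yc Nc in auto)
  have YK: "Y * ?K = mK ?N * Y"
  proof (rule eq_matI)
    fix t i assume "t < dim_row (mK ?N * Y)" "i < dim_col (mK ?N * Y)"
    then have ti: "t < Suc r" "i < ?m" using Nc Yc by auto
    have "(mK ?N * Y) $$ (t, i) = (\<Sum>s<Suc r. if s = t then w ^ (j + t) * Y $$ (t, i) else 0)"
      unfolding mat_mult_entry[OF Nc(2) Yc ti] by (intro sum.cong refl) (use ti in \<open>auto simp: std_mod_sel\<close>)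
    also have "\<dots> = w ^ (j + t) * Y $$ (t, i)" using ti by (simp del: sum.lessThan_Suc)
    also have "\<dots> = (w ^ (j + t) \<cdot>\<^sub>m (Pm l * ?E ^\<^sub>m (r - t))) $$ (a, i) / c"
      using ti by (simp add: Y_def smult_entry[OF EPc(2) ab(1) ti(2)])
    also have "w ^ (j + t) \<cdot>\<^sub>m (Pm l * ?E ^\<^sub>m (r - t)) = (Pm l * ?E ^\<^sub>m (r - t)) * ?K"
    proof (rule mat_opr_inject[of _ ?m])
      let ?s = "r - t" and ?p = "A.weight_proj k l"
      have l: "l = (j + t) + ?s" using ti by (simp add: l_def)
      have "scale_opr (w ^ ?s) (?p * e ^ ?s * k) = ?p * (k * e ^ ?s)"
        using A.q_commute_powers[OF ke, of 1 ?s] by (simp add: opr.scl_mult_right mult.assoc)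
      also have "\<dots> = (k * ?p) * e ^ ?s"
        using A.weight_proj_commute[of k k l] by (simp add: mult.assoc[symmetric])
      also have "\<dots> = scale_opr (w ^ ?s) (scale_opr (w ^ (j + t)) (?p * e ^ ?s))"
        by (simp add: A.weight_proj_eigen_left[OF k_ord] opr.scl_mult_left l power_add mult.commute)
      finally have "?p * e ^ ?s * k = scale_opr (w ^ (j + t)) (?p * e ^ ?s)"
        using w_nonzero by (simp only: opr.scale_cancel_left) simp
      then show "mat_opr ?m (w ^ (j + t) \<cdot>\<^sub>m (Pm l * ?E ^\<^sub>m (r - t))) = mat_opr ?m ((Pm l * ?E ^\<^sub>m (r - t)) * ?K)"
        by (simp add: mat_opr_smult[OF m EPc(2)] op_mult[OF EPc(2) B(3)] EP k_def)
    qed (use B(3) EPc(2)[of l "r - t"] in auto)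
    also have "\<dots> $$ (a, i) / c = (Y * ?K) $$ (t, i)"
      unfolding mat_mult_entry[OF EPc(2) B(3) ab(1) ti(2)] mat_mult_entry[OF Yc B(3) ti] sum_divide_distrib
      by (intro sum.cong refl) (use ti in \<open>simp add: Y_def\<close>)
    finally show "(Y * ?K) $$ (t, i) = (mK ?N * Y) $$ (t, i)" by simp
  qed (use B(3) Yc Nc in auto)
  have "mdim ?N = Suc r" by (simp add: std_mod_sel)
  then have "mod_iso X ?N M"
    using split_mono_into_indecomposable[OF M carrier_std_mod, where X = X and Y = Y, of j r] Xc Yc YX XE XK YE YK
    by simp
  then show ?thesis using rd by (auto simp: isomorphic_def)
qed

section \<open>Transport of indecomposability\<close>

lemma submod_twist:
  assumes "carrier_mod X" "submod X W"
  shows "submod (twist s X) W"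
proof -
  have "(s \<cdot>\<^sub>m mK X) *\<^sub>v v = s \<cdot>\<^sub>v (mK X *\<^sub>v v)" if "v \<in> W" for v
    using assms that by (intro smult_mat_vec) (auto simp: carrier_mod_def submod_def)
  then show ?thesis using assms(2) unfolding submod_def by auto
qed

lemma twist_inverse:
  assumes "s \<noteq> 0" shows "twist (inverse s) (twist s X) = X"
proof -
  have "inverse s \<cdot>\<^sub>m (s \<cdot>\<^sub>m mK X) = mK X"
    using assms by (simp add: smult_smult_mat one_smult_mat)
  then show ?thesis by (simp add: twist_def)
qed

lemma indecomposable_twist:
  assumes "s \<noteq> 0" "indecomposable q d X" "uqp_module q d (twist s X)"
  shows "indecomposable q d (twist s X)"
proof -
  have c: "carrier_mod X" using assms(2) by (auto simp: indecomposable_def intro: borel_actionD uqp_module_borel_action)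
  have "submod X W" if "submod (twist s X) W" for W
    using submod_twist[OF carrier_mod_twist[OF c] that, of "inverse s"] twist_inverse[OF assms(1)] by simp
  then show ?thesis using assms(2,3) unfolding indecomposable_def by auto
qed

text \<open>Pull a decomposition of \<open>N\<close> back along the isomorphism.\<close>

lemma indecomposable_isomorphic:
  assumes M: "indecomposable q d M" and iso: "isomorphic M N" and c: "carrier_mod N"
  shows "indecomposable q d N"
proof -
  have uM: "uqp_module q d M" and M0: "mdim M \<noteq> 0" using M by (auto simp: indecomposable_def)
  have Mc: "carrier_mod M" using uqp_module_borel_action[OF uM] by (rule borel_actionD)
  let ?n = "mdim M"
  obtain P where "mod_iso P M N" using iso by (auto simp: isomorphic_def)
  then obtain Q where Q: "mdim N = ?n" "P \<in> carrier_mat ?n ?n" "Q \<in> carrier_mat ?n ?n"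
    "P * Q = 1\<^sub>m ?n" "Q * P = 1\<^sub>m ?n" "P * mE M = mE N * P" "P * mK M = mK N * P"
    by (elim mod_isoE) auto
  note cc = carrier_modD[OF Mc] carrier_modD[OF c, unfolded Q(1)]
  have PQ: "P *\<^sub>v (Q *\<^sub>v v) = v" "Q *\<^sub>v (P *\<^sub>v v) = v" if "v \<in> carrier_vec ?n" for v
    using Q that by (metis assoc_mult_mat_vec one_mult_mat_vec)+
  define pre where "pre V = {v \<in> carrier_vec ?n. P *\<^sub>v v \<in> V}" for V
  have move: "P *\<^sub>v (A *\<^sub>v v) = B *\<^sub>v (P *\<^sub>v v)"
    if "P * A = B * P" "A \<in> carrier_mat ?n ?n" "B \<in> carrier_mat ?n ?n" "v \<in> carrier_vec ?n" for A B v
    using that Q by (metis assoc_mult_mat_vec)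
  have P0: "P *\<^sub>v 0\<^sub>v ?n = 0\<^sub>v ?n" using Q by auto
  have sub: "submod M (pre V)" if "submod N V" for V
    unfolding submod_def
  proof (intro conjI ballI allI)
    note V = that[unfolded submod_def Q(1)]
    show "pre V \<subseteq> carrier_vec ?n" "0\<^sub>v ?n \<in> pre V" using V P0 by (auto simp: pre_def)
    fix v assume v: "v \<in> pre V"
    show "a \<cdot>\<^sub>v v \<in> pre V" for a using v V Q by (auto simp: pre_def mult_mat_vec)
    show "mE M *\<^sub>v v \<in> pre V" "mK M *\<^sub>v v \<in> pre V"
      using v V cc by (auto simp: pre_def move[OF Q(6) cc(1,3)] move[OF Q(7) cc(2,4)])
    fix v' assume "v' \<in> pre V"
    then show "v + v' \<in> pre V" using v V Q by (auto simp: pre_def mult_add_distrib_mat_vec)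
  qed
  have zero: "V = {0\<^sub>v ?n}" if sV: "submod N V" and pV: "pre V = {0\<^sub>v ?n}" for V
  proof -
    note V = sV[unfolded submod_def Q(1)]
    have "v = 0\<^sub>v ?n" if "v \<in> V" for v
    proof -
      have v: "v \<in> carrier_vec ?n" using that V by auto
      then have "Q *\<^sub>v v \<in> pre V" using that Q PQ(1)[OF v] by (auto simp: pre_def)
      then have "Q *\<^sub>v v = 0\<^sub>v ?n" using pV by auto
      then show ?thesis using PQ(1)[OF v] P0 by simp
    qed
    then show ?thesis using V by auto
  qed
  show ?thesis
    unfolding indecomposable_def
  proof (intro conjI allI impI)
    show "uqp_module q d N" by (rule uqp_module_isomorphic[OF uM iso c])
    show "mdim N \<noteq> 0" using M0 Q(1) by simp
    fix V W
    assume VW: "submod N V \<and> submod N W \<and> V \<inter> W = {0\<^sub>v (mdim N)} \<and>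
       {v + w | v w. v \<in> V \<and> w \<in> W} = carrier_vec (mdim N)"
    then have V: "submod N V" and W: "submod N W" and int: "V \<inter> W = {0\<^sub>v ?n}"
      and sum: "{v + w | v w. v \<in> V \<and> w \<in> W} = carrier_vec ?n" by (auto simp: Q(1))
    have "pre V \<inter> pre W = {0\<^sub>v ?n}"
    proof
      show "{0\<^sub>v ?n} \<subseteq> pre V \<inter> pre W"
        using sub[OF V] sub[OF W] by (auto simp: submod_def)
      show "pre V \<inter> pre W \<subseteq> {0\<^sub>v ?n}"
      proof
        fix v assume v: "v \<in> pre V \<inter> pre W"
        then have "P *\<^sub>v v = 0\<^sub>v ?n" using int by (auto simp: pre_def)
        moreover have "Q *\<^sub>v 0\<^sub>v ?n = 0\<^sub>v ?n" using Q by auto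
        ultimately show "v \<in> {0\<^sub>v ?n}" using PQ(2)[of v] v by (auto simp: pre_def)
      qed
    qed
    moreover have "{v + w | v w. v \<in> pre V \<and> w \<in> pre W} = carrier_vec ?n"
    proof
      show "{v + w | v w. v \<in> pre V \<and> w \<in> pre W} \<subseteq> carrier_vec ?n" by (auto simp: pre_def)
      show "carrier_vec ?n \<subseteq> {v + w | v w. v \<in> pre V \<and> w \<in> pre W}"
      proof
        fix v :: "complex vec" assume v: "v \<in> carrier_vec ?n"
        then have "P *\<^sub>v v \<in> carrier_vec ?n" using Q by simp
        then obtain a b where ab: "P *\<^sub>v v = a + b" "a \<in> V" "b \<in> W" unfolding sum[symmetric] by blast
        have abc: "a \<in> carrier_vec ?n" "b \<in> carrier_vec ?n"
          using ab V W by (auto simp: submod_def Q(1))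
        have "v = Q *\<^sub>v (a + b)" using PQ(2)[OF v] ab by simp
        also have "\<dots> = Q *\<^sub>v a + Q *\<^sub>v b" using Q abc by (intro mult_add_distrib_mat_vec) auto
        finally have "v = Q *\<^sub>v a + Q *\<^sub>v b" .
        moreover have "Q *\<^sub>v a \<in> pre V" "Q *\<^sub>v b \<in> pre W"
          using ab Q abc PQ(1) by (auto simp: pre_def)
        ultimately show "v \<in> {v + w | v w. v \<in> pre V \<and> w \<in> pre W}" by blast
      qed
    qed
    ultimately have "pre V = {0\<^sub>v ?n} \<or> pre W = {0\<^sub>v ?n}"
      using M sub[OF V] sub[OF W] unfolding indecomposable_def by blast
    then show "V = {0\<^sub>v (mdim N)} \<or> W = {0\<^sub>v (mdim N)}" using zero[OF V] zero[OF W] Q(1) by auto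
  qed
qed

section \<open>Simple modules\<close>

lemma simple_mod_indecomposable:
  assumes "simple_mod q d S" shows "indecomposable q d S"
  unfolding indecomposable_def
proof (intro conjI allI impI)
  show "uqp_module q d S" "mdim S \<noteq> 0" using assms by (auto simp: simple_mod_def)
  fix V W
  assume VW: "submod S V \<and> submod S W \<and> V \<inter> W = {0\<^sub>v (mdim S)} \<and>
     {v + w | v w. v \<in> V \<and> w \<in> W} = carrier_vec (mdim S)"
  then have "V = {0\<^sub>v (mdim S)} \<or> V = carrier_vec (mdim S)" "W \<subseteq> carrier_vec (mdim S)"
    using assms by (auto simp: simple_mod_def submod_def)
  then show "V = {0\<^sub>v (mdim S)} \<or> W = {0\<^sub>v (mdim S)}" using VW by auto
qed

text \<open>The kernel of \<open>E\<close> is a submodule, and it is not 0 because \<open>E\<close> is nilpotent.\<close>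

lemma simple_mod_E_zero:
  assumes "simple_mod q d S" shows "mE S = 0\<^sub>m (mdim S) (mdim S)"
proof -
  let ?m = "mdim S"
  have "borel_action q d S" and m: "?m \<noteq> 0"
    using assms by (auto simp: simple_mod_def intro: uqp_module_borel_action)
  note B = borel_actionD[OF this(1)]
  define W where "W = {v \<in> carrier_vec ?m. mE S *\<^sub>v v = 0\<^sub>v ?m}"
  have z: "A *\<^sub>v 0\<^sub>v ?m = 0\<^sub>v ?m" if "A \<in> carrier_mat ?m ?m" for A :: "complex mat" using that by auto
  have sz: "c \<cdot>\<^sub>v 0\<^sub>v ?m = 0\<^sub>v ?m" for c :: complex by (intro eq_vecI) auto
  have "submod S W"
    unfolding submod_def
  proof (intro conjI ballI allI)
    show "W \<subseteq> carrier_vec ?m" "0\<^sub>v ?m \<in> W" using z[OF B(2)] by (auto simp: W_def)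
    fix v assume v: "v \<in> W"
    show "c \<cdot>\<^sub>v v \<in> W" for c using v B(2) by (auto simp: W_def mult_mat_vec sz)
    show "mE S *\<^sub>v v \<in> W" using v z[OF B(2)] by (auto simp: W_def)
    have vc: "v \<in> carrier_vec ?m" using v by (simp add: W_def)
    have "w \<cdot>\<^sub>v (mE S *\<^sub>v (mK S *\<^sub>v v)) = (w \<cdot>\<^sub>m (mE S * mK S)) *\<^sub>v v"
      using B(2,3) vc by (subst smult_mat_vec[of _ ?m ?m]) (auto simp: assoc_mult_mat_vec)
    also have "\<dots> = mK S *\<^sub>v (mE S *\<^sub>v v)"
      unfolding w_def B(6)[symmetric] using B(2,3) vc by (intro assoc_mult_mat_vec) auto
    also have "\<dots> = 0\<^sub>v ?m" using v z[OF B(3)] by (simp add: W_def)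
    finally have "inverse w \<cdot>\<^sub>v (w \<cdot>\<^sub>v (mE S *\<^sub>v (mK S *\<^sub>v v))) = 0\<^sub>v ?m" by (simp add: sz)
    then have "mE S *\<^sub>v (mK S *\<^sub>v v) = 0\<^sub>v ?m"
      using w_nonzero by (simp add: smult_smult_assoc)
    then show "mK S *\<^sub>v v \<in> W" using B(3) vc by (auto simp: W_def)
    fix v' assume "v' \<in> W"
    then show "v + v' \<in> W" using v B(2) by (auto simp: W_def mult_add_distrib_mat_vec)
  qed
  moreover have "W \<noteq> {0\<^sub>v ?m}"
  proof
    assume W0: "W = {0\<^sub>v ?m}"
    have inj: "v = 0\<^sub>v ?m" if "(mE S ^\<^sub>m k) *\<^sub>v v = 0\<^sub>v ?m" "v \<in> carrier_vec ?m" for k v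
      using that
    proof (induction k arbitrary: v)
      case 0 then show ?case using B(2) by simp
    next
      case (Suc k)
      have Ev: "mE S *\<^sub>v v \<in> carrier_vec ?m" using Suc.prems B(2) by simp
      have "(mE S ^\<^sub>m k) *\<^sub>v (mE S *\<^sub>v v) = (mE S ^\<^sub>m Suc k) *\<^sub>v v"
        unfolding pow_mat.simps using B(2) Suc.prems by (intro assoc_mult_mat_vec[symmetric]) auto
      then have "mE S *\<^sub>v v = 0\<^sub>v ?m" using Suc.IH[OF _ Ev] Suc.prems by simp
      then have "v \<in> W" using Suc.prems by (simp add: W_def)
      then show ?case using W0 by simp
    qed
    have "(mE S ^\<^sub>m d) *\<^sub>v unit_vec ?m 0 = 0\<^sub>v ?m" unfolding B(4) by (intro eq_vecI) auto
    then have "unit_vec ?m 0 = (0\<^sub>v ?m :: complex vec)" by (rule inj) simp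
    then have "unit_vec ?m 0 $ 0 = (0\<^sub>v ?m :: complex vec) $ 0" by simp
    then show False using m by simp
  qed
  ultimately have W: "W = carrier_vec ?m" using assms by (auto simp: simple_mod_def)
  show ?thesis
  proof (rule mat_eq_by_vectors[OF B(2)])
    fix v :: "complex vec" assume v: "v \<in> carrier_vec ?m"
    then have "mE S *\<^sub>v v = 0\<^sub>v ?m" using W by (auto simp: W_def)
    also have "\<dots> = 0\<^sub>m ?m ?m *\<^sub>v v" using v by (intro eq_vecI) auto
    finally show "mE S *\<^sub>v v = 0\<^sub>m ?m ?m *\<^sub>v v" .
  qed simp
qed

text \<open>A simple module is indecomposable, so it is some \<open>M_i^u\<close>; as \<open>E\<close> acts by 0, the dimension is 1,
  and \<open>K\<close> is a \<open>d\<close>-th root of unity.\<close>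

lemma simple_mod_eq_line:
  assumes "simple_mod q d S"
  obtains a where "a < d" "S = line (w ^ a)"
proof -
  have "borel_action q d S"
    using assms by (auto simp: simple_mod_def intro: uqp_module_borel_action)
  note B = borel_actionD[OF this(1)]
  obtain i u where "isomorphic (std_mod q i u) S"
    using indecomposable_is_std_mod[OF simple_mod_indecomposable[OF assms]] by blast
  then obtain P where "mod_iso P (std_mod q i u) S" by (auto simp: isomorphic_def)
  then obtain Q where P: "mdim S = Suc u" "P \<in> carrier_mat (Suc u) (Suc u)" "Q \<in> carrier_mat (Suc u) (Suc u)"
    "Q * P = 1\<^sub>m (Suc u)" "P * mE (std_mod q i u) = mE S * P"
    by (elim mod_isoE) (auto simp: std_mod_sel(1))
  let ?E = "mE (std_mod q i u)"
  have E: "?E \<in> carrier_mat (Suc u) (Suc u)" by (simp add: std_mod_sel)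
  have "?E = (Q * P) * ?E" using E P by simp
  also have "\<dots> = Q * (P * ?E)" using E P by (intro assoc_mult_mat) auto
  also have "\<dots> = 0\<^sub>m (Suc u) (Suc u)" using P simple_mod_E_zero[OF assms] by simp
  finally have E0: "?E = 0\<^sub>m (Suc u) (Suc u)" .
  have "u = 0"
  proof (rule ccontr)
    assume "u \<noteq> 0"
    then have "?E $$ (1, 0) = 1" by (simp add: std_mod_sel)
    then show False using E0 \<open>u \<noteq> 0\<close> by simp
  qed
  then have m: "mdim S = 1" using P(1) by simp
  define s where "s = mK S $$ (0, 0)"
  have K: "mK S = s \<cdot>\<^sub>m 1\<^sub>m 1" using B(3) m by (intro eq_matI) (auto simp: s_def)
  have "mK S ^\<^sub>m k = s ^ k \<cdot>\<^sub>m 1\<^sub>m 1" for k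
  proof (induction k)
    case 0 show ?case using B(3) m by (simp add: one_smult_mat)
  next
    case (Suc k)
    have "(s ^ k \<cdot>\<^sub>m 1\<^sub>m 1) * (s \<cdot>\<^sub>m 1\<^sub>m 1) = s ^ k \<cdot>\<^sub>m (1\<^sub>m 1 * (s \<cdot>\<^sub>m 1\<^sub>m 1))"
      by (intro mult_smult_assoc_mat) auto
    then show ?case using Suc by (simp add: K smult_smult_mat mult.commute)
  qed
  then have "(s ^ d \<cdot>\<^sub>m 1\<^sub>m 1) $$ (0, 0) = (1\<^sub>m 1 :: complex mat) $$ (0, 0)" using B(5) m by metis
  then have "s ^ d = 1" by simp
  then obtain a where "a < d" "s = w ^ a" by (rule root_of_unity_is_power)
  moreover have "S = line s" using m K simple_mod_E_zero[OF assms] by (simp add: line_def)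
  ultimately show ?thesis using that by blast
qed

lemma simple_mod_line: "simple_mod q d (line (w ^ a))"
  unfolding simple_mod_def
proof (intro conjI allI impI)
  have "0 < d" using d_ge_2 by simp
  then show "uqp_module q d (line (w ^ a))" unfolding line_std_mod by (rule uqp_module_std_mod)
  show "mdim (line (w ^ a)) \<noteq> 0" by simp
  fix W assume W: "submod (line (w ^ a)) W"
  then have W': "W \<subseteq> carrier_vec 1" "0\<^sub>v 1 \<in> W" "\<And>c v. v \<in> W \<Longrightarrow> c \<cdot>\<^sub>v v \<in> W"
    by (auto simp: submod_def)
  show "W = {0\<^sub>v (mdim (line (w ^ a)))} \<or> W = carrier_vec (mdim (line (w ^ a)))"
  proof (cases "W \<subseteq> {0\<^sub>v 1}")
    case True then show ?thesis using W'(2) by auto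
  next
    case False
    then obtain v where v: "v \<in> W" "v \<noteq> 0\<^sub>v 1" by auto
    then have vc: "v \<in> carrier_vec 1" using W' by auto
    have v0: "v $ 0 \<noteq> 0"
    proof
      assume "v $ 0 = 0"
      then have "v = 0\<^sub>v 1" using vc by (intro eq_vecI) auto
      then show False using v by simp
    qed
    have "x \<in> W" if "x \<in> carrier_vec 1" for x :: "complex vec"
    proof -
      have "x = (x $ 0 / v $ 0) \<cdot>\<^sub>v v" using that vc v0 by (intro eq_vecI) auto
      then show ?thesis using W'(3)[OF v(1)] by metis
    qed
    then show ?thesis using W'(1) by auto
  qed
qed

section \<open>The orbit of the extendable modules\<close>

lemma iso_class_eq:
  assumes "isomorphic M N" "carrier_mod M" "carrier_mod N"
  shows "iso_class q d M = iso_class q d N"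
proof -
  have "isomorphic L M \<longleftrightarrow> isomorphic L N" if "uqp_module q d L" for L
  proof -
    have "carrier_mod L" using uqp_module_borel_action[OF that] by (rule borel_actionD)
    then show ?thesis
      using assms isomorphic_sym[OF assms] isomorphic_trans[of L M N] isomorphic_trans[of L N M] by blast
  qed
  then show ?thesis by (auto simp: iso_class_def)
qed

text \<open>Tensor products of isomorphic modules are isomorphic, so the union runs over one and the same class.\<close>

lemma class_tensor_eq:
  assumes "uqp_module q d S" "uqp_module q d X"
  shows "class_tensor q d (iso_class q d S) (iso_class q d X) = iso_class q d (mod_tensor S X)"
proof -
  have c: "carrier_mod L" if "uqp_module q d L" for L
    using uqp_module_borel_action[OF that] by (rule borel_actionD)
  have eq: "iso_class q d (mod_tensor M N) = iso_class q d (mod_tensor S X)"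
    if "M \<in> iso_class q d S" "N \<in> iso_class q d X" for M N
  proof (rule iso_class_eq)
    have MN: "carrier_mod M" "carrier_mod N" using that c by (auto simp: iso_class_def)
    have "isomorphic M S" "isomorphic N X" using that by (auto simp: iso_class_def)
    then obtain P P' where "mod_iso P M S" "mod_iso P' N X" unfolding isomorphic_def by blast
    then show "isomorphic (mod_tensor M N) (mod_tensor S X)"
      using mod_iso_tensor MN c[OF assms(1)] c[OF assms(2)] unfolding isomorphic_def by blast
    show "carrier_mod (mod_tensor M N)" "carrier_mod (mod_tensor S X)"
      using MN c assms by (auto intro: carrier_mod_tensor)
  qed
  moreover have "S \<in> iso_class q d S" "X \<in> iso_class q d X"
    using assms c isomorphic_refl by (auto simp: iso_class_def)
  ultimately show ?thesis unfolding class_tensor_def by blast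
qed

lemma extendable_orbit_iff:
  "C \<in> extendable_orbit q d \<longleftrightarrow>
     (\<exists>a X. indecomposable q d X \<and> extendable q d X \<and> C = iso_class q d (twist (w ^ a) X))"
proof -
  have tens: "class_tensor q d (iso_class q d (line (w ^ a))) (iso_class q d X) = iso_class q d (twist (w ^ a) X)"
    if "indecomposable q d X" for a X
  proof -
    have X: "uqp_module q d X" using that by (simp add: indecomposable_def)
    moreover have "uqp_module q d (line (w ^ a))" using simple_mod_line by (simp add: simple_mod_def)
    moreover have "carrier_mod X" using uqp_module_borel_action[OF X] by (rule borel_actionD)
    ultimately show ?thesis by (simp add: class_tensor_eq line_tensor)
  qed
  show ?thesis
  proof
    assume "C \<in> extendable_orbit q d"
    then obtain X S where "indecomposable q d X" "extendable q d X" "simple_mod q d S"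
      "C = class_tensor q d (iso_class q d S) (iso_class q d X)"
      by (auto simp: extendable_orbit_def extendable_Ind_def orbit_def structure_group_def)
    then show "\<exists>a X. indecomposable q d X \<and> extendable q d X \<and> C = iso_class q d (twist (w ^ a) X)"
      using tens by (metis simple_mod_eq_line)
  next
    assume "\<exists>a X. indecomposable q d X \<and> extendable q d X \<and> C = iso_class q d (twist (w ^ a) X)"
    then obtain a X where X: "indecomposable q d X" "extendable q d X"
      and C: "C = class_tensor q d (iso_class q d (line (w ^ a))) (iso_class q d X)"
      using tens by metis
    have "iso_class q d (line (w ^ a)) \<in> carrier (structure_group q d)"
      using simple_mod_line by (auto simp: structure_group_def)
    then have "C \<in> orbit (structure_group q d) (class_tensor q d) (iso_class q d X)"
      using C by (auto simp: orbit_def)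
    moreover have "iso_class q d X \<in> extendable_Ind q d" using X by (auto simp: extendable_Ind_def)
    ultimately show "C \<in> extendable_orbit q d" by (auto simp: extendable_orbit_def)
  qed
qed

text \<open>By the classification a twist of \<open>X\<close> is isomorphic to some \<open>M_i^u\<close>, hence a module for the
  subalgebra \<open>u_q^+\<close>.\<close>

lemma extendable_orbit_subset_Ind: "extendable_orbit q d \<subseteq> Ind q d"
proof
  fix C assume "C \<in> extendable_orbit q d"
  then obtain a X where X: "indecomposable q d X" and C: "C = iso_class q d (twist (w ^ a) X)"
    unfolding extendable_orbit_iff by blast
  have Xu: "uqp_module q d X" using X by (simp add: indecomposable_def)
  have Xc: "carrier_mod X" using uqp_module_borel_action[OF Xu] by (rule borel_actionD)
  obtain i u where iu: "u < d" "isomorphic (std_mod q i u) X" using indecomposable_is_std_mod[OF X] by blast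
  then obtain P where P: "mod_iso P (std_mod q i u) X" by (auto simp: isomorphic_def)
  have "mod_iso (kron (1\<^sub>m 1) P) (mod_tensor (line (w ^ a)) (std_mod q i u)) (mod_tensor (line (w ^ a)) X)"
    using mod_iso_tensor[OF mod_iso_refl[OF carrier_mod_line] P carrier_mod_line carrier_mod_line carrier_std_mod Xc]
    by simp
  then have "isomorphic (std_mod q (a + i) u) (twist (w ^ a) X)"
    by (auto simp: isomorphic_def line_tensor[OF Xc] line_tensor[OF carrier_std_mod] twist_std_mod)
  then have "uqp_module q d (twist (w ^ a) X)"
    by (rule uqp_module_isomorphic[OF uqp_module_std_mod[OF iu(1)] _ carrier_mod_twist[OF Xc]])
  then have "indecomposable q d (twist (w ^ a) X)"
    using indecomposable_twist[OF _ X] w_nonzero by simp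
  then show "C \<in> Ind q d" using C by (auto simp: Ind_def)
qed

lemma std_mod_factorization:
  assumes "u < d" "odd d \<or> even u"
  obtains a c F where "std_mod q i u = twist (w ^ a) (std_mod q c u)" "uq_extension q d (std_mod q c u) F"
proof -
  obtain c where c: "w ^ (2 * c + u) = 1" using symmetric_shift_exists[OF assms] by blast
  then obtain F where F: "uq_extension q d (std_mod q c u) F"
    using uq_extension_std_mod[OF assms(1) weights_symmetric] by blast
  \<comment> \<open>\<open>a = i - c\<close> modulo \<open>d\<close>\<close>
  define a where "a = i + (d - 1) * c"
  have "a + c = i + d * c" using d_ge_2 by (cases d) (auto simp: a_def algebra_simps)
  then have "w ^ (a + c) = w ^ i" by (simp only: power_add power_mult w_power_d power_one mult_1_right)
  then have "std_mod q i u = twist (w ^ a) (std_mod q c u)"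
    unfolding twist_std_mod by (intro std_mod_cong) simp
  then show ?thesis using that F by blast
qed

lemma indecomposable_in_extendable_orbit:
  assumes M: "indecomposable q d M" and parity: "odd d \<or> odd (mdim M)"
  shows "iso_class q d M \<in> extendable_orbit q d"
proof -
  have Mu: "uqp_module q d M" using M by (simp add: indecomposable_def)
  have Mc: "carrier_mod M" using uqp_module_borel_action[OF Mu] by (rule borel_actionD)
  obtain i u where iu: "u < d" "isomorphic (std_mod q i u) M" using indecomposable_is_std_mod[OF M] by blast
  have "mdim M = Suc u" using isomorphic_dim[OF iu(2)] by (simp add: std_mod_sel)
  then have "odd d \<or> even u" using parity by simp
  then obtain a c F where f: "std_mod q i u = twist (w ^ a) (std_mod q c u)" "uq_extension q d (std_mod q c u) F"
    using std_mod_factorization[OF iu(1)] by metis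
  have "indecomposable q d (std_mod q i u)"
    using indecomposable_isomorphic[OF M isomorphic_sym[OF iu(2) carrier_std_mod Mc] carrier_std_mod] .
  then have U: "indecomposable q d (twist (w ^ a) (std_mod q c u))" unfolding f(1) .
  have "uqp_module q d (twist (inverse (w ^ a)) (twist (w ^ a) (std_mod q c u)))"
    using uqp_module_std_mod[OF iu(1), of c] w_nonzero by (simp add: twist_inverse)
  then have "indecomposable q d (twist (inverse (w ^ a)) (twist (w ^ a) (std_mod q c u)))"
    using w_nonzero by (intro indecomposable_twist[OF _ U]) simp
  then have "indecomposable q d (std_mod q c u)" using w_nonzero by (simp add: twist_inverse)
  moreover have "extendable q d (std_mod q c u)"
    using f(2) uqp_module_std_mod[OF iu(1)] by (auto simp: extendable_def)
  moreover have "iso_class q d M = iso_class q d (twist (w ^ a) (std_mod q c u))"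
    using iso_class_eq[OF iu(2) carrier_std_mod Mc] f(1) by simp
  ultimately show ?thesis unfolding extendable_orbit_iff by blast
qed

section \<open>The induced isomorphisms\<close>

text \<open>The simple factor of any factorization is some \<open>line s\<close>, so the module is a twist of \<open>X\<close>.\<close>

lemma factorizationD:
  assumes "factorization q d M S X F"
  obtains s where "s ^ d = 1" "S = line s" "sl2_action q d X F" "carrier_mod X" "borel_action q d X"
    "isomorphic M (twist s X)" "mdim X = mdim M"
proof -
  obtain a where a: "S = line (w ^ a)" using assms simple_mod_eq_line by (metis factorization_def)
  have F: "sl2_action q d X F" using assms by (auto simp: factorization_def intro: uq_extension_sl2_action)
  then have B: "borel_action q d X" by (simp add: sl2_action_def)
  note c = borel_actionD(1)[OF B]
  have i: "isomorphic M (twist (w ^ a) X)" using assms a by (simp add: factorization_def line_tensor[OF c])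
  have "(w ^ a) ^ d = 1" by (metis power_mult mult.commute w_power_d power_one)
  then show ?thesis using that a F B c i isomorphic_dim[OF i] by simp
qed

lemma simple_mod_line_root: "s ^ d = 1 \<Longrightarrow> simple_mod q d (line s)"
  by (metis root_of_unity_is_power simple_mod_line)

lemma isomorphic_line:
  assumes "isomorphic (line s) (line t)" shows "s = t"
proof -
  obtain P where "mod_iso P (line s) (line t)" using assms by (auto simp: isomorphic_def)
  then obtain Q where P: "P \<in> carrier_mat 1 1" "Q \<in> carrier_mat 1 1" "P * Q = 1\<^sub>m 1"
    "P * (s \<cdot>\<^sub>m 1\<^sub>m 1) = (t \<cdot>\<^sub>m 1\<^sub>m 1) * P"
    by (elim mod_isoE) auto
  have "(P * Q) $$ (0, 0) = P $$ (0, 0) * Q $$ (0, 0)"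
    using mat_mult_entry[OF P(1,2), of 0 0] by simp
  then have "P $$ (0, 0) \<noteq> 0" using P(3) by auto
  moreover have "P $$ (0, 0) * s = t * P $$ (0, 0)"
    using arg_cong[OF P(4), of "\<lambda>A. A $$ (0, 0)"] mat_mult_entry[of P 1 1 "s \<cdot>\<^sub>m 1\<^sub>m 1" 1 0 0]
      mat_mult_entry[of "t \<cdot>\<^sub>m 1\<^sub>m 1" 1 1 P 1 0 0] P(1) by simp
  ultimately show ?thesis by simp
qed

lemma isomorphic_tensor_of_twists:
  assumes "isomorphic M (twist s X)" "isomorphic N (twist t Y)"
    and "borel_action q d X" "borel_action q d Y" "carrier_mod M" "carrier_mod N" "t ^ d = 1"
  shows "isomorphic (mod_tensor M N) (twist (s * t) (mod_tensor X Y))"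
proof -
  note X = borel_actionD(1)[OF assms(3)] and Y = borel_actionD(1)[OF assms(4)]
  have "isomorphic (mod_tensor M N) (mod_tensor (twist s X) (twist t Y))"
    using assms mod_iso_tensor carrier_mod_twist[OF X] carrier_mod_twist[OF Y] unfolding isomorphic_def by blast
  moreover have "isomorphic (mod_tensor (twist s X) (twist t Y)) (twist (s * t) (mod_tensor X Y))"
    using mod_iso_twist_tensor[OF root_of_unity_axioms assms(3) Y assms(7)] unfolding isomorphic_def .
  ultimately show ?thesis
    by (rule isomorphic_trans) (use assms X Y in \<open>auto intro: carrier_mod_tensor carrier_mod_twist\<close>)
qed

text \<open>Both outer isomorphisms are instances of \<open>isomorphic_tensor_of_twists\<close>, the second one with the
  roles of the factors exchanged and then inverted. The middle map is the braiding tensored with the identity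
  of the simple module.\<close>

lemma braiding_induces_iso_factorizable:
  assumes M: "carrier_mod M" "0 < mdim M" "\<exists>S X F. factorization q d M S X F"
    and N: "carrier_mod N" "0 < mdim N" "\<exists>S X F. factorization q d N S X F"
  shows "braiding_induces_iso q d M N"
  unfolding braiding_induces_iso_def
proof (intro conjI allI impI)
  show "\<exists>S X F. factorization q d M S X F" "\<exists>S X F. factorization q d N S X F" using M N by auto
  fix S' X FX S'' Y FY
  assume "factorization q d M S' X FX \<and> factorization q d N S'' Y FY"
  then have fM: "factorization q d M S' X FX" and fN: "factorization q d N S'' Y FY" by auto
  obtain s where s: "s ^ d = 1" "S' = line s" "sl2_action q d X FX" "carrier_mod X" "borel_action q d X"
    "isomorphic M (twist s X)" "mdim X = mdim M" using fM by (rule factorizationD)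
  obtain t where t: "t ^ d = 1" "S'' = line t" "sl2_action q d Y FY" "carrier_mod Y" "borel_action q d Y"
    "isomorphic N (twist t Y)" "mdim Y = mdim N" using fN by (rule factorizationD)
  have st: "(s * t) ^ d = 1" using s t by (simp add: power_mult_distrib)
  have line: "mod_tensor S' S'' = line (s * t)"
    using s t carrier_mod_line[of t] by (simp add: line_tensor) (simp add: twist_def line_def smult_smult_mat)
  show "\<exists>S. simple_mod q d S \<and> isomorphic S (mod_tensor S' S'')"
    unfolding line using simple_mod_line_root[OF st] isomorphic_refl[OF carrier_mod_line] by blast
  fix S assume "simple_mod q d S \<and> isomorphic S (mod_tensor S' S'')"
  then have S: "S = line (s * t)"
    unfolding line using isomorphic_line simple_mod_eq_line by metis
  have XYc: "carrier_mod (mod_tensor X Y)" "carrier_mod (mod_tensor Y X)"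
    "carrier_mod (mod_tensor M N)" "carrier_mod (mod_tensor N M)"
    using s t M N by (auto intro: carrier_mod_tensor)
  have SXY: "mod_tensor S (mod_tensor X Y) = twist (s * t) (mod_tensor X Y)"
    "mod_tensor S (mod_tensor Y X) = twist (s * t) (mod_tensor Y X)"
    unfolding S using XYc by (simp_all add: line_tensor)
  show "\<exists>\<alpha>. mod_iso \<alpha> (mod_tensor M N) (mod_tensor S (mod_tensor X Y))"
    unfolding SXY isomorphic_def[symmetric] by (rule isomorphic_tensor_of_twists) (use s t M N in auto)
  have "isomorphic (mod_tensor N M) (twist (s * t) (mod_tensor Y X))"
    using isomorphic_tensor_of_twists[OF t(6) s(6) t(5) s(5) N(1) M(1) s(1)] by (simp add: mult.commute)
  then show "\<exists>\<beta>. mod_iso \<beta> (mod_tensor S (mod_tensor Y X)) (mod_tensor N M)"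
    unfolding SXY isomorphic_def[symmetric] by (rule isomorphic_sym) (use XYc in \<open>auto intro: carrier_mod_twist\<close>)
  fix \<alpha> \<beta>
  assume "mod_iso \<alpha> (mod_tensor M N) (mod_tensor S (mod_tensor X Y)) \<and>
    mod_iso \<beta> (mod_tensor S (mod_tensor Y X)) (mod_tensor N M)"
  then have \<alpha>: "mod_iso \<alpha> (mod_tensor M N) (mod_tensor S (mod_tensor X Y))"
    and \<beta>: "mod_iso \<beta> (mod_tensor S (mod_tensor Y X)) (mod_tensor N M)" by auto
  have "mod_iso (braiding q d X Y FY) (mod_tensor X Y) (mod_tensor Y X)"
    using mod_iso_braiding[OF root_of_unity_axioms s(5) t(3)] s(7) t(7) M(2) N(2) by simp
  then have "mod_iso (kron (1\<^sub>m (mdim S)) (braiding q d X Y FY)) (mod_tensor S (mod_tensor X Y)) (mod_tensor S (mod_tensor Y X))"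
    using mod_iso_tensor[OF mod_iso_refl] XYc carrier_mod_line unfolding S by blast
  from mod_iso_comp[OF this \<beta>] have \<gamma>: "mod_iso (\<beta> * kron (1\<^sub>m (mdim S)) (braiding q d X Y FY)) (mod_tensor S (mod_tensor X Y)) (mod_tensor N M)"
    using XYc carrier_mod_line unfolding S by (auto intro: carrier_mod_tensor)
  show "mod_iso (\<beta> * kron (1\<^sub>m (mdim S)) (braiding q d X Y FY) * \<alpha>) (mod_tensor M N) (mod_tensor N M)"
    by (rule mod_iso_comp[OF \<alpha> \<gamma>]) (use XYc carrier_mod_line in \<open>auto simp: S intro: carrier_mod_tensor\<close>)
qed

lemma braiding_induces_iso_std_mod:
  assumes "u < d" "odd d \<or> even u" "v < d" "odd d \<or> even v"
  shows "braiding_induces_iso q d (std_mod q i u) (std_mod q j v)"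
proof -
  have "\<exists>S X F. factorization q d (std_mod q k t) S X F" if t: "t < d" "odd d \<or> even t" for k t
  proof -
    obtain a c F where f: "std_mod q k t = twist (w ^ a) (std_mod q c t)" "uq_extension q d (std_mod q c t) F"
      using std_mod_factorization[OF t] by metis
    have "factorization q d (std_mod q k t) (line (w ^ a)) (std_mod q c t) F"
      unfolding factorization_def extendable_def
      using f simple_mod_line uqp_module_std_mod[OF t(1)] isomorphic_refl[OF carrier_mod_twist[OF carrier_std_mod]]
      by (auto simp: line_tensor[OF carrier_std_mod])
    then show ?thesis by blast
  qed
  then show ?thesis
    using assms by (intro braiding_induces_iso_factorizable) (auto simp: carrier_std_mod std_mod_sel(1))
qed

end

theorem corollary4p1:
  fixes q :: complex and n d :: nat
  assumes "n \<ge> 3" and "n \<noteq> 4"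
    and "q ^ n = 1" and "\<forall>k. 0 < k \<and> k < n \<longrightarrow> q ^ k \<noteq> 1"
    and "d = (if odd n then n else n div 2)"
  shows
    "(odd d \<longrightarrow>
        extendable_orbit q d = Ind q d \<and>
        (\<forall>i<d. \<forall>j<d. \<forall>u\<le>d - 1. \<forall>v\<le>d - 1.
           braiding_induces_iso q d (std_mod q i u) (std_mod q j v))) \<and>
     (even d \<longrightarrow>
        {iso_class q d M | M. indecomposable q d M \<and> odd (mdim M)} \<subseteq> extendable_orbit q d \<and>
        (\<forall>i<d. \<forall>j<d. \<forall>u\<le>d - 1. \<forall>v\<le>d - 1. even u \<and> even v \<longrightarrow>
           braiding_induces_iso q d (std_mod q i u) (std_mod q j v)))"
proof -
  have root: "root_of_unity q d"
  proof
    show "2 \<le> d" using assms(1,5) by auto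
    show "(q\<^sup>2) ^ d = 1"
    proof (cases "odd n")
      case True
      then have "(q\<^sup>2) ^ d = (q ^ n) ^ 2" using assms(5) by (simp add: mult.commute flip: power_mult)
      then show ?thesis by (simp add: assms(3))
    next
      case False
      then have "(q\<^sup>2) ^ d = q ^ n" using assms(5) by (simp flip: power_mult)
      then show ?thesis by (simp add: assms(3))
    qed
    show "(q\<^sup>2) ^ k \<noteq> 1" if k: "0 < k" "k < d" for k
    proof
      assume *: "(q\<^sup>2) ^ k = 1"
      then have qk: "q ^ (2 * k) = 1" by (simp add: power_mult)
      show False
      proof (cases "2 * k < n")
        case True then show False using assms(4) qk k(1) by auto
      next
        \<comment> \<open>Here \<open>n\<close> is odd and \<open>n < 2 k < 2 n\<close>, so \<open>q ^ (2 k - n) = 1\<close> contradicts primitivity.\<close>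
        case False
        then have odd: "odd n" and nk: "n < 2 * k" "k < n"
          using assms(5) k by (auto split: if_splits simp: not_less le_less) 
        have "q ^ n * q ^ (2 * k - n) = 1" using qk nk by (simp flip: power_add)
        then have "q ^ (2 * k - n) = 1" by (simp add: assms(3))
        then show False using assms(4) nk by auto
      qed
    qed
  qed
  then interpret root_of_unity q d .
  have le: "u < d" if "u \<le> d - 1" for u using that d_ge_2 by simp
  have "Ind q d \<subseteq> extendable_orbit q d" if "odd d"
    using indecomposable_in_extendable_orbit that by (auto simp: Ind_def)
  then show ?thesis
    using extendable_orbit_subset_Ind indecomposable_in_extendable_orbit braiding_induces_iso_std_mod le
    by auto
qed

end
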